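(* Fix an integer $k \geq 0$. There is a polynomial-time algorithm which, on input a word $w$ on the letters $A_0^{\pm1}, \ldots, A_k^{\pm1}$, declares whether or not $w(0)$ represents an integer (that is, whether or not $w$ is valid), and if so whether $w(0) <0$, $w(0)=0$ or $w(0)>0$.
   Context: $\mathbb{N}=\{0,1,2,\ldots\}$. The Ackermann functions $A_0, A_1:\mathbb{Z}\to\mathbb{Z}$ and $A_i:\mathbb{N}\to\mathbb{N}$ ($i\ge 2$) are defined by: $A_0(n)=n+1$ and $A_1(n)=2n$ for all $n\in\mathbb{Z}$; $A_i(0)=1$ for all $i\ge 2$; and $A_{i+1}(n+1)=A_i(A_{i+1}(n))$ for all $n\ge 0$ and $i\ge 1$. They are injective, so have partial inverses: $A_0^{-1}:\mathbb{Z}\to\mathbb{Z}$, $n\mapsto n-1$; $A_1^{-1}:2\mathbb{Z}\to\mathbb{Z}$, $n\mapsto n/2$; and $A_i^{-1}:\operatorname{Img}A_i\to\mathbb{N}$ for $i\ge 2$. A word $w=x_nx_{n-1}\cdots x_1$ with each $x_j\in\{A_0^{\pm1},\ldots,A_k^{\pm1}\}$ is evaluated at $0$ from right to left by applying $x_1$, then $x_2$, and so on. It is valid (equivalently, $w(0)$ represents an integer) if $x_mx_{m-1}\cdots x_1(0)$ is defined for all $0\le m\le n$, i.e. no $x_j$ is ever applied to an integer outside its domain; in that case $w(0)$ denotes the resulting integer. "Polynomial-time" means the running time is bounded by a polynomial (which may depend on $k$) in the length $\ell(w)=n$ of $w$. *)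

theory Defs
  imports "HOL-Computational_Algebra.Polynomial"
begin

subsection \<open>Ackermann functions and words in their partial inverses\<close>

text \<open>Values on the natural numbers. For indices 0 and 1 the functions live on all integers
  (see \<open>A\<close> below); the first two clauses are their restrictions, on which the recursion
  for the higher indices rests.\<close>

fun ack :: "nat \<Rightarrow> nat \<Rightarrow> nat" where
  "ack 0 n = n + 1"
| "ack (Suc 0) n = 2 * n"
| "ack (Suc (Suc i)) 0 = 1"
| "ack (Suc (Suc i)) (Suc n) = ack (Suc i) (ack (Suc (Suc i)) n)"

definition A_dom :: "nat \<Rightarrow> int set" where
  "A_dom i = (if i \<le> 1 then UNIV else {0..})"

text \<open>For \<open>i \<ge> 2\<close> the value of \<open>A i\<close> matters only on \<open>A_dom i\<close>.\<close>

definition A :: "nat \<Rightarrow> int \<Rightarrow> int" where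
  "A i n = (if i = 0 then n + 1 else if i = 1 then 2 * n else int (ack i (nat n)))"

lemma A_0: "A 0 n = n + 1"
  and A_1: "A 1 n = 2 * n"
  and A_at_0: "i \<ge> 2 \<Longrightarrow> A i 0 = 1"
proof -
  show "A 0 n = n + 1" "A 1 n = 2 * n" by (simp_all add: A_def)
  assume "i \<ge> 2"
  then obtain j where "i = Suc (Suc j)" by (metis add_2_eq_Suc le_Suc_ex)
  then show "A i 0 = 1" by (simp add: A_def)
qed

lemma A_int: "A i (int n) = int (ack i n)"
proof (cases i)
  case (Suc j)
  then show ?thesis by (cases j) (simp_all add: A_def)
qed (simp add: A_def)

lemma A_rec:
  assumes "n \<ge> 0" "i \<ge> 1"
  shows "A (i + 1) (n + 1) = A i (A (i + 1) n)"
proof -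
  obtain m where m: "n = int m" using assms(1) nonneg_int_cases by blast
  obtain j where j: "i = Suc j" using assms(2) by (metis One_nat_def Suc_le_D)
  have "A (i + 1) (n + 1) = int (ack (Suc (Suc j)) (Suc m))"
    using A_int[of "i + 1" "Suc m"] by (simp add: m j add.commute)
  then show ?thesis by (simp add: m j A_int)
qed

lemma ack_less_Suc: "ack i n < ack i (Suc n) \<and> (i \<ge> 2 \<longrightarrow> n < ack i n)"
proof (induction i arbitrary: n)
  case (Suc i)
  show ?case
  proof (cases i)
    case (Suc j)
    have mono: "strict_mono (ack i)" using Suc.IH by (simp add: strict_mono_Suc_iff)
    have ge: "x < ack i x" if "x > 0" for x
      using that Suc.IH[of x] Suc by (cases j) auto
    have gt: "m < ack (Suc i) m" for m
    proof (induction m)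
      case (Suc m)
      then show ?case using ge[of "ack (Suc i) m"] \<open>i = Suc j\<close> by simp
    qed (simp add: \<open>i = Suc j\<close>)
    show ?thesis using gt[of n] gt[of "Suc n"] ge[OF le_less_trans[OF le0 gt[of n]]] \<open>i = Suc j\<close> by simp
  qed simp
qed simp

lemma inj_on_A: "inj_on (A i) (A_dom i)"
proof -
  have "inj (ack i)"
    using ack_less_Suc strict_mono_imp_inj_on by (metis strict_mono_Suc_iff)
  then show ?thesis
    by (auto simp: inj_on_def A_def A_dom_def) (metis int_nat_eq)
qed

definition A_inv :: "nat \<Rightarrow> int \<Rightarrow> int option" where
  "A_inv i m = (if m \<in> A i ` A_dom i then Some (the_inv_into (A_dom i) (A i) m) else None)"

datatype letter = Ack nat | AckInv nat

fun index :: "letter \<Rightarrow> nat" where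
  "index (Ack i) = i"
| "index (AckInv i) = i"

fun apply_letter :: "letter \<Rightarrow> int \<Rightarrow> int option" where
  "apply_letter (Ack i) n = (if n \<in> A_dom i then Some (A i n) else None)"
| "apply_letter (AckInv i) n = A_inv i n"

text \<open>A word is listed as it is written, so its last letter is applied first.\<close>

fun eval_word :: "letter list \<Rightarrow> int \<Rightarrow> int option" where
  "eval_word [] n = Some n"
| "eval_word (x # w) n = Option.bind (eval_word w n) (apply_letter x)"

definition valid :: "letter list \<Rightarrow> bool" where
  "valid w \<longleftrightarrow> (\<forall>m \<le> length w. eval_word (drop (length w - m) w) 0 \<noteq> None)"

lemma valid_iff: "valid w \<longleftrightarrow> eval_word w 0 \<noteq> None"
proof
  assume "valid w"
  then show "eval_word w 0 \<noteq> None" by (auto simp: valid_def dest: spec[of _ "length w"])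
next
  have *: "eval_word (u @ v) 0 \<noteq> None \<Longrightarrow> eval_word v 0 \<noteq> None" for u v
    by (induction u) (auto simp: bind_eq_Some_conv)
  assume "eval_word w 0 \<noteq> None"
  then show "valid w"
    using * by (metis append_take_drop_id valid_def)
qed

definition words :: "nat \<Rightarrow> letter list set" where
  "words k = {w. \<forall>x \<in> set w. index x \<le> k}"

datatype verdict = Invalid | Negative | Zero | Positive

definition verdict_of :: "letter list \<Rightarrow> verdict" where
  "verdict_of w =
    (if \<not> valid w then Invalid
     else let n = the (eval_word w 0) in
       if n < 0 then Negative else if n = 0 then Zero else Positive)"

subsection \<open>Polynomial time on deterministic multitape Turing machines\<close>

datatype direction = MoveLeft | Stay | MoveRight

text \<open>States, tape symbols and tapes are numbered from 0; state 0 is initial and symbol 0 is the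
  blank. A state \<open>q\<close> is halting iff \<open>answer M q\<close> is some \<open>v\<close>, and the machine then
  outputs \<open>v\<close> (for a two-element answer type: the accepting and rejecting states).
  Tape 0 is the input tape; all tapes are two-way infinite and may be written.\<close>

record 'v tm =
  num_tapes :: nat
  num_states :: nat
  num_symbols :: nat
  trans :: "nat \<Rightarrow> nat list \<Rightarrow> nat \<times> (nat \<times> direction) list"
  answer :: "nat \<Rightarrow> 'v option"

definition wf_tm :: "'v tm \<Rightarrow> bool" where
  "wf_tm M \<longleftrightarrow>
    num_tapes M > 0 \<and> num_states M > 0 \<and> num_symbols M > 0 \<and>
    (\<forall>q < num_states M. \<forall>rs. length rs = num_tapes M \<and> set rs \<subseteq> {..<num_symbols M} \<longrightarrow>
      (case trans M q rs of (q', acts) \<Rightarrow>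
        q' < num_states M \<and> length acts = num_tapes M \<and> fst ` set acts \<subseteq> {..<num_symbols M}))"

text \<open>A tape is its contents together with the head position.\<close>

type_synonym tape = "(int \<Rightarrow> nat) \<times> int"
type_synonym config = "nat \<times> tape list"

fun head_shift :: "direction \<Rightarrow> int" where
  "head_shift MoveLeft = -1"
| "head_shift Stay = 0"
| "head_shift MoveRight = 1"

definition read_tape :: "tape \<Rightarrow> nat" where
  "read_tape t = fst t (snd t)"

definition act_tape :: "tape \<Rightarrow> nat \<times> direction \<Rightarrow> tape" where
  "act_tape t a = ((fst t)(snd t := fst a), snd t + head_shift (snd a))"

definition step :: "'v tm \<Rightarrow> config \<Rightarrow> config" where
  "step M c = (case c of (q, ts) \<Rightarrow>
    if answer M q \<noteq> None then c
    else case trans M q (map read_tape ts) of (q', acts) \<Rightarrow> (q', map2 act_tape ts acts))"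

definition input_tape :: "nat list \<Rightarrow> tape" where
  "input_tape xs = ((\<lambda>p. if 0 \<le> p \<and> p < int (length xs) then xs ! nat p else 0), 0)"

definition start_config :: "'v tm \<Rightarrow> nat list \<Rightarrow> config" where
  "start_config M xs = (0, input_tape xs # replicate (num_tapes M - 1) (input_tape []))"

definition outputs_within :: "'v tm \<Rightarrow> nat list \<Rightarrow> nat \<Rightarrow> 'v \<Rightarrow> bool" where
  "outputs_within M xs t v \<longleftrightarrow> answer M (fst ((step M ^^ t) (start_config M xs))) = Some v"

text \<open>The encoding \<open>enc\<close> turns each input letter into a single nonblank tape symbol, so the
  input occupies exactly \<open>length w\<close> cells.\<close>

definition poly_time_computable ::
    "('a \<Rightarrow> nat) \<Rightarrow> 'a list set \<Rightarrow> ('a list \<Rightarrow> 'v) \<Rightarrow> bool" where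
  "poly_time_computable enc D f \<longleftrightarrow>
    (\<exists>(M :: 'v tm) (p :: nat poly). wf_tm M \<and>
      (\<forall>w \<in> D. enc ` set w \<subseteq> {0<..<num_symbols M} \<and>
        outputs_within M (map enc w) (poly p (length w)) (f w)))"

fun letter_code :: "letter \<Rightarrow> nat" where
  "letter_code (Ack i) = 2 * i + 1"
| "letter_code (AckInv i) = 2 * i + 2"

lemma inj_letter_code: "inj letter_code"
proof (rule injI)
  fix x y assume "letter_code x = letter_code y"
  then show "x = y" by (cases x; cases y) (simp_all, presburger+)
qed

end

theory Submission
  imports Defs
begin

text \<open>The value of a prefix of the word is kept either as an explicit binary integer or, once it is
  too large for that, in layers \<open>b + A r\<^sub>1 (c\<^sub>1 + A r\<^sub>2 (c\<^sub>2 + \<dots>))\<close> with binary offsets,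
  where every \<open>A r x\<close> exceeds \<open>2 ^ B\<close> and all offsets have fewer than \<open>B - 1\<close> bits.
  A layer value is a power of two, and the offset is too small to reach another one; so a layered
  number with nonzero offset is outside the image of each \<open>A i\<close>, \<open>i \<ge> 2\<close>, and its sign is positive.
  If moreover each layer carries the largest index \<open>r \<le> k\<close> with its value in the image of
  \<open>A r\<close>, then a number with offset 0 and top index \<open>r\<close> is in the image of \<open>A i\<close> exactly if
  \<open>i \<le> r\<close>. Both operations reduce to the next higher index, by
  \<open>A i x = A (i + 1) (y + 1)\<close> and \<open>A_inv i x = A (i + 1) (y - 1)\<close> for \<open>x = A (i + 1) y\<close>,
  hence cost boundedly many elementary steps per letter. The bound \<open>B\<close> is linear in the length
  of the word and decreases by one with each letter, since halving may halve a layer.\<close>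

subsection \<open>A command language for stacks and its Turing machines\<close>

text \<open>The obstacle is that intermediate values can be towers of exponentials although the
  result is small, and that membership of such a value in an image has to be decided without its
  digits. Passing to the next higher index, rather than unfolding the recursion downwards, makes the
  procedure end at \<open>k\<close>: no index lies above it, so there an inverse of a layered number
  just removes the top layer or fails, and a large application just opens a layer. Each level
  doubles the work of the next higher one and adds a shift by one, so an operation of index
  \<open>k + 1 - d\<close> lengthens the offsets by at most \<open>2 ^ d - 1\<close> bits, and
  \<open>2 ^ k\<close> suffices for every letter. After \<open>j\<close> letters the offsets have at
  most \<open>j * 2 ^ k\<close> bits while the threshold has dropped to \<open>B - j\<close>;
  keeping them apart for \<open>n\<close> letters leads to the initial bound
  \<open>(2 ^ k + 1) * n + 2\<close>. How many layers there are does not matter for the running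
  time, as each elementary step touches only the top of a stack. Explicit numbers are evaluated and
  inverted by iterating the lower indices; these loops are short since \<open>A i\<close> with
  \<open>i \<ge> 2\<close> grows at least like \<open>2 ^ n\<close>.\<close>

datatype com =
    Skip
  | Seq com com (infixr ";;" 60)
  | Cond nat "nat set" com com
  | Loop nat "nat set" com
  | Psh nat nat "nat \<Rightarrow> nat"
  | Pop nat
  | Wr nat nat

type_synonym stacks = "nat \<Rightarrow> nat list"

definition peek :: "nat list \<Rightarrow> nat" where
  "peek xs = (case xs of [] \<Rightarrow> 0 | x # _ \<Rightarrow> x)"

lemma peek_simps [simp]: "peek [] = 0" "peek (x # xs) = x"
  by (simp_all add: peek_def)

text \<open>The time is the exact number of single steps of the continuation machine below;
  unfolding a control structure costs one. Pushing the symbol 0, the bottom of every stack, and a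
  bare \<open>Wr\<close> have no derivation.\<close>

inductive exec :: "com \<Rightarrow> stacks \<Rightarrow> nat \<Rightarrow> stacks \<Rightarrow> bool" where
  exec_Skip: "exec Skip s 1 s"
| exec_Seq: "exec c s t s' \<Longrightarrow> exec d s' u s'' \<Longrightarrow> exec (c ;; d) s (t + u + 1) s''"
| exec_CondT: "peek (s r) \<in> X \<Longrightarrow> exec c s t s' \<Longrightarrow> exec (Cond r X c d) s (t + 1) s'"
| exec_CondF: "peek (s r) \<notin> X \<Longrightarrow> exec d s t s' \<Longrightarrow> exec (Cond r X c d) s (t + 1) s'"
| exec_LoopF: "peek (s r) \<notin> X \<Longrightarrow> exec (Loop r X c) s 1 s"
| exec_LoopT: "peek (s r) \<in> X \<Longrightarrow> exec c s t s' \<Longrightarrow> exec (Loop r X c) s' u s'' \<Longrightarrow>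
    exec (Loop r X c) s (t + u + 1) s''"
| exec_Psh: "f (peek (s a)) \<noteq> 0 \<Longrightarrow> exec (Psh b a f) s 2 (s(b := f (peek (s a)) # s b))"
| exec_Pop: "exec (Pop a) s 1 (s(a := tl (s a)))"

inductive_cases exec_SeqE: "exec (c ;; d) s t s'"

definition run :: "com \<Rightarrow> stacks \<Rightarrow> nat \<Rightarrow> stacks \<Rightarrow> bool" where
  "run c s n s' \<longleftrightarrow> (\<exists>t\<le>n. exec c s t s')"

text \<open>A machine step writes first and moves afterwards, so a push takes two steps: the head
  moves left, leaving the old cell unchanged, and then \<open>Wr\<close>, which carries the symbol
  in the control state, fills the new cell.\<close>

fun nxt :: "com list \<Rightarrow> (nat \<Rightarrow> nat) \<Rightarrow> com list \<times> (nat \<Rightarrow> nat \<times> direction)" where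
  "nxt [] rd = ([], \<lambda>i. (rd i, Stay))"
| "nxt (Skip # K) rd = (K, \<lambda>i. (rd i, Stay))"
| "nxt ((c ;; d) # K) rd = (c # d # K, \<lambda>i. (rd i, Stay))"
| "nxt (Cond r X c d # K) rd = ((if rd r \<in> X then c else d) # K, \<lambda>i. (rd i, Stay))"
| "nxt (Loop r X c # K) rd = (if rd r \<in> X then c # Loop r X c # K else K, \<lambda>i. (rd i, Stay))"
| "nxt (Psh b a f # K) rd = (Wr b (f (rd a)) # K, \<lambda>i. (rd i, if i = b then MoveLeft else Stay))"
| "nxt (Pop a # K) rd = (K, \<lambda>i. (rd i, if i = a then MoveRight else Stay))"
| "nxt (Wr b x # K) rd = (K, \<lambda>i. (if i = b then x else rd i, Stay))"

primrec wf_com :: "nat \<Rightarrow> nat \<Rightarrow> com \<Rightarrow> bool" where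
  "wf_com m g Skip \<longleftrightarrow> True"
| "wf_com m g (c ;; d) \<longleftrightarrow> wf_com m g c \<and> wf_com m g d"
| "wf_com m g (Cond r X c d) \<longleftrightarrow> r < m \<and> wf_com m g c \<and> wf_com m g d"
| "wf_com m g (Loop r X c) \<longleftrightarrow> r < m \<and> wf_com m g c"
| "wf_com m g (Psh b a f) \<longleftrightarrow> b < m \<and> a < m \<and> (\<forall>x<g. f x < g)"
| "wf_com m g (Pop a) \<longleftrightarrow> a < m"
| "wf_com m g (Wr b x) \<longleftrightarrow> False"

text \<open>The control states that occur while \<open>c\<close> runs on top of the continuation \<open>K\<close>.\<close>

primrec conts :: "nat \<Rightarrow> com \<Rightarrow> com list \<Rightarrow> com list set" where
  "conts g Skip K = {Skip # K}"
| "conts g (c ;; d) K = insert ((c ;; d) # K) (conts g c (d # K) \<union> conts g d K)"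
| "conts g (Cond r X c d) K = insert (Cond r X c d # K) (conts g c K \<union> conts g d K)"
| "conts g (Loop r X c) K = insert (Loop r X c # K) (conts g c (Loop r X c # K))"
| "conts g (Psh b a f) K = insert (Psh b a f # K) ((\<lambda>x. Wr b x # K) ` {..<g})"
| "conts g (Pop a) K = {Pop a # K}"
| "conts g (Wr b x) K = {}"

lemma finite_conts: "finite (conts g c K)"
  by (induction c arbitrary: K) auto

lemma conts_start: "wf_com m g c \<Longrightarrow> c # K \<in> conts g c K"
  by (cases c) auto

text \<open>A loop body runs on top of the loop itself, whose control state is already a member, so
  the finitely many continuations never grow further; they become the states of the machine.\<close>

lemma conts_closed:
  assumes "wf_com m g c" "L \<in> conts g c K" "\<And>i. i < m \<Longrightarrow> rd i < g" "i < m"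
  shows "fst (nxt L rd) \<in> insert K (conts g c K) \<and> fst (snd (nxt L rd) i) < g"
  using assms
proof (induction c arbitrary: K)
  case (Seq c d)
  consider "L = (c ;; d) # K" | "L \<in> conts g c (d # K)" | "L \<in> conts g d K"
    using Seq.prems by auto
  then show ?case
  proof cases
    case 2
    then show ?thesis using Seq.IH(1)[OF _ 2] Seq.prems conts_start[of m g d K] by auto
  qed (use Seq conts_start[of m g c "d # K"] in auto)
next
  case (Cond r X c d)
  then show ?case using conts_start[of m g c K] conts_start[of m g d K] by auto
next
  case (Loop r X c)
  consider "L = Loop r X c # K" | "L \<in> conts g c (Loop r X c # K)" using Loop.prems by auto
  then show ?case
  proof cases
    case 1
    then show ?thesis using Loop.prems conts_start[of m g c "Loop r X c # K"] by simp
  next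
    case 2
    then show ?thesis using Loop.IH[OF _ 2] Loop.prems by simp
  qed
next
  case (Psh b a f)
  then consider "L = Psh b a f # K" | x where "x < g" "L = Wr b x # K" by auto
  then show ?case using Psh.prems by cases auto
qed simp_all

text \<open>Cells to the left of the head are unconstrained: a pop leaves its symbol behind, and the
  next push overwrites it. The input tape, with its head on the first letter, is already a stack in
  this sense.\<close>

definition rep_tape :: "tape \<Rightarrow> nat list \<Rightarrow> bool" where
  "rep_tape t xs \<longleftrightarrow> (\<forall>i. fst t (snd t + int i) = (if i < length xs then xs ! i else 0))"

definition rep :: "nat \<Rightarrow> tape list \<Rightarrow> stacks \<Rightarrow> bool" where
  "rep m ts s \<longleftrightarrow> length ts = m \<and> (\<forall>i<m. rep_tape (ts ! i) (s i))"

lemma read_rep: "rep_tape t xs \<Longrightarrow> read_tape t = peek xs"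
proof -
  assume "rep_tape t xs"
  then have "fst t (snd t + int 0) = (if 0 < length xs then xs ! 0 else 0)"
    unfolding rep_tape_def by blast
  then show ?thesis by (cases xs) (simp_all add: read_tape_def)
qed

lemma rep_tape_pop: "rep_tape t xs \<Longrightarrow> rep_tape (act_tape t (read_tape t, MoveRight)) (tl xs)"
  unfolding rep_tape_def act_tape_def read_tape_def
proof (intro allI)
  fix i assume "\<forall>i. fst t (snd t + int i) = (if i < length xs then xs ! i else 0)"
  from spec[OF this, of "Suc i"]
  show "fst ((fst t)(snd t := fst (fst t (snd t), MoveRight)),
            snd t + head_shift (snd (fst t (snd t), MoveRight)))
          (snd ((fst t)(snd t := fst (fst t (snd t), MoveRight)),
            snd t + head_shift (snd (fst t (snd t), MoveRight))) + int i) =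
         (if i < length (tl xs) then tl xs ! i else 0)"
    by (cases xs) (auto simp: algebra_simps)
qed

lemma act_tape_stay [simp]: "act_tape t (read_tape t, Stay) = t"
  by (simp add: act_tape_def read_tape_def)

lemma rep_tape_push:
  assumes "rep_tape t xs"
  shows "rep_tape (act_tape (act_tape t (read_tape t, MoveLeft)) (x, Stay)) (x # xs)"
  unfolding rep_tape_def
proof
  fix i
  have "fst t (snd t + int j) = (if j < length xs then xs ! j else 0)" for j
    using assms unfolding rep_tape_def by blast
  then show "fst (act_tape (act_tape t (read_tape t, MoveLeft)) (x, Stay))
          (snd (act_tape (act_tape t (read_tape t, MoveLeft)) (x, Stay)) + int i) =
         (if i < length (x # xs) then (x # xs) ! i else 0)"
    by (cases i) (auto simp: act_tape_def read_tape_def)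
qed

section \<open>Simulation of commands by steps on tapes\<close>

definition cstep :: "com list \<times> tape list \<Rightarrow> com list \<times> tape list" where
  "cstep c = (case c of (K, ts) \<Rightarrow>
     case nxt K (\<lambda>i. map read_tape ts ! i) of (K', a) \<Rightarrow> (K', map2 act_tape ts (map a [0..<length ts])))"

lemma cstep_stay:
  assumes "nxt K (\<lambda>i. map read_tape ts ! i) = (K', \<lambda>i. (map read_tape ts ! i, Stay))"
  shows "cstep (K, ts) = (K', ts)"
  by (simp add: cstep_def assms) (rule nth_equalityI, auto)

lemma exec_cstep:
  assumes "exec c s t s'" "wf_com m g c" "rep m ts s"
  shows "\<exists>ts'. (cstep ^^ t) (c # K, ts) = (K, ts') \<and> rep m ts' s'"
  using assms
proof (induction arbitrary: ts K)
  case (exec_Skip s)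
  then show ?case by (simp add: cstep_stay)
next
  case (exec_Seq c s t s' d u s'')
  then obtain ts1 where 1: "(cstep ^^ t) (c # d # K, ts) = (d # K, ts1)" "rep m ts1 s'"
    by (metis wf_com.simps(2))
  then obtain ts2 where 2: "(cstep ^^ u) (d # K, ts1) = (K, ts2)" "rep m ts2 s''"
    using exec_Seq by (metis wf_com.simps(2))
  have "(cstep ^^ (t + u + 1)) ((c ;; d) # K, ts) = (cstep ^^ (u + t)) (cstep ((c ;; d) # K, ts))"
    by (simp add: funpow_swap1 add.commute)
  then show ?case using 1 2 by (simp add: cstep_stay funpow_add)
next
  case (exec_CondT s r X c t s' d)
  then have "cstep (Cond r X c d # K, ts) = (c # K, ts)"
    by (intro cstep_stay) (auto simp: rep_def read_rep)
  then show ?case using exec_CondT by (simp add: funpow_swap1)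
next
  case (exec_CondF s r X d t s' c)
  then have "cstep (Cond r X c d # K, ts) = (d # K, ts)"
    by (intro cstep_stay) (auto simp: rep_def read_rep)
  then show ?case using exec_CondF by (simp add: funpow_swap1)
next
  case (exec_LoopF s r X c)
  then have "cstep (Loop r X c # K, ts) = (K, ts)"
    by (intro cstep_stay) (auto simp: rep_def read_rep)
  then show ?case using exec_LoopF by simp
next
  case (exec_LoopT s r X c t s' u s'')
  then have a: "cstep (Loop r X c # K, ts) = (c # Loop r X c # K, ts)"
    by (intro cstep_stay) (auto simp: rep_def read_rep)
  obtain ts1 where 1: "(cstep ^^ t) (c # Loop r X c # K, ts) = (Loop r X c # K, ts1)" "rep m ts1 s'"
    using exec_LoopT by (metis wf_com.simps(4))
  then obtain ts2 where 2: "(cstep ^^ u) (Loop r X c # K, ts1) = (K, ts2)" "rep m ts2 s''"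
    using exec_LoopT by metis
  have "(cstep ^^ (t + u + 1)) (Loop r X c # K, ts) = (cstep ^^ (u + t)) (cstep (Loop r X c # K, ts))"
    by (simp add: funpow_swap1 add.commute)
  then show ?case using 1 2 a by (simp add: funpow_add)
next
  case (exec_Psh f s a b)
  let ?x = "f (peek (s a))"
  have len: "length ts = m" and ab: "a < m" "b < m" using exec_Psh by (auto simp: rep_def)
  let ?ts1 = "ts[b := act_tape (ts ! b) (read_tape (ts ! b), MoveLeft)]"
  have 1: "cstep (Psh b a f # K, ts) = (Wr b ?x # K, ?ts1)"
  proof -
    have "map read_tape ts ! a = peek (s a)" using exec_Psh ab by (auto simp: rep_def read_rep)
    then show ?thesis using len ab
      by (simp add: cstep_def) (rule nth_equalityI, auto simp: nth_list_update)
  qed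
  let ?ts2 = "ts[b := act_tape (act_tape (ts ! b) (read_tape (ts ! b), MoveLeft)) (?x, Stay)]"
  have 2: "cstep (Wr b ?x # K, ?ts1) = (K, ?ts2)"
    using len ab by (simp add: cstep_def) (rule nth_equalityI, auto simp: nth_list_update)
  have "rep m ?ts2 (s(b := ?x # s b))"
    using exec_Psh len ab by (auto simp: rep_def nth_list_update intro: rep_tape_push)
  then show ?case using 1 2 by (auto simp: numeral_2_eq_2 fun_upd_def)
next
  case (exec_Pop a s)
  have len: "length ts = m" and ab: "a < m" using exec_Pop by (auto simp: rep_def)
  let ?ts1 = "ts[a := act_tape (ts ! a) (read_tape (ts ! a), MoveRight)]"
  have 1: "cstep (Pop a # K, ts) = (K, ?ts1)"
    using len ab by (simp add: cstep_def) (rule nth_equalityI, auto simp: nth_list_update)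
  have "rep m ?ts1 (s(a := tl (s a)))"
    using exec_Pop len ab by (auto simp: rep_def nth_list_update intro: rep_tape_pop)
  then show ?case using 1 by (auto simp: fun_upd_def)
qed

section \<open>From commands to Turing machines\<close>

lemma ex_numbering:
  assumes "finite Q" "x \<in> Q"
  shows "\<exists>h. bij_betw h Q {..<card Q} \<and> h x = (0::nat)"
proof -
  obtain h where h: "bij_betw h (Q - {x}) {0..<card (Q - {x})}"
    using ex_bij_betw_finite_nat[of "Q - {x}"] assms(1) by blast
  have card: "card Q = Suc (card (Q - {x}))" using card_Suc_Diff1[OF assms] by simp
  let ?h = "\<lambda>q. if q = x then 0 else Suc (h q)"
  have "inj_on ?h Q" using h by (auto simp: bij_betw_def inj_on_def)
  moreover have "?h ` Q = {..<card Q}"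
  proof -
    have "?h ` Q = insert 0 (?h ` (Q - {x}))" using assms(2) by auto
    moreover have "?h ` (Q - {x}) = Suc ` (h ` (Q - {x}))"
      unfolding image_image by (rule image_cong) auto
    moreover have "h ` (Q - {x}) = {..<card (Q - {x})}"
      using h by (simp add: bij_betw_def atLeast0LessThan)
    ultimately show ?thesis unfolding card lessThan_Suc_eq_insert_0 by simp
  qed
  ultimately have "bij_betw ?h Q {..<card Q}" by (simp add: bij_betw_def)
  then show ?thesis by (intro exI[of _ ?h]) simp
qed

text \<open>The states are the continuations together with one halting state for each possible
  output. When the continuation is exhausted, one further step reads all heads and passes to the
  halting state, whence \<open>p + 1\<close>; finiteness of \<open>range out\<close> keeps the state
  set finite, and the numbering sends the initial continuation to 0.\<close>

theorem compile:
  fixes c :: com and out :: "(nat \<Rightarrow> nat) \<Rightarrow> 'v"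
  assumes wf: "wf_com m g c" and m: "0 < m" and g: "0 < g" and fin: "finite (range out)"
    and out: "\<And>rd rd'. (\<And>i. i < m \<Longrightarrow> rd i = rd' i) \<Longrightarrow> out rd = out rd'"
    and D: "\<And>w. w \<in> D \<Longrightarrow> enc ` set w \<subseteq> {0<..<g}"
    and run: "\<And>w. w \<in> D \<Longrightarrow> \<exists>s. run c ((\<lambda>_. [])(0 := map enc w)) (poly p (length w)) s \<and>
       out (\<lambda>i. peek (s i)) = f w"
  shows "poly_time_computable enc D f"
proof -
  define Q where "Q = Inl ` insert [] (conts g c []) \<union> Inr ` range out"
  have finQ: "finite Q" by (simp add: Q_def finite_conts fin)
  have start: "Inl [c] \<in> Q" using conts_start[OF wf, of "[]"] by (auto simp: Q_def)
  obtain h where h: "bij_betw h Q {..<card Q}" and h0: "h (Inl [c]) = (0::nat)"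
    using ex_numbering[OF finQ start] by blast
  define e where "e = inv_into Q h"
  have eh: "e (h q) = q" if "q \<in> Q" for q using h that by (simp add: e_def bij_betw_def)
  have eQ: "e q \<in> Q" if "q < card Q" for q
    using h that unfolding e_def bij_betw_def by (metis inv_into_into lessThan_iff)
  have hQ: "h q < card Q" if "q \<in> Q" for q using h that by (auto simp: bij_betw_def)
  define tr where "tr = (\<lambda>q rs. case e q of
      Inl [] \<Rightarrow> (h (Inr (out (\<lambda>i. rs ! i))), map (\<lambda>i. (rs ! i, Stay)) [0..<m])
    | Inl K \<Rightarrow> (case nxt K (\<lambda>i. rs ! i) of (K', a) \<Rightarrow> (h (Inl K'), map a [0..<m]))
    | Inr v \<Rightarrow> (0, map (\<lambda>i. (rs ! i, Stay)) [0..<m]))"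
  define M where "M = \<lparr>num_tapes = m, num_states = card Q, num_symbols = g, trans = tr,
     answer = (\<lambda>q. case e q of Inl K \<Rightarrow> None | Inr v \<Rightarrow> Some v)\<rparr>"
  have Mn: "num_tapes M = m" "num_states M = card Q" "num_symbols M = g" "trans M = tr"
    by (simp_all add: M_def)
  have ans: "answer M (h (Inl K)) = None" if "Inl K \<in> Q" for K
    using that by (simp add: M_def eh)
  have ansr: "answer M (h (Inr v)) = Some v" if "Inr v \<in> Q" for v
    using that by (simp add: M_def eh)
  have card0: "0 < card Q" using finQ start card_gt_0_iff by blast
  have closed: "case tr q rs of (q', acts) \<Rightarrow>
        q' < card Q \<and> length acts = m \<and> fst ` set acts \<subseteq> {..<g}"
    if q: "q < card Q" and rs: "length rs = m" "set rs \<subseteq> {..<g}" for q rs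
  proof -
    have rd: "rs ! i < g" if "i < m" for i using rs that nth_mem by blast
    show ?thesis
    proof (cases "e q")
      case (Inr v)
      then show ?thesis using rd card0 by (auto simp: tr_def)
    next
      case (Inl K)
      show ?thesis
      proof (cases K)
        case Nil
        have "Inr (out (\<lambda>i. rs ! i)) \<in> Q" by (simp add: Q_def)
        then show ?thesis using rd Inl Nil by (auto simp: tr_def hQ)
      next
        case (Cons c' K')
        have K: "K \<in> conts g c []" using eQ[OF q] Inl Cons by (auto simp: Q_def)
        have "Inl (fst (nxt K (\<lambda>i. rs ! i))) \<in> Q"
          unfolding Q_def by (intro UnI1 imageI conjunct1[OF conts_closed[OF wf K _ m]] rd)
        moreover have "fst (snd (nxt K (\<lambda>i. rs ! i)) i) < g" if "i < m" for i
          by (rule conjunct2[OF conts_closed[OF wf K]]) (use rd that in simp_all)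
        ultimately show ?thesis
          using Inl Cons by (auto simp: tr_def hQ split_beta)
      qed
    qed
  qed
  have wfM: "wf_tm M" unfolding wf_tm_def Mn using m g card0 closed by simp
  have sim: "step M (h (Inl K), ts) = (h (Inl (fst (cstep (K, ts)))), snd (cstep (K, ts)))"
    if "Inl K \<in> Q" "K \<noteq> []" "length ts = m" for K ts
    using that by (cases K) (auto simp: step_def ans Mn tr_def eh cstep_def split: prod.splits)
  have fin_step: "step M (h (Inl []), ts) = (h (Inr (out (\<lambda>i. map read_tape ts ! i))), ts)"
    if "length ts = m" for ts
  proof -
    have a: "Inl [] \<in> Q" by (simp add: Q_def)
    have b: "map2 act_tape ts (map (\<lambda>i. (map read_tape ts ! i, Stay)) [0..<m]) = ts"
      using that by (intro nth_equalityI) auto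
    show ?thesis using a b by (simp add: step_def ans Mn tr_def eh)
  qed
  have simn: "(step M ^^ n) (h (Inl [c]), ts) =
      (h (Inl (fst ((cstep ^^ n) ([c], ts)))), snd ((cstep ^^ n) ([c], ts)))"
    if "\<And>j. j < n \<Longrightarrow> fst ((cstep ^^ j) ([c], ts)) \<noteq> [] \<and> Inl (fst ((cstep ^^ j) ([c], ts))) \<in> Q \<and>
        length (snd ((cstep ^^ j) ([c], ts))) = m" for n ts
    using that
  proof (induction n)
    case (Suc n)
    then show ?case using sim[of "fst ((cstep ^^ n) ([c], ts))" "snd ((cstep ^^ n) ([c], ts))"] by simp
  qed simp
  define okt where "okt ts \<longleftrightarrow> length ts = m \<and> (\<forall>i<m. \<forall>p. fst (ts ! i) p < g)" for ts :: "tape list"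
  have inv: "fst (cstep (K, ts)) \<in> insert [] (conts g c []) \<and> okt (snd (cstep (K, ts)))"
    if K: "K \<in> insert [] (conts g c [])" and ts: "okt ts" for K ts
  proof -
    have len: "length ts = m" using ts by (simp add: okt_def)
    have rd: "map read_tape ts ! i < g" if "i < m" for i
      using ts that by (simp add: okt_def read_tape_def)
    have cl: "fst (nxt K (\<lambda>i. map read_tape ts ! i)) \<in> insert [] (conts g c []) \<and>
        fst (snd (nxt K (\<lambda>i. map read_tape ts ! i)) i) < g" if "i < m" for i
    proof (cases "K = []")
      case True
      then show ?thesis using rd[OF that] by simp
    next
      case False
      then have "K \<in> conts g c []" using K by simp
      then show ?thesis using conts_closed[OF wf] rd that by simp
    qed
    show ?thesis
    proof (cases "nxt K (\<lambda>i. map read_tape ts ! i)")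
      case (Pair K' a)
      then have "K' \<in> insert [] (conts g c [])" "\<And>i. i < m \<Longrightarrow> fst (a i) < g"
        using cl cl[OF m] by simp_all
      then show ?thesis using Pair ts len by (simp add: cstep_def okt_def act_tape_def)
    qed
  qed
  have "outputs_within M (map enc w) (poly (p + 1) (length w)) (f w)" if w: "w \<in> D" for w
  proof -
    define xs where "xs = map enc w"
    define ts where "ts = input_tape xs # replicate (m - 1) (input_tape [])"
    obtain s t where s: "t \<le> poly p (length w)" "exec c ((\<lambda>_. [])(0 := xs)) t s"
      "out (\<lambda>i. peek (s i)) = f w"
      using run[OF w] unfolding run_def xs_def by blast
    have "set xs \<subseteq> {..<g}" using D[OF w] by (auto simp: xs_def)
    then have xs: "xs ! i < g" if "i < length xs" for i using that nth_mem by blast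
    have "rep m ts ((\<lambda>_. [])(0 := xs))"
      using m by (auto simp: rep_def ts_def rep_tape_def input_tape_def nth_Cons split: nat.splits)
    from exec_cstep[OF s(2) wf this, of "[]"]
    obtain ts' where ts': "(cstep ^^ t) ([c], ts) = ([], ts')" "rep m ts' s" by blast
    let ?c = "\<lambda>j. (cstep ^^ j) ([c], ts)"
    have ok: "fst (?c j) \<in> insert [] (conts g c []) \<and> okt (snd (?c j))" for j
    proof (induction j)
      case 0
      have "fst (input_tape xs) p < g" "fst (input_tape []) p < g" for p
        using xs g by (auto simp: input_tape_def)
      then have "okt ts" using m by (simp add: okt_def ts_def nth_Cons split: nat.split)
      then show ?case using conts_start[OF wf] by simp
    next
      case (Suc j)
      then show ?case using inv[of "fst (?c j)" "snd (?c j)"] by simp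
    qed
    \<comment> \<open>On the empty continuation \<open>cstep\<close> idles whereas the machine moves
      on to a halting state, so the two run in parallel only until the continuation is empty for the
      first time.\<close>
    define n where "n = (LEAST j. fst (?c j) = [])"
    have t: "fst (?c t) = []" using ts'(1) by simp
    have n: "fst (?c n) = []" unfolding n_def by (rule LeastI[of "\<lambda>j. fst (?c j) = []", OF t])
    have nt: "n \<le> t" unfolding n_def by (rule Least_le[of "\<lambda>j. fst (?c j) = []", OF t])
    have less: "fst (?c j) \<noteq> []" if "j < n" for j
      using not_less_Least[of j "\<lambda>j. fst (?c j) = []"] that unfolding n_def by blast
    have stay: "(cstep ^^ j) ([], us) = ([], us)" for j and us :: "tape list"
      by (induction j) (simp_all add: cstep_stay)
    obtain d where d: "t = d + n" using nt le_iff_add[of n t] by (auto simp: add.commute)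
    have "?c t = (cstep ^^ d) (?c n)" by (simp add: d funpow_add)
    also have "\<dots> = ?c n" using n stay[of d "snd (?c n)"] by (cases "?c n") simp
    finally have cn: "?c n = ([], ts')" using ts'(1) by simp
    have "(step M ^^ n) (h (Inl [c]), ts) = (h (Inl []), ts')"
    proof -
      have "fst (?c j) \<noteq> [] \<and> Inl (fst (?c j)) \<in> Q \<and> length (snd (?c j)) = m" if "j < n" for j
        using less[OF that] ok[of j] unfolding Q_def okt_def by blast
      from simn[OF this] show ?thesis using cn by simp
    qed
    moreover have "length ts' = m" using ts'(2) by (simp add: rep_def)
    ultimately have "(step M ^^ Suc n) (h (Inl [c]), ts) = (h (Inr (out (\<lambda>i. map read_tape ts' ! i))), ts')"
      by (simp add: fin_step)
    moreover have "out (\<lambda>i. map read_tape ts' ! i) = f w"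
      using ts'(2) unfolding s(3)[symmetric] by (intro out) (auto simp: rep_def read_rep)
    ultimately have fin: "(step M ^^ Suc n) (h (Inl [c]), ts) = (h (Inr (f w)), ts')" by simp
    have fQ: "Inr (f w) \<in> Q" unfolding Q_def s(3)[symmetric] by blast
    then have halt: "(step M ^^ j) (h (Inr (f w)), ts') = (h (Inr (f w)), ts')" for j
      by (induction j) (simp_all add: step_def ansr)
    have le: "Suc n \<le> poly (p + 1) (length w)" using nt s(1) by simp
    then have "(step M ^^ poly (p + 1) (length w)) (h (Inl [c]), ts) = (h (Inr (f w)), ts')"
    proof -
      define j where "j = poly (p + 1) (length w) - Suc n"
      have "poly (p + 1) (length w) = j + Suc n" using le by (simp add: j_def)
      then show ?thesis using halt[of j] fin by (simp only: funpow_add o_apply)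
    qed
    then show ?thesis
      using fQ by (simp add: outputs_within_def start_config_def Mn h0 ansr xs_def ts_def)
  qed
  then show ?thesis unfolding poly_time_computable_def using wfM D Mn(3)
    by (intro exI[of _ M] exI[of _ "p + 1"]) simp
qed

subsection \<open>Layered numbers\<close>

lemma ack_two: "ack (Suc (Suc 0)) n = 2 ^ n"
  by (induction n) simp_all

lemma ack_pow2: "\<exists>p. ack (Suc (Suc i)) n = 2 ^ p"
proof (induction i arbitrary: n)
  case (Suc i)
  have "ack (Suc (Suc (Suc i))) 0 = 2 ^ 0" by simp
  then show ?case using Suc by (cases n) (metis, simp)
qed (auto simp: ack_two)

lemma ack_ge_pow2: "2 ^ n \<le> ack (Suc (Suc i)) n"
proof (induction i arbitrary: n)
  case (Suc i)
  show ?case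
  proof (cases n)
    case (Suc m)
    have "m < ack (Suc (Suc (Suc i))) m" using ack_less_Suc[of "Suc (Suc (Suc i))" m] by simp
    then have "(2::nat) ^ n \<le> 2 ^ ack (Suc (Suc (Suc i))) m"
      unfolding Suc by (intro power_increasing) auto
    also have "\<dots> \<le> ack (Suc (Suc i)) (ack (Suc (Suc (Suc i))) m)" by (rule Suc.IH)
    finally show ?thesis by (simp add: Suc)
  qed simp
qed (simp add: ack_two)

lemma A_nat: "2 \<le> i \<Longrightarrow> 0 \<le> n \<Longrightarrow> A i n = int (ack i (nat n))"
  by (simp add: A_def)

lemma A_two: "0 \<le> n \<Longrightarrow> A 2 n = 2 ^ nat n"
  using ack_two[of "nat n"] by (simp add: A_nat numeral_2_eq_2)

lemma A_pow2: "2 \<le> i \<Longrightarrow> 0 \<le> n \<Longrightarrow> \<exists>p. A i n = 2 ^ p"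
  using ack_pow2[of "i - 2" "nat n"] by (auto simp: A_nat numeral_2_eq_2 Suc_diff_Suc)

lemma A_ge_pow2: "2 \<le> i \<Longrightarrow> 0 \<le> n \<Longrightarrow> 2 ^ nat n \<le> A i n"
  using ack_ge_pow2[of "nat n" "i - 2"]
  by (simp add: A_nat numeral_2_eq_2 Suc_diff_Suc)

lemma A_Suc_0: "A (Suc 0) n = 2 * n"
  by (simp add: A_def)

lemma A_pos: "2 \<le> i \<Longrightarrow> 0 \<le> n \<Longrightarrow> 0 < A i n"
  using A_pow2[of i n] by auto

lemma A_gt: "2 \<le> i \<Longrightarrow> 0 \<le> n \<Longrightarrow> n < A i n"
  using ack_less_Suc[of i "nat n"] by (simp add: A_nat zless_nat_eq_int_zless nat_less_iff)

lemma A_strict_mono: "2 \<le> i \<Longrightarrow> 0 \<le> a \<Longrightarrow> a < b \<Longrightarrow> A i a < A i b"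
  using strict_monoD[of "ack i" "nat a" "nat b"] ack_less_Suc
  by (simp add: A_nat strict_mono_Suc_iff)

lemma A_inv_Some: "A_inv i x = Some y \<longleftrightarrow> y \<in> A_dom i \<and> A i y = x"
  unfolding A_inv_def using inj_on_A[of i]
  by (auto simp: the_inv_into_f_f inj_on_eq_iff)

lemma A_inv_None: "A_inv i x = None \<longleftrightarrow> (\<forall>y\<in>A_dom i. A i y \<noteq> x)"
  using A_inv_Some by (metis not_None_eq)

lemma A_dom_ge2: "2 \<le> i \<Longrightarrow> A_dom i = {0..}"
  by (simp add: A_dom_def)

lemma A_inv_A: "y \<in> A_dom i \<Longrightarrow> A_inv i (A i y) = Some y"
  by (simp add: A_inv_Some)

lemma A_inv_one: "A_inv (Suc 0) x = (if even x then Some (x div 2) else None)"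
  by (auto simp: A_inv_Some A_inv_None A_dom_def A_def)

lemma A_inv_zero: "A_inv 0 x = Some (x - 1)"
  by (auto simp: A_inv_Some A_dom_def A_def)

lemma A_Suc: "1 \<le> i \<Longrightarrow> 1 \<le> p \<Longrightarrow> A (Suc i) p = A i (A (Suc i) (p - 1))"
  using A_rec[of "p - 1" i] by simp

lemma A_in_dom: "1 \<le> i \<Longrightarrow> 0 \<le> p \<Longrightarrow> A (Suc i) p \<in> A_dom i"
  using A_pos[of "Suc i" p] by (auto simp: A_dom_def)

text \<open>The defining recursion read backwards: undo \<open>A i\<close>, undo
  \<open>A (Suc i)\<close>, and count one more. The value 1 is excluded because it is
  \<open>A (Suc i) 0\<close>, the start of the recursion.\<close>

lemma A_inv_Suc:
  assumes i: "1 \<le> i" and x: "x \<noteq> 1"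
  shows "A_inv (Suc i) x = Option.bind (A_inv i x) (\<lambda>y. map_option (\<lambda>z. z + 1) (A_inv (Suc i) y))"
proof (cases "A_inv (Suc i) x")
  case (Some p)
  then have p: "0 \<le> p" "A (Suc i) p = x" using i by (auto simp: A_inv_Some A_dom_ge2)
  then have "p \<noteq> 0" using x A_at_0[of "Suc i"] i by auto
  then have p1: "1 \<le> p" using p by simp
  then have "A_inv i x = Some (A (Suc i) (p - 1))"
    using A_Suc[OF i p1] A_in_dom[OF i, of "p - 1"] p by (simp add: A_inv_Some)
  moreover have "A_inv (Suc i) (A (Suc i) (p - 1)) = Some (p - 1)"
    using p1 i by (intro A_inv_A) (simp add: A_dom_ge2)
  ultimately show ?thesis using Some by simp
next
  case None
  have False if y: "A_inv i x = Some y" and z: "A_inv (Suc i) y = Some z" for y z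
  proof -
    have "0 \<le> z" "A (Suc i) z = y" "A i y = x" using y z i by (auto simp: A_inv_Some A_dom_ge2)
    then have "A (Suc i) (z + 1) = x" using A_Suc[OF i, of "z + 1"] by simp
    then have "A_inv (Suc i) x = Some (z + 1)" using \<open>0 \<le> z\<close> i by (simp add: A_inv_Some A_dom_ge2)
    then show False using None by simp
  qed
  then show ?thesis using None by (cases "A_inv i x"; cases "A_inv (Suc i) (the (A_inv i x))") auto
qed

text \<open>The images are nested: 1 lies in all of them, and by \<open>A_inv_Suc\<close> any other
  value of \<open>A (Suc j)\<close> is a value of \<open>A j\<close>. Hence the largest index whose
  image contains a number decides all membership questions about it.\<close>

lemma A_inv_mono:
  assumes "2 \<le> i" "i \<le> j" "A_inv i x = None"
  shows "A_inv j x = None"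
  using assms(2)
proof (induction j rule: dec_induct)
  case (step j)
  have "x \<noteq> 1" using assms A_at_0[of i] A_dom_ge2[of i] by (auto simp: A_inv_None)
  then show ?case using step assms(1) by (simp add: A_inv_Suc)
qed (rule assms(3))

lemma A_inv_ge2:
  assumes "2 \<le> i" "A_inv i x = Some y"
  shows "0 \<le> y" "A i y = x" "y < x" "\<exists>p. x = 2 ^ p"
  using assms A_gt[of i y] A_pow2[of i y] by (auto simp: A_inv_Some A_dom_ge2)

text \<open>A configuration \<open>(b, [(r\<^sub>1, c\<^sub>1), (r\<^sub>2, c\<^sub>2), \<dots>])\<close> denotes the integer
  \<open>b + A r\<^sub>1 (c\<^sub>1 + A r\<^sub>2 (c\<^sub>2 + \<dots>))\<close>.\<close>

type_synonym cfg = "int \<times> (nat \<times> int) list"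

fun cval :: "int \<Rightarrow> (nat \<times> int) list \<Rightarrow> int" where
  "cval b [] = b"
| "cval b ((r, c) # st) = A r (cval c st) + b"

text \<open>Opening a layer is legitimate only if the argument is not in the image of
  \<open>A (i + 1)\<close>, as the new layer would otherwise not carry its largest index;
  \<open>appc\<close> tests this beforehand. The threshold \<open>2 ^ B\<close> keeps explicit
  values short.\<close>

definition raw :: "nat \<Rightarrow> nat \<Rightarrow> int \<Rightarrow> (nat \<times> int) list \<Rightarrow> cfg" where
  "raw B i b st = (if st = [] \<and> 0 \<le> b \<and> A i b \<le> 2 ^ B then (A i b, []) else (0, (i, b) # st))"

text \<open>Partial inverse and application of \<open>A (k + 1 - d)\<close> on configurations.\<close>

fun invc :: "nat \<Rightarrow> nat \<Rightarrow> nat \<Rightarrow> int \<Rightarrow> (nat \<times> int) list \<Rightarrow> cfg option"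
  and appc :: "nat \<Rightarrow> nat \<Rightarrow> nat \<Rightarrow> int \<Rightarrow> (nat \<times> int) list \<Rightarrow> cfg" where
  "invc k B 0 b st = None"
| "invc k B (Suc d) b [] = map_option (\<lambda>q. (q, [])) (A_inv (k - d) b)"
| "invc k B (Suc d) b ((r, c) # st) =
    (if b \<noteq> 0 \<or> r < k - d then None else if r = k - d then Some (c, st)
     else map_option (\<lambda>(b, st). appc k B d (b - 1) st) (invc k B d b ((r, c) # st)))"
| "appc k B 0 b st = (b, st)"
| "appc k B (Suc d) b st = (case invc k B d b st of None \<Rightarrow> raw B (k - d) b st
     | Some (b', st') \<Rightarrow> appc k B d (b' + 1) st')"

text \<open>With nothing below it, \<open>c\<close> is an explicit argument of \<open>A r\<close>
  rather than a perturbation of a further layer, so \<open>2 ^ m\<close> does not bound it. The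
  index \<open>k\<close> is exempt from maximality because layers of a higher index are never
  formed.\<close>

fun layers :: "nat \<Rightarrow> nat \<Rightarrow> nat \<Rightarrow> (nat \<times> int) list \<Rightarrow> bool" where
  "layers k B m [] \<longleftrightarrow> True"
| "layers k B m ((r, c) # st) \<longleftrightarrow> 2 \<le> r \<and> r \<le> k \<and> 0 \<le> cval c st \<and> 2 ^ B < A r (cval c st) \<and>
    (r < k \<longrightarrow> A_inv (Suc r) (A r (cval c st)) = None) \<and> (st \<noteq> [] \<longrightarrow> \<bar>c\<bar> < 2 ^ m) \<and> layers k B m st"

definition good :: "nat \<Rightarrow> nat \<Rightarrow> nat \<Rightarrow> int \<Rightarrow> (nat \<times> int) list \<Rightarrow> bool" where
  "good k B m b st \<longleftrightarrow> layers k B m st \<and> (st \<noteq> [] \<longrightarrow> \<bar>b\<bar> < 2 ^ m)"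

section \<open>Bounds on offsets and their separation from powers of two\<close>

lemma abs_less_pow_mono: "\<bar>b\<bar> < (2::int) ^ m \<Longrightarrow> m \<le> m' \<Longrightarrow> \<bar>b\<bar> < 2 ^ m'"
  using power_increasing[of m m' "2::int"] by linarith

lemma abs_less_pow_Suc: "\<bar>b\<bar> < (2::int) ^ m \<Longrightarrow> \<bar>b + 1\<bar> < 2 ^ Suc m \<and> \<bar>b - 1\<bar> < 2 ^ Suc m"
proof -
  assume "\<bar>b\<bar> < 2 ^ m"
  moreover have "(1::int) \<le> 2 ^ m" by simp
  ultimately show ?thesis by (simp add: abs_if split: if_splits)
qed

lemma layers_mono: "layers k B m st \<Longrightarrow> B' \<le> B \<Longrightarrow> m \<le> m' \<Longrightarrow> layers k B' m' st"
proof (induction st)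
  case (Cons a st)
  have "(2::int) ^ B' < x" if "2 ^ B < x" for x
    using power_increasing[of B' B "2::int"] Cons.prems that by linarith
  moreover obtain r c where "a = (r, c)" by force
  ultimately show ?case using Cons abs_less_pow_mono[of c m m'] by auto
qed simp

lemma good_mono: "good k B m b st \<Longrightarrow> B' \<le> B \<Longrightarrow> m \<le> m' \<Longrightarrow> good k B' m' b st"
  unfolding good_def using layers_mono abs_less_pow_mono by blast

lemma good_Suc: "good k B m b st \<Longrightarrow> good k B (Suc m) (b + 1) st \<and> good k B (Suc m) (b - 1) st"
  unfolding good_def using layers_mono[of k B m st B "Suc m"] abs_less_pow_Suc by auto

lemma layered_large:
  assumes "good k B m b st" "st \<noteq> []" "Suc m \<le> B"
  shows "2 ^ (B - 1) < cval b st"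
proof -
  obtain r c st' where st: "st = (r, c) # st'" using assms(2) by (cases st) auto
  have b: "\<bar>b\<bar> < 2 ^ (B - 1)" using assms abs_less_pow_mono[of b m "B - 1"] by (auto simp: good_def)
  have "(2::int) ^ B = 2 * 2 ^ (B - 1)" using assms(3) by (cases B) auto
  then show ?thesis using b assms(1) by (auto simp: st good_def)
qed

text \<open>Every power of two other than \<open>2 ^ p\<close> differs from it by at least
  \<open>2 ^ (p - 1)\<close>, and \<open>b\<close> is smaller than that.\<close>

lemma offset_not_pow2:
  fixes b :: int
  assumes L: "2 ^ B < (2::int) ^ p" and b: "\<bar>b\<bar> < 2 ^ m" "b \<noteq> 0" and "Suc m \<le> B"
  shows "2 ^ p + b \<noteq> 2 ^ q"
proof
  assume q: "2 ^ p + b = 2 ^ q"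
  have "B < p" using L by (simp add: power_strict_increasing_iff)
  then have p: "(2::int) ^ p = 2 * 2 ^ (p - 1)" by (cases p) auto
  have bp: "\<bar>b\<bar> < 2 ^ (p - 1)" using abs_less_pow_mono[OF b(1)] assms(4) \<open>B < p\<close> by auto
  consider "q < p" | "q = p" | "p < q" by linarith
  then show False
  proof cases
    case 1
    then have "(2::int) ^ q \<le> 2 ^ (p - 1)" by (simp add: power_increasing)
    then show ?thesis using q p bp by linarith
  next
    case 3
    then have "(2::int) ^ Suc p \<le> 2 ^ q" by (intro power_increasing) auto
    then show ?thesis using q p bp by simp
  qed (use q b in simp)
qed

lemma add_pow_minus_one: "m \<le> m + 2 ^ d - (1::nat)"
  using one_le_power[of "2::nat" d] by linarith

text \<open>Write \<open>g d\<close> for the growth of the offsets in bits. One level consists of an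
  inverse, a shift by one and an application, the outer two at the next higher index, so
  \<open>g (d + 1) = g d + 1 + g d\<close> with \<open>g 0 = 0\<close>, that is
  \<open>2 ^ d - 1\<close>. The hypotheses on \<open>d\<close> say that the index lies between 2 and
  \<open>k\<close>; \<open>d = 0\<close> is the index above \<open>k\<close>, where
  \<open>invc\<close> fails by convention and sends \<open>appc\<close> to \<open>raw\<close>. The
  final clauses on \<open>appc\<close>, that a layered result has no offset and an explicit one is
  at most \<open>2 ^ B\<close>, are what doubling and halving rely on.\<close>

lemma invc_appc_correct:
  shows "d < k \<Longrightarrow> 1 \<le> d \<Longrightarrow> good k B m b st \<Longrightarrow> m + 2 ^ d + 1 \<le> B \<Longrightarrow>
      (case invc k B d b st of None \<Rightarrow> A_inv (k + 1 - d) (cval b st) = None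
       | Some (b', st') \<Rightarrow> A_inv (k + 1 - d) (cval b st) = Some (cval b' st') \<and>
           good k B (m + 2 ^ d - 1) b' st')"
    and "d < k \<Longrightarrow> 1 \<le> d \<Longrightarrow> good k B m b st \<Longrightarrow> m + 2 ^ d + 1 \<le> B \<Longrightarrow> 0 \<le> cval b st \<Longrightarrow>
      (case appc k B d b st of (b', st') \<Rightarrow> cval b' st' = A (k + 1 - d) (cval b st) \<and>
         good k B (m + 2 ^ d - 1) b' st' \<and> (st' \<noteq> [] \<longrightarrow> b' = 0) \<and> (st' = [] \<longrightarrow> b' \<le> 2 ^ B))"
proof (induction d arbitrary: m b st)
  case (Suc d)
  let ?i = "k - d"
  {
    case 1
    then have i: "2 \<le> ?i" "k + 1 - Suc d = ?i" "k + 1 - d = Suc ?i" "Suc k - d = Suc ?i" by auto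
    show ?case
    proof (cases st)
      case Nil
      then show ?thesis
        by (auto simp: i good_def split: option.splits)
    next
      case (Cons rc st')
      obtain r c where rc: "rc = (r, c)" by force
      define L where "L = A r (cval c st')"
      have g: "2 \<le> r" "r \<le> k" "0 \<le> cval c st'" "2 ^ B < L" "r < k \<Longrightarrow> A_inv (Suc r) L = None"
        "layers k B m st'" "st' \<noteq> [] \<Longrightarrow> \<bar>c\<bar> < 2 ^ m" "\<bar>b\<bar> < 2 ^ m"
        using 1(3) by (auto simp: Cons rc good_def L_def)
      obtain p where p: "L = 2 ^ p" using A_pow2 g L_def by blast
      have val: "cval b st = L + b" by (simp add: Cons rc L_def)
      note prem = 1(4)
      have lim: "m + 2 ^ d + 1 \<le> B" "m + 2 ^ d - 1 + 1 + 2 ^ d + 1 \<le> B"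
        "m + 2 ^ d - 1 + 1 + 2 ^ d - 1 = m + 2 ^ Suc d - 1" using prem by auto
      note dk = 1(1) note gd = 1(3)
      consider "b \<noteq> 0" | "b = 0" "r < ?i" | "b = 0" "r = ?i" | "b = 0" "?i < r" by linarith
      then show ?thesis
      proof cases
        case 1
        have "A_inv ?i (L + b) = None"
        proof (rule ccontr)
          assume "A_inv ?i (L + b) \<noteq> None"
          then obtain q where "L + b = 2 ^ q" using A_inv_ge2(4)[OF i(1)] by blast
          then show False using offset_not_pow2[of B p b m q] g \<open>b \<noteq> 0\<close> p prem by auto
        qed
        then show ?thesis using 1 by (simp add: Cons rc i L_def)
      next
        case 2
        have "A_inv ?i L = None" using A_inv_mono[of "Suc r" ?i L] g 2 by auto
        then show ?thesis using 2 val by (simp add: Cons rc i)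
      next
        case 3
        have "A_inv ?i L = Some (cval c st')"
          unfolding L_def 3 using g i by (intro A_inv_A) (simp add: A_dom_ge2)
        moreover have "good k B (m + 2 ^ Suc d - 1) c st'"
          using g good_mono[of k B m c st' B "m + 2 ^ Suc d - 1"] add_pow_minus_one[of m "Suc d"]
          by (simp add: good_def)
        ultimately show ?thesis using 3 val by (simp add: Cons rc i)
      next
        case 4
        then have d: "1 \<le> d" "d < k" using g dk by (cases d; simp)+
        have "A_inv r L = Some (cval c st')"
          unfolding L_def using g by (intro A_inv_A) (simp add: A_dom_ge2)
        \<comment> \<open>\<open>Suc ?i\<close> is at most \<open>r\<close>, so by nestedness of the
          images the recursive inverse cannot fail.\<close>
        then have ne: "A_inv (Suc ?i) L \<noteq> None" using A_inv_mono[of "Suc ?i" r L] 4 i by auto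
        have val0: "cval b st = L" using val 4 by simp
        have "case invc k B d b st of None \<Rightarrow> A_inv (Suc ?i) L = None
           | Some (b', st') \<Rightarrow> A_inv (Suc ?i) L = Some (cval b' st') \<and> good k B (m + 2 ^ d - 1) b' st'"
          using Suc.IH(1)[OF d(2,1) gd lim(1)] unfolding i(3) val0 .
        then obtain b1 st1 where 1: "invc k B d b st = Some (b1, st1)"
          "A_inv (Suc ?i) L = Some (cval b1 st1)" "good k B (m + 2 ^ d - 1) b1 st1"
          using ne by (auto split: option.splits)
        have y: "0 \<le> cval b1 st1" "A (Suc ?i) (cval b1 st1) = L"
          using A_inv_ge2[OF _ 1(2)] i by auto
        have L1: "1 < L" using g(4) by (meson one_le_power le_less_trans one_le_numeral)
        then have "cval b1 st1 \<noteq> 0" using y A_at_0[of "Suc ?i"] i by auto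
        then have y1: "1 \<le> cval b1 st1" using y by simp
        have dec: "cval (b1 - 1) st1 = cval b1 st1 - 1" by (cases "(b1, st1)" rule: cval.cases) auto
        have A: "A ?i (A (Suc ?i) (cval b1 st1 - 1)) = L"
          using A_Suc[of ?i "cval b1 st1"] y y1 i by simp
        have "case appc k B d (b1 - 1) st1 of (b', st') \<Rightarrow>
            cval b' st' = A (Suc ?i) (cval b1 st1 - 1) \<and> good k B (m + 2 ^ Suc d - 1) b' st'"
          using Suc.IH(2)[OF d(2,1) conjunct2[OF good_Suc[OF 1(3)]]] lim y1
          by (auto simp: i dec split: prod.splits)
        moreover have "A_inv ?i L = Some (A (Suc ?i) (cval b1 st1 - 1))"
          using A_inv_A[OF A_in_dom[of ?i "cval b1 st1 - 1"]] A y1 i by simp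
        ultimately show ?thesis using 1(1) 4 val0
          by (auto simp: Cons rc i split: prod.splits)
      qed
    qed
  next
    case 2
    then have i: "2 \<le> ?i" "k + 1 - Suc d = ?i" "k + 1 - d = Suc ?i" "Suc k - d = Suc ?i" by auto
    have app: "appc k B (Suc d) b st = (case invc k B d b st of None \<Rightarrow> raw B ?i b st
     | Some (b', st') \<Rightarrow> appc k B d (b' + 1) st')" by simp
    show ?case
    proof (cases "invc k B d b st")
      case None
      \<comment> \<open>At the top index \<open>?i = k\<close> the test \<open>invc k B 0\<close>
        fails by convention and proves nothing, but \<open>layers\<close> asks for nothing there
        either.\<close>
      have no: "A_inv (Suc ?i) (cval b st) = None" if "?i < k"
        using Suc.IH(1)[of m b st] that 2 None i by simp
      \<comment> \<open>A layered argument exceeds \<open>2 ^ (B - 1)\<close>, hence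
        \<open>B\<close>, so its image under \<open>A ?i\<close> is above the threshold without
        being computed.\<close>
      have large: "2 ^ B < A ?i (cval b st)" if "st \<noteq> []"
      proof -
        have "int B \<le> 2 ^ (B - 1)"
        proof (cases B)
          case (Suc n)
          have "Suc n \<le> 2 ^ n" by (induction n) auto
          then show ?thesis using Suc by (metis diff_Suc_1 of_nat_le_iff of_nat_numeral of_nat_power)
        qed simp
        moreover have "2 ^ (B - 1) < cval b st" using layered_large[OF 2(3) that] 2(4) by simp
        ultimately have "int B < cval b st" by linarith
        then have "(2::int) ^ B < 2 ^ nat (cval b st)" by (intro power_strict_increasing) auto
        also have "\<dots> \<le> A ?i (cval b st)" using A_ge_pow2 i 2 by simp
        finally show ?thesis .
      qed
      \<comment> \<open>If a value of \<open>A ?i\<close> other than 1 were in the image of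
        \<open>A (Suc ?i)\<close>, then its argument would be in that image as well; the failed test
        rules this out, so \<open>?i\<close> is the largest index.\<close>
      have new: "A_inv (Suc ?i) (A ?i (cval b st)) = None"
        if "?i < k" "2 ^ B < A ?i (cval b st)"
      proof -
        have "1 < A ?i (cval b st)" using that(2) by (meson one_le_power le_less_trans one_le_numeral)
        moreover have "A_inv ?i (A ?i (cval b st)) = Some (cval b st)"
          using 2 i by (intro A_inv_A) (simp add: A_dom_ge2)
        ultimately show ?thesis using no[OF that(1)] i by (simp add: A_inv_Suc)
      qed
      have gm: "layers k B (m + 2 ^ Suc d - 1) st" "st \<noteq> [] \<Longrightarrow> \<bar>b\<bar> < 2 ^ (m + 2 ^ Suc d - 1)"
        using good_mono[OF 2(3) order.refl add_pow_minus_one, of "Suc d"] by (auto simp: good_def)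
      show ?thesis
      proof (cases "st = [] \<and> 0 \<le> b \<and> A ?i b \<le> 2 ^ B")
        case True
        then show ?thesis using None by (simp add: app raw_def i good_def)
      next
        case False
        then have "2 ^ B < A ?i (cval b st)" using large 2 by (cases "st = []") auto
        then show ?thesis using None False new gm i 2 by (auto simp: raw_def good_def)
      qed
    next
      case (Some p)
      obtain b1 st1 where p: "p = (b1, st1)" by force
      have lim: "m + 2 ^ d + 1 \<le> B" "m + 2 ^ d - 1 + 1 + 2 ^ d + 1 \<le> B"
        "m + 2 ^ d - 1 + 1 + 2 ^ d - 1 = m + 2 ^ Suc d - 1" using 2(4) by auto
      have d: "1 \<le> d" "d < k" using Some 2(1) by (cases d; simp)+
      have y: "A_inv (Suc ?i) (cval b st) = Some (cval b1 st1)" "good k B (m + 2 ^ d - 1) b1 st1"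
        using Suc.IH(1)[OF d(2,1) 2(3)] 2(4) Some p by (auto simp: i)
      have y0: "0 \<le> cval b1 st1" "A (Suc ?i) (cval b1 st1) = cval b st"
        using A_inv_ge2[OF _ y(1)] i by auto
      have inc: "cval (b1 + 1) st1 = cval b1 st1 + 1" by (cases "(b1, st1)" rule: cval.cases) auto
      have "A (Suc ?i) (cval b1 st1 + 1) = A ?i (cval b st)"
        using A_Suc[of ?i "cval b1 st1 + 1"] y0 i by simp
      then show ?thesis
        using Suc.IH(2)[OF d(2,1) conjunct1[OF good_Suc[OF y(2)]]] lim y0 Some p
        by (auto simp: i inc split: prod.splits)
    qed
  }
qed simp_all

text \<open>\<open>good\<close> protects correctness and leaves explicit integers unbounded; the
  running time needs a bound on everything stored. This bound is propagated without assuming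
  \<open>good\<close>.\<close>

definition bits_le :: "nat \<Rightarrow> int \<Rightarrow> (nat \<times> int) list \<Rightarrow> bool" where
  "bits_le m b st \<longleftrightarrow> \<bar>b\<bar> < 2 ^ m \<and> (\<forall>(r, c)\<in>set st. \<bar>c\<bar> < 2 ^ m)"

lemma bits_le_mono: "bits_le m b st \<Longrightarrow> m \<le> m' \<Longrightarrow> bits_le m' b st"
  unfolding bits_le_def using abs_less_pow_mono by blast

lemma bits_le_Suc: "bits_le m b st \<Longrightarrow> bits_le (Suc m) (b + 1) st \<and> bits_le (Suc m) (b - 1) st"
  using bits_le_mono[of m b st "Suc m"] abs_less_pow_Suc by (auto simp: bits_le_def)

lemma bits_le_step:
  assumes "bits_le (m + 2 ^ d - 1) b st" "e = 1 \<or> e = -1"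
  shows "bits_le (m + 2 ^ d) (b + e) st"
proof -
  have "Suc (m + 2 ^ d - 1) = m + 2 ^ d" using one_le_power[of "2::nat" d] by linarith
  then show ?thesis using bits_le_Suc[OF assms(1)] assms(2) by (elim disjE) simp_all
qed

lemma bits_le_raw: "bits_le m b st \<Longrightarrow> B < m \<Longrightarrow> 2 \<le> i \<Longrightarrow>
    (case raw B i b st of (b', st') \<Rightarrow> bits_le m b' st')"
  using power_strict_increasing[of B m "2::int"] A_pos[of i b]
  by (auto simp: raw_def bits_le_def intro: le_less_trans)

text \<open>The same recursion \<open>2 ^ d - 1\<close> as for correctness; explicit inverses shrink
  their argument, and \<open>B < m\<close> absorbs the explicit values, at most
  \<open>2 ^ B\<close>, that \<open>raw\<close> produces.\<close>

lemma bits_le_invc_appc: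
  shows "d < k \<Longrightarrow> bits_le m b st \<Longrightarrow> B < m \<Longrightarrow> invc k B d b st = Some (b', st') \<Longrightarrow>
      bits_le (m + 2 ^ d - 1) b' st'"
    and "d < k \<Longrightarrow> bits_le m b st \<Longrightarrow> B < m \<Longrightarrow> appc k B d b st = (b', st') \<Longrightarrow>
      bits_le (m + 2 ^ d - 1) b' st'"
proof (induction d arbitrary: m b st b' st')
  case (Suc d)
  {
    case 1
    then have lim: "m \<le> m + 2 ^ Suc d - 1" "m + 2 ^ d + 2 ^ d - 1 = m + 2 ^ Suc d - 1"
      "B < m + 2 ^ d" using add_pow_minus_one[of m d] add_pow_minus_one[of m "Suc d"] by auto
    show ?case
    proof (cases st)
      case Nil
      then have "A_inv (k - d) b = Some b'" "st' = []" using 1 by auto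
      moreover have "2 \<le> k - d" using 1(1) by simp
      ultimately have "bits_le m b' st'"
        using A_inv_ge2(1,3)[of "k - d" b b'] 1(1,2) Nil by (auto simp: bits_le_def)
      then show ?thesis using bits_le_mono lim by blast
    next
      case (Cons rc st1)
      obtain r c where rc: "rc = (r, c)" by force
      show ?thesis
      proof (cases "r = k - d")
        case True
        then have "bits_le m b' st'" using 1 by (auto simp: Cons rc bits_le_def split: if_splits)
        then show ?thesis using bits_le_mono lim by blast
      next
        case False
        then obtain b2 st2 where 2: "invc k B d b st = Some (b2, st2)" "appc k B d (b2 - 1) st2 = (b', st')"
          using 1(4) by (auto simp: Cons rc split: if_splits)
        have "bits_le (m + 2 ^ d) (b2 - 1) st2"
          using bits_le_step[of m d b2 st2 "- 1"] Suc.IH(1)[OF _ 1(2,3) 2(1)] 1(1) by simp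
        then show ?thesis using Suc.IH(2)[OF _ _ lim(3) 2(2)] 1(1) lim(2) by simp
      qed
    qed
  next
    case 2
    then have lim: "m \<le> m + 2 ^ Suc d - 1" "m + 2 ^ d + 2 ^ d - 1 = m + 2 ^ Suc d - 1"
      "B < m + 2 ^ d" using add_pow_minus_one[of m d] add_pow_minus_one[of m "Suc d"] by auto
    show ?case
    proof (cases "invc k B d b st")
      case None
      then have "bits_le m b' st'" using 2 bits_le_raw[of m b st B "k - d"] by auto
      then show ?thesis using bits_le_mono lim by blast
    next
      case (Some p)
      obtain b2 st2 where p: "p = (b2, st2)" by force
      have "bits_le (m + 2 ^ d) (b2 + 1) st2"
        using bits_le_step[of m d b2 st2 1] Suc.IH(1)[OF _ 2(2,3), of b2 st2] 2(1) Some p by simp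
      moreover have "appc k B d (b2 + 1) st2 = (b', st')" using 2(4) Some p by simp
      ultimately show ?thesis using Suc.IH(2)[OF _ _ lim(3)] 2(1) lim(2) by simp
    qed
  }
qed simp_all

text \<open>For \<open>L = A 2 y\<close> with \<open>y > 0\<close> one has
  \<open>2 * L = A 2 (y + 1)\<close> and \<open>L div 2 = A 2 (y - 1)\<close>. So doubling and
  halving a layered number shift its top layer through index 2, which is \<open>d = k - 1\<close>,
  while the offset is doubled or halved separately; \<open>snd\<close> drops the vanishing offset of
  the shifted layer. Layer values are even, so parity is that of \<open>b\<close>. Only explicit
  numbers can be negative.\<close>

fun stepc :: "nat \<Rightarrow> nat \<Rightarrow> letter \<Rightarrow> int \<Rightarrow> (nat \<times> int) list \<Rightarrow> cfg option" where
  "stepc k B (Ack 0) b st = Some (b + 1, st)"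
| "stepc k B (Ack (Suc 0)) b st = (if st = [] then Some (2 * b, [])
     else map_option (\<lambda>(b', st'). (2 * b, snd (appc k B (k - 1) (b' + 1) st'))) (invc k B (k - 1) 0 st))"
| "stepc k B (Ack (Suc (Suc i))) b st =
    (if st = [] \<and> b < 0 then None else Some (appc k B (k - Suc i) b st))"
| "stepc k B (AckInv 0) b st = Some (b - 1, st)"
| "stepc k B (AckInv (Suc 0)) b st = (if odd b then None else if st = [] then Some (b div 2, [])
     else map_option (\<lambda>(b', st'). (b div 2, snd (appc k B (k - 1) (b' - 1) st'))) (invc k B (k - 1) 0 st))"
| "stepc k B (AckInv (Suc (Suc i))) b st = invc k B (k - Suc i) b st"

section \<open>Correctness of a single letter and of a word\<close>

lemma cval_add: "cval (a + b) st = cval a st + b"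
  by (cases "(a, st)" rule: cval.cases) auto

lemma bits_le_stepc:
  assumes "index x \<le> k" "bits_le m b st" "B < m" "stepc k B x b st = Some (b', st')"
  shows "bits_le (m + 2 ^ k) b' st'"
proof -
  have Suc: "bits_le (m + 2 ^ k) b1 st1" if "bits_le (Suc m) b1 st1" for b1 st1
    using bits_le_mono[OF that] by simp
  have app: "bits_le (m + 2 ^ k) b1 st1" if "bits_le (m + 2 ^ d - 1) b1 st1" "d < k" for b1 st1 d
  proof -
    have "m + 2 ^ d - 1 \<le> m + 2 ^ k" using power_increasing[of d k "2::nat"] that(2) by linarith
    then show ?thesis using bits_le_mono that(1) by blast
  qed
  have one: "bits_le (m + 2 ^ k) c (snd (appc k B (k - 1) (b1 + e) st1))"
    if "invc k B (k - 1) 0 st = Some (b1, st1)" "\<bar>c\<bar> < 2 ^ Suc m" "e = 1 \<or> e = -1" for b1 st1 c e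
  proof -
    have k: "k - 1 < k" "Suc (k - 1) = k" using that(1) by (cases k; simp)+
    have "bits_le m 0 st" using assms(2) by (auto simp: bits_le_def)
    then have z: "bits_le (m + 2 ^ (k - 1)) (b1 + e) st1"
      using bits_le_step bits_le_invc_appc(1)[OF k(1) _ assms(3) that(1)] that(3) by blast
    obtain b2 st2 where 2: "appc k B (k - 1) (b1 + e) st1 = (b2, st2)" by force
    have "B < m + 2 ^ (k - 1)" using assms(3) by simp
    then have "bits_le (m + 2 ^ (k - 1) + 2 ^ (k - 1) - 1) b2 st2"
      by (rule bits_le_invc_appc(2)[OF k(1) z _ 2])
    moreover have "m + 2 ^ (k - 1) + 2 ^ (k - 1) - 1 \<le> m + 2 ^ k"
      using power_Suc[of "2::nat" "k - 1"] k by simp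
    ultimately have "bits_le (m + 2 ^ k) b2 st2" by (rule bits_le_mono)
    moreover have "\<bar>c\<bar> < 2 ^ (m + 2 ^ k)" by (rule abs_less_pow_mono[OF that(2)]) simp
    ultimately show ?thesis unfolding 2 by (simp add: bits_le_def)
  qed
  have b2: "\<bar>2 * b\<bar> < 2 ^ Suc m" "\<bar>b div 2\<bar> < 2 ^ Suc m"
    using assms(2) by (auto simp: bits_le_def)
  show ?thesis
  proof (cases "(k, B, x, b, st)" rule: stepc.cases)
    case (2 k' B' c st0)
    then show ?thesis using assms(4) Suc[of b' "[]"] b2 one[of _ _ "2 * b" 1]
      by (auto simp: bits_le_def split: if_splits)
  next
    case (5 k' B' c st0)
    then show ?thesis using assms(4) Suc[of b' "[]"] b2 one[of _ _ "b div 2" "- 1"]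
      by (auto simp: bits_le_def split: if_splits)
  next
    case (3 k' B' i c st0)
    then have d: "k - Suc i < k" using assms(1) by simp
    have "appc k B (k - Suc i) b st = (b', st')" using 3 assms(4) by (simp split: if_splits)
    from app[OF bits_le_invc_appc(2)[OF d assms(2,3) this] d] show ?thesis .
  next
    case (6 k' B' i c st0)
    then have d: "k - Suc i < k" using assms(1) by simp
    have "invc k B (k - Suc i) b st = Some (b', st')" using 6 assms(4) by simp
    from app[OF bits_le_invc_appc(1)[OF d assms(2,3) this] d] show ?thesis .
  qed (use assms Suc bits_le_Suc in auto)
qed

text \<open>One unit of the threshold pays for halving: from \<open>L > 2 ^ Suc B\<close> both
  \<open>2 * L\<close> and \<open>L div 2\<close> exceed \<open>2 ^ B\<close>, so that the result of
  \<open>appc\<close> is again layered and has offset 0.\<close>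

lemma A1_layered:
  assumes g: "good k (Suc B) m b st" "st \<noteq> []" and B: "m + 2 ^ k + 2 \<le> B" and "\<bar>c\<bar> < 2 ^ (m + 2 ^ k)"
  shows "\<exists>b1 st1. invc k B (k - 1) 0 st = Some (b1, st1) \<and>
      cval c (snd (appc k B (k - 1) (b1 + 1) st1)) = 2 * cval 0 st + c \<and>
      good k B (m + 2 ^ k) c (snd (appc k B (k - 1) (b1 + 1) st1)) \<and>
      even (cval 0 st) \<and>
      cval c (snd (appc k B (k - 1) (b1 - 1) st1)) = cval 0 st div 2 + c \<and>
      good k B (m + 2 ^ k) c (snd (appc k B (k - 1) (b1 - 1) st1))"
proof -
  obtain r x st' where st: "st = (r, x) # st'" using g(2) by (cases st) auto
  define L where "L = cval 0 st"
  have L: "2 \<le> r" "r \<le> k" "0 \<le> cval x st'" "L = A r (cval x st')" "2 ^ Suc B < L"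
    using g(1) by (auto simp: st good_def L_def)
  have k: "k - 1 < k" "1 \<le> k - 1" "Suc (k - 1) = k" "k + 1 - (k - 1) = 2" using L by auto
  have g0: "good k B m 0 st" using good_mono[OF g(1), of B m] by (auto simp: good_def)
  have p2: "2 ^ (k - 1) + 2 ^ (k - 1) = (2::nat) ^ k" using power_Suc[of "2::nat" "k - 1"] k by simp
  have lim: "m + 2 ^ (k - 1) + 1 \<le> B" using B p2 by linarith
  have "A_inv 2 L \<noteq> None"
    using A_inv_mono[of 2 r L] L A_inv_A[of "cval x st'" r] by (auto simp: A_dom_ge2)
  then obtain b1 st1 where 1: "invc k B (k - 1) 0 st = Some (b1, st1)" "A_inv 2 L = Some (cval b1 st1)"
    "good k B (m + 2 ^ (k - 1) - 1) b1 st1"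
    using invc_appc_correct(1)[OF k(1,2) g0 lim] k(4) by (auto simp: L_def split: option.splits)
  have y: "0 \<le> cval b1 st1" "A 2 (cval b1 st1) = L" using A_inv_ge2[OF _ 1(2)] by auto
  have Lp: "2 ^ nat (cval b1 st1) = L" using y A_two by simp
  have "(2::int) ^ Suc B < 2 ^ nat (cval b1 st1)" using Lp L by simp
  then have y2: "2 \<le> cval b1 st1" using power_strict_increasing_iff[of "2::int" "Suc B" "nat (cval b1 st1)"] B
    by simp
  have step: "cval c (snd (appc k B (k - 1) z st1)) = A 2 (cval z st1) + c \<and>
      good k B (m + 2 ^ k) c (snd (appc k B (k - 1) z st1))"
    if z: "good k B (Suc (m + 2 ^ (k - 1) - 1)) z st1" "0 \<le> cval z st1" "2 ^ B < A 2 (cval z st1)" for z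
  proof -
    obtain b2 st2 where 2: "appc k B (k - 1) z st1 = (b2, st2)" by force
    have "Suc (m + 2 ^ (k - 1) - 1) + 2 ^ (k - 1) + 1 \<le> B" using B p2 by simp
    from invc_appc_correct(2)[OF k(1,2) z(1) this z(2)]
    have 3: "cval b2 st2 = A 2 (cval z st1)" "good k B (Suc (m + 2 ^ (k - 1) - 1) + 2 ^ (k - 1) - 1) b2 st2"
      "st2 \<noteq> [] \<Longrightarrow> b2 = 0" "st2 = [] \<Longrightarrow> b2 \<le> 2 ^ B" unfolding 2 k(4) by simp_all
    have "st2 \<noteq> []" using 3 z(3) by auto
    then have "cval b2 st2 + c = cval c st2" using 3(3) cval_add[of 0 c st2] by simp
    moreover have "good k B (m + 2 ^ k) c st2"
      using good_mono[OF 3(2), of B "m + 2 ^ k"] p2 assms(4) by (simp add: good_def)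
    ultimately show ?thesis using 2 3 by simp
  qed
  have pow: "A 2 (cval b1 st1 + 1) = 2 * L" "2 * A 2 (cval b1 st1 - 1) = L"
    using A_Suc[of 1 "cval b1 st1 + 1"] A_Suc[of 1 "cval b1 st1"] y y2 by (simp_all add: A_Suc_0 numeral_2_eq_2)
  then have "2 ^ B < A 2 (cval b1 st1 + 1)" "2 ^ B < A 2 (cval b1 st1 - 1)"
    "L div 2 = A 2 (cval b1 st1 - 1)" "even L"
  proof -
    have "0 < (2::int) ^ B" by simp
    then show "2 ^ B < A 2 (cval b1 st1 + 1)" using pow L(5) by (simp only: power_Suc)
    show "even L" unfolding pow(2)[symmetric] by simp
  qed (use pow L(5) in simp_all)
  then show ?thesis
    using step[of "b1 + 1"] step[of "b1 - 1"] good_Suc[OF 1(3)] y2 pow 1(1)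
    unfolding L_def[symmetric] by (simp add: cval_add cval_add[of b1 "- 1", simplified])
qed

lemma stepc_correct:
  assumes x: "index x \<le> k" and g: "good k (Suc B) m b st" and B: "m + 2 ^ k + 2 \<le> B"
  shows "case stepc k B x b st of None \<Rightarrow> apply_letter x (cval b st) = None
    | Some (b', st') \<Rightarrow> apply_letter x (cval b st) = Some (cval b' st') \<and> good k B (m + 2 ^ k) b' st'"
proof -
  have gB: "good k B m b st" using good_mono[OF g] by simp
  have gS: "good k B (m + 2 ^ k) (b + 1) st" "good k B (m + 2 ^ k) (b - 1) st"
    using good_Suc[OF gB] good_mono[of k B "Suc m" _ st B "m + 2 ^ k"] by auto
  have large: "0 \<le> cval b st" if "st \<noteq> []"
  proof -
    have "0 < (2::int) ^ (B - 1)" by simp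
    moreover have "2 ^ (B - 1) < cval b st" using layered_large[OF gB that] B by simp
    ultimately show ?thesis by linarith
  qed
  have b2: "\<bar>2 * b\<bar> < 2 ^ (m + 2 ^ k)" "\<bar>b div 2\<bar> < 2 ^ (m + 2 ^ k)" if "st \<noteq> []"
    using gB that abs_less_pow_mono[of "2 * b" "Suc m" "m + 2 ^ k"]
      abs_less_pow_mono[of "b div 2" "m" "m + 2 ^ k"] by (auto simp: good_def)
  have higher: "k - Suc i < k" "1 \<le> k - Suc i" "k + 1 - (k - Suc i) = Suc (Suc i)"
      "m + 2 ^ (k - Suc i) + 1 \<le> B" "m + 2 ^ (k - Suc i) - 1 \<le> m + 2 ^ k" if "Suc (Suc i) \<le> k" for i
  proof -
    have "2 ^ (k - Suc i) \<le> (2::nat) ^ k" by (intro power_increasing) auto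
    then show "m + 2 ^ (k - Suc i) + 1 \<le> B" "m + 2 ^ (k - Suc i) - 1 \<le> m + 2 ^ k"
      using B by linarith+
  qed (use that in auto)
  have split: "cval b st = cval 0 st + b" using cval_add[of 0 b st] by simp
  show ?thesis
  proof (cases "(k, B, x, b, st)" rule: stepc.cases)
    case (1 k B b st)
    then show ?thesis using gS by (simp add: A_dom_def A_0 cval_add)
  next
    case (2 k B b st)
    then show ?thesis using A1_layered[OF g _ B, of "2 * b"] b2 split
      by (cases "st = []") (auto simp: A_dom_def A_Suc_0 good_def split: option.splits)
  next
    case (3 k' B' i b' st')
    then have i: "Suc (Suc i) \<le> k" using x by simp
    show ?thesis
    proof (cases "0 \<le> cval b st")
      case True
      then have "\<not> (st = [] \<and> b < 0)" by auto
      then show ?thesis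
        using 3 invc_appc_correct(2)[OF higher(1,2) gB higher(4) True, OF i i i] higher(3,5)[OF i]
          good_mono[of k B "m + 2 ^ (k - Suc i) - 1" _ _ B "m + 2 ^ k"] True
        by (simp add: A_dom_ge2 split: prod.splits)
    next
      case False
      then have "st = []" using large 3 by auto
      then show ?thesis using 3 False by (simp add: A_dom_ge2)
    qed
  next
    case (4 k B b st)
    then show ?thesis using gS by (simp add: A_inv_zero cval_add[of b "- 1", simplified])
  next
    case (5 k B b st)
    then show ?thesis using A1_layered[OF g _ B, of "b div 2"] b2 split
      by (cases "st = []") (auto simp: A_inv_one good_def split: option.splits)
  next
    case (6 k' B' i b' st')
    then have i: "Suc (Suc i) \<le> k" using x by simp
    show ?thesis
      using 6 invc_appc_correct(1)[OF higher(1,2) gB higher(4), OF i i i] higher(3,5)[OF i]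
          good_mono[of k B "m + 2 ^ (k - Suc i) - 1" _ _ B "m + 2 ^ k"]
      by (simp split: option.splits prod.splits)
  qed
qed

text \<open>The configuration after the first \<open>j\<close> letters of \<open>w\<close> (in the order in which they are
  applied), together with a flag that is set once a letter could not be applied.\<close>

fun trace :: "nat \<Rightarrow> nat \<Rightarrow> letter list \<Rightarrow> nat \<Rightarrow> cfg \<times> bool" where
  "trace k B w 0 = ((0, []), False)"
| "trace k B w (Suc j) = (let (cf, e) = trace k B w j in
     if e then (cf, True)
     else case stepc k (B - Suc j) (w ! j) (fst cf) (snd cf) of
         None \<Rightarrow> (cf, True)
       | Some cf' \<Rightarrow> (cf', False))"

text \<open>After \<open>j\<close> letters the offsets have at most \<open>j * 2 ^ k\<close> bits,
  and the next letter lowers the threshold to \<open>B - Suc j\<close>; the requirement of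
  \<open>stepc_correct\<close> then reads \<open>j * 2 ^ k + 2 ^ k + 2 \<le> B - Suc j\<close>, and
  its worst case is the stated bound on \<open>B\<close>.\<close>

lemma trace_correct:
  assumes "\<forall>x\<in>set w. index x \<le> k" "(2 ^ k + 1) * length w + 2 \<le> B" "j \<le> length w"
  shows "case trace k B w j of ((b, st), e) \<Rightarrow>
    eval_word (rev (take j w)) 0 = (if e then None else Some (cval b st)) \<and>
    bits_le (B + 1 + j * 2 ^ k) b st \<and> (\<not> e \<longrightarrow> good k (B - j) (j * 2 ^ k) b st)"
  using assms(3)
proof (induction j)
  case 0
  then show ?case by (simp add: bits_le_def good_def)
next
  case (Suc j)
  then have j: "j < length w" by simp
  obtain b st e where t: "trace k B w j = ((b, st), e)" by (metis prod.collapse)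
  have x: "index (w ! j) \<le> k" using assms(1) j by simp
  have app: "rev (take (Suc j) w) = w ! j # rev (take j w)" using j by (simp add: take_Suc_conv_app_nth)
  have IH: "eval_word (rev (take j w)) 0 = (if e then None else Some (cval b st))"
    "bits_le (B + 1 + j * 2 ^ k) b st" "\<not> e \<Longrightarrow> good k (B - j) (j * 2 ^ k) b st"
    using Suc j t by auto
  have "(2 ^ k + 1) * Suc j \<le> (2 ^ k + 1) * length w" using j by (intro mult_le_mono2) simp
  then have B: "Suc j \<le> B" "j * 2 ^ k + 2 ^ k + 2 \<le> B - Suc j" "B - j = Suc (B - Suc j)"
    using assms(2) by (simp_all add: algebra_simps)
  show ?case
  proof (cases e)
    case True
    then show ?thesis using IH t bits_le_mono[OF IH(2), of "B + 1 + Suc j * 2 ^ k"] app by simp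
  next
    case False
    have c: "case stepc k (B - Suc j) (w ! j) b st of None \<Rightarrow> apply_letter (w ! j) (cval b st) = None
      | Some (b', st') \<Rightarrow> apply_letter (w ! j) (cval b st) = Some (cval b' st') \<and>
         good k (B - Suc j) (j * 2 ^ k + 2 ^ k) b' st'"
      using stepc_correct[OF x _ B(2)] IH(3)[OF False] B(3) by simp
    show ?thesis
    proof (cases "stepc k (B - Suc j) (w ! j) b st")
      case None
      then show ?thesis using c IH False t bits_le_mono[OF IH(2), of "B + 1 + Suc j * 2 ^ k"] app by simp
    next
      case (Some cf)
      obtain b' st' where cf: "cf = (b', st')" by force
      have "bits_le (B + 1 + j * 2 ^ k + 2 ^ k) b' st'"
        using bits_le_stepc[OF x IH(2) _ Some[unfolded cf]] by simp
      then show ?thesis using c Some cf IH(1) False t app by (simp add: algebra_simps)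
    qed
  qed
qed

lemma verdict_trace:
  assumes "w \<in> words k" "(2 ^ k + 1) * length w + 2 \<le> B"
  shows "verdict_of w = (case trace k B (rev w) (length w) of ((b, st), e) \<Rightarrow>
    if e then Invalid else if st \<noteq> [] then Positive
    else if b < 0 then Negative else if b = 0 then Zero else Positive)"
proof -
  obtain b st e where t: "trace k B (rev w) (length w) = ((b, st), e)" by (metis prod.collapse)
  have T: "eval_word w 0 = (if e then None else Some (cval b st))"
      "\<not> e \<Longrightarrow> good k (B - length w) (length w * 2 ^ k) b st"
    using trace_correct[of "rev w" k B "length w"] assms t by (auto simp: words_def)
  have "0 < cval b st" if "st \<noteq> []" "\<not> e"
  proof -
    have "0 < (2::int) ^ (B - length w - 1)" by simp
    moreover have "Suc (length w * 2 ^ k) \<le> B - length w"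
      using assms(2) by (simp add: algebra_simps)
    ultimately show ?thesis using layered_large[OF T(2)[OF that(2)] that(1)] by linarith
  qed
  then show ?thesis using T(1) t by (auto simp: verdict_of_def valid_iff)
qed

subsection \<open>Running times of commands\<close>

lemma run_mono: "run c s n s' \<Longrightarrow> n \<le> m \<Longrightarrow> run c s m s'"
  unfolding run_def using le_trans by blast

lemma run_Skip: "1 \<le> n \<Longrightarrow> run Skip s n s"
  unfolding run_def using exec_Skip by blast

lemma run_Seq: "run c s n s' \<Longrightarrow> run d s' m s'' \<Longrightarrow> run (c ;; d) s (n + m + 1) s''"
  unfolding run_def by (meson add_le_mono exec_Seq order_refl)

lemma run_CondT: "peek (s r) \<in> X \<Longrightarrow> run c s n s' \<Longrightarrow> run (Cond r X c d) s (n + 1) s'"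
  unfolding run_def by (meson add_le_mono exec_CondT order_refl)

lemma run_CondF: "peek (s r) \<notin> X \<Longrightarrow> run d s n s' \<Longrightarrow> run (Cond r X c d) s (n + 1) s'"
  unfolding run_def by (meson add_le_mono exec_CondF order_refl)

lemma run_LoopF: "peek (s r) \<notin> X \<Longrightarrow> s' = s \<Longrightarrow> 1 \<le> n \<Longrightarrow> run (Loop r X c) s n s'"
  unfolding run_def using exec_LoopF by blast

lemma run_LoopT: "peek (s r) \<in> X \<Longrightarrow> run c s n s' \<Longrightarrow> run (Loop r X c) s' m s'' \<Longrightarrow>
    run (Loop r X c) s (n + m + 1) s''"
  unfolding run_def by (meson add_le_mono exec_LoopT order_refl)

lemma run_Psh: "f (peek (s a)) \<noteq> 0 \<Longrightarrow> s' = s(b := f (peek (s a)) # s b) \<Longrightarrow> 2 \<le> n \<Longrightarrow>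
    run (Psh b a f) s n s'"
  unfolding run_def using exec_Psh by blast

lemma run_Pop: "s' = s(a := tl (s a)) \<Longrightarrow> 1 \<le> n \<Longrightarrow> run (Pop a) s n s'"
  unfolding run_def using exec_Pop by blast

text \<open>Lets an induction over the iterations treat a loop together with the code after it as
  one command, which is what the inductions for \<open>GROW\<close> and \<open>SHRINK\<close>
  need.\<close>

lemma run_LoopT_Seq:
  assumes "peek (s r) \<in> X" "run c s n s'" "run (Loop r X c ;; d) s' m s''"
  shows "run (Loop r X c ;; d) s (n + m + 1) s''"
proof -
  obtain t where t: "t \<le> m" "exec (Loop r X c ;; d) s' t s''" using assms(3) by (auto simp: run_def)
  from t(2) obtain u v s1 where u: "exec (Loop r X c) s' u s1" "exec d s1 v s''" "t = u + v + 1"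
    by (auto elim: exec_SeqE)
  have "run (Loop r X c) s (n + u + 1) s1"
    using run_LoopT[OF assms(1,2)] u(1) by (auto simp: run_def)
  moreover have "run d s1 v s''" using u(2) by (auto simp: run_def)
  ultimately have "run (Loop r X c ;; d) s (n + u + 1 + v + 1) s''" by (rule run_Seq)
  then show ?thesis by (rule run_mono) (use t(1) u(3) in simp)
qed

text \<open>The families \<open>f\<close> and \<open>g\<close> assign to each instance \<open>z\<close> of size \<open>Z\<close> the initial and the final state;
  quantifying the polynomial outside the family is what makes the bound uniform.\<close>

definition ptime :: "(nat \<Rightarrow> 'z \<Rightarrow> bool) \<Rightarrow> com \<Rightarrow> ('z \<Rightarrow> stacks) \<Rightarrow> ('z \<Rightarrow> stacks) \<Rightarrow> bool" where
  "ptime D c f g \<longleftrightarrow> (\<exists>p :: nat poly. \<forall>Z z. D Z z \<longrightarrow> run c (f z) (poly p Z) (g z))"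

section \<open>Rules for uniform polynomial time\<close>

lemma ptime_run:
  assumes "\<And>Z z. D Z z \<Longrightarrow> run c (f z) (a * l z + b) (g z)" "\<And>Z z. D Z z \<Longrightarrow> l z \<le> poly q Z"
  shows "ptime D c f g"
proof -
  have "run c (f z) (poly ([:a:] * q + [:b:]) Z) (g z)" if "D Z z" for Z z
    by (rule run_mono[OF assms(1)[OF that]]) (use assms(2)[OF that] in simp)
  then show ?thesis unfolding ptime_def by blast
qed

lemma ptime_Seq:
  assumes "ptime D c f g" "ptime D d g h"
  shows "ptime D (c ;; d) f h"
proof -
  obtain p q where "\<And>Z z. D Z z \<Longrightarrow> run c (f z) (poly p Z) (g z)" "\<And>Z z. D Z z \<Longrightarrow> run d (g z) (poly q Z) (h z)"
    using assms unfolding ptime_def by blast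
  then have "run (c ;; d) (f z) (poly (p + q + 1) Z) (h z)" if "D Z z" for Z z
    using run_Seq that by fastforce
  then show ?thesis unfolding ptime_def by blast
qed

lemma ptime_cases:
  assumes "ptime (\<lambda>Z z. D Z z \<and> Q z) c f g" "ptime (\<lambda>Z z. D Z z \<and> \<not> Q z) c f g"
  shows "ptime D c f g"
proof -
  obtain p q where pq: "\<And>Z z. D Z z \<Longrightarrow> Q z \<Longrightarrow> run c (f z) (poly p Z) (g z)"
      "\<And>Z z. D Z z \<Longrightarrow> \<not> Q z \<Longrightarrow> run c (f z) (poly q Z) (g z)"
    using assms unfolding ptime_def by blast
  have "run c (f z) (poly (p + q) Z) (g z)" if "D Z z" for Z z
    using run_mono[OF pq(1)[OF that]] run_mono[OF pq(2)[OF that]] by (cases "Q z") simp_all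
  then show ?thesis unfolding ptime_def by blast
qed

lemma ptime_CondT:
  assumes "ptime D c f g" "\<And>Z z. D Z z \<Longrightarrow> peek (f z r) \<in> X"
  shows "ptime D (Cond r X c d) f g"
proof -
  obtain p where "\<And>Z z. D Z z \<Longrightarrow> run c (f z) (poly p Z) (g z)"
    using assms(1) unfolding ptime_def by blast
  then have "run (Cond r X c d) (f z) (poly (p + 1) Z) (g z)" if "D Z z" for Z z
    using run_CondT assms(2) that by fastforce
  then show ?thesis unfolding ptime_def by blast
qed

lemma ptime_CondF:
  assumes "ptime D d f g" "\<And>Z z. D Z z \<Longrightarrow> peek (f z r) \<notin> X"
  shows "ptime D (Cond r X c d) f g"
proof -
  obtain p where "\<And>Z z. D Z z \<Longrightarrow> run d (f z) (poly p Z) (g z)"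
    using assms(1) unfolding ptime_def by blast
  then have "run (Cond r X c d) (f z) (poly (p + 1) Z) (g z)" if "D Z z" for Z z
    using run_CondF assms(2) that by fastforce
  then show ?thesis unfolding ptime_def by blast
qed

text \<open>Polynomials compose, so a bound for a called command carries over to the caller as soon
  as the size of the called instance is a polynomial \<open>q\<close> in that of the calling
  one.\<close>

lemma ptime_use:
  assumes "ptime D' c f' g'" "\<And>Z z. D Z z \<Longrightarrow> D' (poly q Z) (h z) \<and> f' (h z) = f z \<and> g' (h z) = g z"
  shows "ptime D c f g"
proof -
  obtain p where "\<And>Z z. D' Z z \<Longrightarrow> run c (f' z) (poly p Z) (g' z)"
    using assms(1) unfolding ptime_def by blast
  then have "run c (f z) (poly (pcompose p q) Z) (g z)" if "D Z z" for Z z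
    using assms(2)[OF that] by (metis poly_pcompose)
  then show ?thesis unfolding ptime_def by blast
qed

lemma ptime_cong:
  assumes "ptime D' c f' g'" "\<And>Z z. D Z z \<Longrightarrow> D' Z z \<and> f' z = f z \<and> g' z = g z"
  shows "ptime D c f g"
  by (rule ptime_use[OF assms(1), where h = id and q = "[:0, 1:]"]) (use assms(2) in simp)

text \<open>\<open>F z i\<close> is the state after \<open>i\<close> rounds. The round number is
  part of the instance of the body while the size is that of \<open>z\<close> alone, so one
  polynomial bounds all \<open>m z\<close> rounds.\<close>

lemma ptime_Loop:
  assumes body: "ptime (\<lambda>Z (z, i). D Z z \<and> i < m z) c (\<lambda>(z, i). F z i) (\<lambda>(z, i). F z (Suc i))"
    and T: "\<And>Z z i. D Z z \<Longrightarrow> i < m z \<Longrightarrow> peek (F z i r) \<in> X"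
    and Fin: "\<And>Z z. D Z z \<Longrightarrow> peek (F z (m z) r) \<notin> X"
    and m: "\<And>Z z. D Z z \<Longrightarrow> m z \<le> poly q Z"
  shows "ptime D (Loop r X c) (\<lambda>z. F z 0) (\<lambda>z. F z (m z))"
proof -
  obtain p where p: "\<And>Z z i. D Z z \<Longrightarrow> i < m z \<Longrightarrow> run c (F z i) (poly p Z) (F z (Suc i))"
    using body unfolding ptime_def by fast
  have it: "run (Loop r X c) (F z (m z - j)) (j * (poly p Z + 1) + 1) (F z (m z))"
    if D: "D Z z" and "j \<le> m z" for Z z j
    using that(2)
  proof (induction j)
    case 0
    then show ?case using run_LoopF Fin[OF D] by simp
  next
    case (Suc j)
    have i: "m z - Suc j < m z" "Suc (m z - Suc j) = m z - j" using Suc.prems by auto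
    have "run (Loop r X c) (F z (m z - Suc j)) (poly p Z + (j * (poly p Z + 1) + 1) + 1) (F z (m z))"
      by (rule run_LoopT[OF T[OF D i(1)] p[OF D i(1)]]) (use Suc i in simp)
    then show ?case by (rule run_mono) simp
  qed
  have "run (Loop r X c) (F z 0) (poly (q * (p + 1) + 1) Z) (F z (m z))" if D: "D Z z" for Z z
  proof (rule run_mono)
    show "run (Loop r X c) (F z 0) (m z * (poly p Z + 1) + 1) (F z (m z))" using it[OF D, of "m z"] by simp
    show "m z * (poly p Z + 1) + 1 \<le> poly (q * (p + 1) + 1) Z"
      using mult_le_mono1[OF m[OF D], of "poly p Z + 1"] by simp
  qed
  then show ?thesis unfolding ptime_def by blast
qed

lemma ptime_Skip: "ptime D Skip f f"
  by (rule ptime_run[where a = 0 and b = 1 and l = "\<lambda>_. 0" and q = 0]) (auto intro: run_Skip)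

lemma ptime_Psh:
  assumes "\<And>Z z. D Z z \<Longrightarrow> h (peek (f z a)) \<noteq> 0"
    and "\<And>Z z. D Z z \<Longrightarrow> g z = (f z)(b := h (peek (f z a)) # f z b)"
  shows "ptime D (Psh b a h) f g"
  by (rule ptime_run[where a = 0 and b = 2 and l = "\<lambda>_. 0" and q = 0]) (auto intro!: run_Psh assms)

lemma ptime_Psh_const:
  assumes "\<And>Z z. D Z z \<Longrightarrow> g z = (f z)(b := x # f z b)" "x \<noteq> 0"
  shows "ptime D (Psh b a (\<lambda>_. x)) f g"
  by (rule ptime_Psh) (simp_all add: assms)

lemma ptime_Pop:
  assumes "\<And>Z z. D Z z \<Longrightarrow> g z = (f z)(a := tl (f z a))"
  shows "ptime D (Pop a) f g"
  by (rule ptime_run[where a = 0 and b = 1 and l = "\<lambda>_. 0" and q = 0]) (auto intro!: run_Pop assms)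

subsection \<open>Moving stacks\<close>

definition MOVE :: "nat \<Rightarrow> nat set \<Rightarrow> nat \<Rightarrow> com" where
  "MOVE a X b = Loop a X (Psh b a id ;; Pop a)"

lemma run_MOVE:
  assumes "s a = xs @ ys" "set xs \<subseteq> X" "0 \<notin> X" "peek ys \<notin> X" "a \<noteq> b"
    and "s' = s(a := ys, b := rev xs @ s b)" "5 * length xs + 1 \<le> n"
  shows "run (MOVE a X b) s n s'"
proof -
  have "run (MOVE a X b) s (5 * length xs + 1) (s(a := ys, b := rev xs @ s b))"
    using assms(1-5)
  proof (induction xs arbitrary: s)
    case Nil
    then show ?case unfolding MOVE_def by (intro run_LoopF) auto
  next
    case (Cons x xs)
    then have "x \<in> X" by simp
    moreover have "x \<noteq> 0" using Cons.prems by (cases "x = 0") auto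
    ultimately have x: "x \<in> X" "x \<noteq> 0" by auto
    let ?s = "s(b := x # s b, a := xs @ ys)"
    have 1: "run (Psh b a id ;; Pop a) s (2 + 1 + 1) ?s"
      by (rule run_Seq[OF run_Psh[OF _ refl] run_Pop]) (use Cons.prems x in \<open>auto simp: fun_eq_iff\<close>)
    have 2: "run (MOVE a X b) ?s (5 * length xs + 1) (?s(a := ys, b := rev xs @ ?s b))"
      using Cons by (intro Cons.IH) auto
    have 3: "?s(a := ys, b := rev xs @ ?s b) = s(a := ys, b := rev (x # xs) @ s b)"
      using Cons.prems by auto
    have "run (MOVE a X b) s (2 + 1 + 1 + (5 * length xs + 1) + 1) (s(a := ys, b := rev (x # xs) @ s b))"
      using run_LoopT[OF _ 1 2[unfolded 3 MOVE_def]] Cons.prems x by (simp add: MOVE_def)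
    then show ?case by (rule run_mono) simp
  qed
  then show ?thesis using assms(6,7) run_mono by simp
qed

lemma ptime_MOVE:
  assumes "\<And>Z z. D Z z \<Longrightarrow> f z a = xs z @ ys z \<and> set (xs z) \<subseteq> X \<and> peek (ys z) \<notin> X \<and> length (xs z) \<le> poly q Z"
    and "0 \<notin> X" "a \<noteq> b"
  shows "ptime D (MOVE a X b) f (\<lambda>z. (f z)(a := ys z, b := rev (xs z) @ f z b))"
proof (rule ptime_run[where a = 5 and b = 1 and q = q and l = "\<lambda>z. length (xs z)"])
  fix Z z assume "D Z z"
  from assms(1)[OF this] show "length (xs z) \<le> poly q Z"
    "run (MOVE a X b) (f z) (5 * length (xs z) + 1) ((f z)(a := ys z, b := rev (xs z) @ f z b))"
    using assms(2,3) by (auto intro!: run_MOVE)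
qed

abbreviation nonblank :: "nat set" where "nonblank \<equiv> - {0}"

lemma ptime_MOVE_all:
  assumes "\<And>Z z. D Z z \<Longrightarrow> 0 \<notin> set (f z a) \<and> length (f z a) \<le> poly q Z" "a \<noteq> b"
    and "\<And>Z z. D Z z \<Longrightarrow> g z = (f z)(a := [], b := rev (f z a) @ f z b)"
  shows "ptime D (MOVE a nonblank b) f g"
proof -
  have "ptime D (MOVE a nonblank b) f (\<lambda>z. (f z)(a := [], b := rev (f z a) @ f z b))"
  proof (rule ptime_MOVE[where q = q])
    fix Z z assume "D Z z"
    then show "f z a = f z a @ [] \<and> set (f z a) \<subseteq> nonblank \<and> peek [] \<notin> nonblank \<and> length (f z a) \<le> poly q Z"
      using assms(1)[of Z z] by auto
  qed (use assms in auto)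
  then show ?thesis by (rule ptime_cong) (simp add: assms)
qed

definition CLEAR :: "nat \<Rightarrow> com" where
  "CLEAR a = Loop a nonblank (Pop a)"

lemma run_CLEAR:
  assumes "s a = xs" "0 \<notin> set xs"
  shows "run (CLEAR a) s (2 * length xs + 1) (s(a := []))"
  using assms
proof (induction xs arbitrary: s)
  case Nil
  then show ?case unfolding CLEAR_def by (intro run_LoopF) auto
next
  case (Cons x xs)
  have "run (CLEAR a) (s(a := xs)) (2 * length xs + 1) ((s(a := xs))(a := []))"
    using Cons by (intro Cons.IH) auto
  then have "run (CLEAR a) s (1 + (2 * length xs + 1) + 1) (s(a := []))"
    unfolding CLEAR_def by (intro run_LoopT[OF _ run_Pop]) (use Cons in auto)
  then show ?case by (rule run_mono) simp
qed

lemma ptime_CLEAR: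
  assumes "\<And>Z z. D Z z \<Longrightarrow> 0 \<notin> set (f z a) \<and> length (f z a) \<le> poly q Z"
    and "\<And>Z z. D Z z \<Longrightarrow> g z = (f z)(a := [])"
  shows "ptime D (CLEAR a) f g"
proof (rule ptime_run[where a = 2 and b = 1 and q = q and l = "\<lambda>z. length (f z a)"])
  fix Z z assume D: "D Z z"
  show "length (f z a) \<le> poly q Z" "run (CLEAR a) (f z) (2 * length (f z a) + 1) (g z)"
    using assms(1)[OF D] run_CLEAR[of "f z" a] assms(2)[OF D] by simp_all
qed

text \<open>Stack 6 is the scratch stack of all basic operations.\<close>

definition XFER :: "nat \<Rightarrow> nat \<Rightarrow> com" where
  "XFER a b = MOVE a nonblank 6 ;; MOVE 6 nonblank b"

lemma ptime_XFER:
  assumes D: "\<And>Z z. D Z z \<Longrightarrow> 0 \<notin> set (f z a) \<and> length (f z a) \<le> poly q Z \<and> f z 6 = []"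
    and ab: "a \<noteq> b" "a \<noteq> 6" "b \<noteq> 6"
    and g: "\<And>Z z. D Z z \<Longrightarrow> g z = (f z)(a := [], b := f z a @ f z b)"
  shows "ptime D (XFER a b) f g"
  unfolding XFER_def
proof (rule ptime_Seq)
  show "ptime D (MOVE a nonblank 6) f (\<lambda>z. (f z)(a := [], 6 := rev (f z a)))"
    by (rule ptime_MOVE_all[where q = q]) ((frule D)?, use ab in auto)+
  show "ptime D (MOVE 6 nonblank b) (\<lambda>z. (f z)(a := [], 6 := rev (f z a))) g"
    by (rule ptime_MOVE_all[where q = q]) ((frule D, frule g)?, use ab in \<open>auto simp: fun_eq_iff\<close>)+
qed

definition COPY :: "nat \<Rightarrow> nat \<Rightarrow> com" where
  "COPY a b = MOVE a nonblank 6 ;; Loop 6 nonblank (Psh a 6 id ;; Psh b 6 id ;; Pop 6)"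

lemma run_COPY_loop:
  assumes "s 6 = xs" "0 \<notin> set xs" "a \<noteq> b" "a \<noteq> 6" "b \<noteq> 6"
  shows "run (Loop 6 nonblank (Psh a 6 id ;; Psh b 6 id ;; Pop 6)) s (8 * length xs + 1)
    (s(6 := [], a := rev xs @ s a, b := rev xs @ s b))"
  using assms
proof (induction xs arbitrary: s)
  case Nil
  then show ?case by (intro run_LoopF) auto
next
  case (Cons x xs)
  let ?s = "s(a := x # s a, b := x # s b, 6 := xs)"
  have 1: "run (Psh a 6 id ;; Psh b 6 id ;; Pop 6) s (2 + (2 + 1 + 1) + 1) ?s"
    by (rule run_Seq[OF run_Psh[OF _ refl] run_Seq[OF run_Psh[OF _ refl] run_Pop]])
      (use Cons(2-) in auto)
  have 2: "run (Loop 6 nonblank (Psh a 6 id ;; Psh b 6 id ;; Pop 6)) ?s (8 * length xs + 1)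
      (?s(6 := [], a := rev xs @ ?s a, b := rev xs @ ?s b))"
    using Cons(2-) by (intro Cons(1)) auto
  have 3: "?s(6 := [], a := rev xs @ ?s a, b := rev xs @ ?s b) =
      s(6 := [], a := rev (x # xs) @ s a, b := rev (x # xs) @ s b)"
    using Cons(4-6) by (auto simp: fun_eq_iff)
  have "run (Loop 6 nonblank (Psh a 6 id ;; Psh b 6 id ;; Pop 6)) s
      (2 + (2 + 1 + 1) + 1 + (8 * length xs + 1) + 1)
      (s(6 := [], a := rev (x # xs) @ s a, b := rev (x # xs) @ s b))"
    by (rule run_LoopT[OF _ 1 2[unfolded 3]]) (use Cons(2-) in auto)
  then show ?case by (rule run_mono) simp
qed

lemma ptime_COPY:
  assumes D: "\<And>Z z. D Z z \<Longrightarrow> 0 \<notin> set (f z a) \<and> length (f z a) \<le> poly q Z \<and> f z 6 = []"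
    and ab: "a \<noteq> b" "a \<noteq> 6" "b \<noteq> 6"
    and g: "\<And>Z z. D Z z \<Longrightarrow> g z = (f z)(b := f z a @ f z b)"
  shows "ptime D (COPY a b) f g"
  unfolding COPY_def
proof (rule ptime_Seq)
  show "ptime D (MOVE a nonblank 6) f (\<lambda>z. (f z)(a := [], 6 := rev (f z a)))"
    by (rule ptime_MOVE_all[where q = q]) ((frule D)?, use ab in auto)+
  show "ptime D (Loop 6 nonblank (Psh a 6 id ;; Psh b 6 id ;; Pop 6))
      (\<lambda>z. (f z)(a := [], 6 := rev (f z a))) g"
  proof (rule ptime_run[where a = 8 and b = 1 and q = q and l = "\<lambda>z. length (f z a)"])
    fix Z z assume z: "D Z z"
    then show "length (f z a) \<le> poly q Z" using D by blast
    have "((f z)(a := [], 6 := rev (f z a)))(6 := [], a := rev (rev (f z a)) @ ((f z)(a := [], 6 := rev (f z a))) a,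
        b := rev (rev (f z a)) @ ((f z)(a := [], 6 := rev (f z a))) b) = g z"
      using D[OF z] ab g[OF z] by (auto simp: fun_eq_iff)
    then show "run (Loop 6 nonblank (Psh a 6 id ;; Psh b 6 id ;; Pop 6)) ((f z)(a := [], 6 := rev (f z a)))
        (8 * length (f z a) + 1) (g z)"
      using run_COPY_loop[of "(f z)(a := [], 6 := rev (f z a))" "rev (f z a)" a b] D[OF z] ab by simp
  qed
qed

subsection \<open>Signed binary numbers\<close>

text \<open>Least significant digit first; the digits of positive and of negative numbers are kept apart,
  so that the sign can be read off any digit.\<close>

fun bin :: "nat \<Rightarrow> nat \<Rightarrow> nat \<Rightarrow> nat list" where
  "bin p q n = (if n = 0 then [] else (if even n then p else q) # bin p q (n div 2))"

declare bin.simps [simp del]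

lemma bin_0 [simp]: "bin p q 0 = []"
  by (simp add: bin.simps)

lemma bin_even: "0 < n \<Longrightarrow> bin p q (2 * n) = p # bin p q n"
  by (subst bin.simps) simp

lemma bin_odd: "bin p q (Suc (2 * n)) = q # bin p q n"
  by (subst bin.simps) simp

lemma bin_eq_Nil [simp]: "bin p q n = [] \<longleftrightarrow> n = 0"
  by (subst bin.simps) simp

lemma peek_bin: "peek (bin p q n) = (if n = 0 then 0 else if even n then p else q)"
  by (subst bin.simps) simp

lemma set_bin: "set (bin p q n) \<subseteq> {p, q}"
  by (induction p q n rule: bin.induct) (subst bin.simps, auto)

lemma length_bin: "n < 2 ^ m \<Longrightarrow> length (bin p q n) \<le> m"
proof (induction m arbitrary: n)
  case (Suc m)
  then show ?case using Suc.IH[of "n div 2"] by (subst bin.simps) auto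
qed simp

text \<open>Converse of \<open>length_bin\<close>; together they make the number of digits monotone
  in the absolute value, see \<open>length_enc_mono\<close>.\<close>

lemma bin_length: "n < 2 ^ length (bin p q n)"
proof (induction p q n rule: bin.induct)
  case (1 p q n)
  show ?case
  proof (cases "n = 0")
    case False
    then have "n div 2 < 2 ^ length (bin p q (n div 2))" by (rule 1)
    moreover have "length (bin p q n) = Suc (length (bin p q (n div 2)))"
      using False by (subst bin.simps) simp
    ultimately show ?thesis by simp
  qed simp
qed

definition enc :: "int \<Rightarrow> nat list" where
  "enc z = (if 0 \<le> z then bin 1 2 (nat z) else bin 3 4 (nat (- z)))"

lemma enc_0 [simp]: "enc 0 = []" and enc_1: "enc 1 = [2]"
  by (simp_all add: enc_def bin_odd[of _ _ 0, simplified])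

lemma enc_eq_Nil [simp]: "enc z = [] \<longleftrightarrow> z = 0"
  by (auto simp: enc_def)

lemma even_nat_minus: "z \<le> 0 \<Longrightarrow> even (nat (- z)) = even z"
  by (metis even_minus even_nat_iff neg_0_le_iff_le)

lemma peek_enc: "peek (enc z) =
    (if z = 0 then 0 else if 0 < z then (if even z then 1 else 2) else (if even z then 3 else 4))"
  by (auto simp: enc_def peek_bin even_nat_iff even_nat_minus)

lemma set_enc: "set (enc z) \<subseteq> {1, 2, 3, 4}"
  unfolding enc_def using set_bin[of 1 2 "nat z"] set_bin[of 3 4 "nat (- z)"] by auto

lemma zero_enc [simp]: "0 \<notin> set (enc z)"
  using set_enc[of z] by auto

lemma length_enc: "\<bar>z\<bar> < 2 ^ m \<Longrightarrow> length (enc z) \<le> m"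
  by (auto simp: enc_def nat_less_iff intro!: length_bin)

lemma enc_length: "\<bar>z\<bar> < 2 ^ length (enc z)"
proof (cases "0 \<le> z")
  case True
  then have "nat z < 2 ^ length (enc z)" using bin_length[of "nat z" 1 2] by (simp add: enc_def)
  then show ?thesis using True by (simp add: nat_less_iff)
next
  case False
  then have "nat (- z) < 2 ^ length (enc z)" using bin_length[of "nat (- z)" 3 4] by (simp add: enc_def)
  then show ?thesis using False by (simp add: nat_less_iff)
qed

lemma enc_double: "z \<noteq> 0 \<Longrightarrow> enc (2 * z) = (if 0 < z then 1 else 3) # enc z"
proof -
  assume z: "z \<noteq> 0"
  have "nat (2 * z) = 2 * nat z" "nat (- (2 * z)) = 2 * nat (- z)" by linarith+
  then show ?thesis using z bin_even[of "nat z" 1 2] bin_even[of "nat (- z)" 3 4]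
    by (auto simp: enc_def)
qed

lemma tl_enc_even: "even z \<Longrightarrow> tl (enc z) = enc (z div 2)"
  using enc_double[of "z div 2"] by (cases "z = 0") auto

lemma tl_enc_odd: "odd z \<Longrightarrow> 0 < z \<Longrightarrow> enc z = 2 # enc (z div 2)"
proof -
  assume "odd z" "0 < z"
  then have "nat z = Suc (2 * nat (z div 2))" by (auto elim!: oddE)
  then show ?thesis using bin_odd[of 1 2 "nat (z div 2)"] \<open>0 < z\<close> by (simp add: enc_def)
qed

text \<open>Here \<open>p\<close> is the digit zero and \<open>q\<close> the digit one of either
  sign. Trailing ones turn into zeros on the scratch stack and the next zero becomes a one; if only
  ones were present, nothing is popped and the number gains a digit.\<close>

definition GROW :: "nat \<Rightarrow> nat \<Rightarrow> nat \<Rightarrow> com" where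
  "GROW p q r = Loop r {q} (Psh 6 r (\<lambda>_. p) ;; Pop r) ;;
     Cond r {p} (Pop r) Skip ;; Psh r r (\<lambda>_. q) ;; MOVE 6 nonblank r"

text \<open>The borrow mirrors the carry. A leading one that would become zero is dropped, so that
  numbers have no leading zeros and zero remains the empty stack.\<close>

definition SHRINK :: "nat \<Rightarrow> nat \<Rightarrow> nat \<Rightarrow> com" where
  "SHRINK p q r = Loop r {p} (Psh 6 r (\<lambda>_. q) ;; Pop r) ;;
     Pop r ;; Cond r {0} Skip (Psh r r (\<lambda>_. p)) ;; MOVE 6 nonblank r"

text \<open>The scratch stack may be nonempty, since after one carry the rest of the run is the same
  command on \<open>n div 2\<close> with one more digit set aside.\<close>

lemma run_GROW:
  assumes "s r = bin p q n" "0 \<notin> set (s 6)" "r \<noteq> 6" "p \<noteq> 0" "q \<noteq> 0" "p \<noteq> q"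
  shows "run (GROW p q r) s (10 * length (s r) + 5 * length (s 6) + 20)
    (s(r := rev (s 6) @ bin p q (n + 1), 6 := []))"
  using assms
proof (induction n arbitrary: s rule: less_induct)
  case (less n)
  show ?case
  proof (cases "odd n")
    case True
    then obtain k where n: "n = Suc (2 * k)" by (auto elim: oddE)
    let ?s = "s(6 := p # s 6, r := bin p q k)"
    have sr: "s r = q # bin p q k" using less by (simp add: n bin_odd)
    have 1: "run (Psh 6 r (\<lambda>_. p) ;; Pop r) s (2 + 1 + 1) ?s"
      by (rule run_Seq[OF run_Psh[OF _ refl] run_Pop]) (use less.prems(2-) sr in auto)
    have 2: "run (GROW p q r) ?s (10 * length (?s r) + 5 * length (?s 6) + 20)
        (?s(r := rev (?s 6) @ bin p q (k + 1), 6 := []))"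
      by (rule less.IH) (use less.prems n in auto)
    have 3: "?s(r := rev (?s 6) @ bin p q (k + 1), 6 := []) = s(r := rev (s 6) @ bin p q (n + 1), 6 := [])"
      using bin_even[of "Suc k" p q] less.prems(3) by (auto simp: n fun_eq_iff)
    have "run (GROW p q r) s (2 + 1 + 1 + (10 * length (?s r) + 5 * length (?s 6) + 20) + 1)
        (s(r := rev (s 6) @ bin p q (n + 1), 6 := []))"
      unfolding GROW_def by (rule run_LoopT_Seq[OF _ 1 2[unfolded 3 GROW_def]]) (simp add: sr)
    then show ?thesis by (rule run_mono) (use less.prems(3) sr in simp)
  next
    case False
    then obtain k where n: "n = 2 * k" by (auto elim: evenE)
    let ?s = "s(r := bin p q k)"
    have 1: "run (Loop r {q} (Psh 6 r (\<lambda>_. p) ;; Pop r)) s 1 s"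
      by (rule run_LoopF) (use less.prems False in \<open>simp_all add: peek_bin\<close>)
    have 2: "run (Cond r {p} (Pop r) Skip) s (1 + 1) ?s"
    proof (cases "n = 0")
      case True
      then have "?s = s" using less.prems n by auto
      then show ?thesis using run_CondF[of s r "{p}", OF _ run_Skip[of 1]] True less.prems by simp
    next
      case False
      then show ?thesis using less.prems n by (intro run_CondT run_Pop) (auto simp: bin_even)
    qed
    have 3: "run (Psh r r (\<lambda>_. q)) ?s 2 (?s(r := q # bin p q k))"
      using less.prems by (intro run_Psh) auto
    have 4: "run (MOVE 6 nonblank r) (?s(r := q # bin p q k)) (5 * length (s 6) + 1)
        (s(r := rev (s 6) @ bin p q (n + 1), 6 := []))"
      by (rule run_MOVE[where xs = "s 6" and ys = "[]"])
        (use less.prems in \<open>auto simp: n bin_odd fun_eq_iff\<close>)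
    show ?thesis unfolding GROW_def
      by (rule run_mono[OF run_Seq[OF 1 run_Seq[OF 2 run_Seq[OF 3 4]]]]) simp
  qed
qed

lemma run_SHRINK:
  assumes "s r = bin p q n" "0 < n" "0 \<notin> set (s 6)" "r \<noteq> 6" "p \<noteq> 0" "q \<noteq> 0" "p \<noteq> q"
  shows "run (SHRINK p q r) s (10 * length (s r) + 5 * length (s 6) + 20)
    (s(r := rev (s 6) @ bin p q (n - 1), 6 := []))"
  using assms
proof (induction n arbitrary: s rule: less_induct)
  case (less n)
  show ?case
  proof (cases "even n")
    case True
    then obtain k where n: "n = 2 * k" by (auto elim: evenE)
    then have k: "0 < k" "k < n" using less.prems by auto
    let ?s = "s(6 := q # s 6, r := bin p q k)"
    have sr: "s r = p # bin p q k" using less k by (simp add: n bin_even)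
    have 1: "run (Psh 6 r (\<lambda>_. q) ;; Pop r) s (2 + 1 + 1) ?s"
      by (rule run_Seq[OF run_Psh[OF _ refl] run_Pop]) (use less.prems(2-) sr in auto)
    have 2: "run (SHRINK p q r) ?s (10 * length (?s r) + 5 * length (?s 6) + 20)
        (?s(r := rev (?s 6) @ bin p q (k - 1), 6 := []))"
      by (rule less.IH) (use less.prems k in auto)
    have "n - 1 = Suc (2 * (k - 1))" using n k by simp
    then have 3: "?s(r := rev (?s 6) @ bin p q (k - 1), 6 := []) = s(r := rev (s 6) @ bin p q (n - 1), 6 := [])"
      using bin_odd[of p q "k - 1"] less.prems(4) by (auto simp: fun_eq_iff)
    have "run (SHRINK p q r) s (2 + 1 + 1 + (10 * length (?s r) + 5 * length (?s 6) + 20) + 1)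
        (s(r := rev (s 6) @ bin p q (n - 1), 6 := []))"
      unfolding SHRINK_def by (rule run_LoopT_Seq[OF _ 1 2[unfolded 3 SHRINK_def]]) (simp add: sr)
    then show ?thesis by (rule run_mono) (use less.prems(4) sr in simp)
  next
    case False
    then obtain k where n: "n = Suc (2 * k)" by (auto elim: oddE)
    let ?s = "s(r := bin p q k)" and ?s' = "s(r := bin p q (n - 1))"
    have 1: "run (Loop r {p} (Psh 6 r (\<lambda>_. q) ;; Pop r)) s 1 s"
      by (rule run_LoopF) (use less.prems False in \<open>simp_all add: peek_bin\<close>)
    have 2: "run (Pop r) s 1 ?s"
      by (rule run_Pop) (use less.prems in \<open>auto simp: n bin_odd\<close>)
    have 3: "run (Cond r {0} Skip (Psh r r (\<lambda>_. p))) ?s (2 + 1) ?s'"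
    proof (cases "k = 0")
      case True
      then show ?thesis using run_CondT[of ?s r "{0}", OF _ run_Skip[of 2]] n by simp
    next
      case False
      then show ?thesis using less.prems n
        by (intro run_CondF run_Psh) (auto simp: bin_even peek_bin)
    qed
    have 4: "run (MOVE 6 nonblank r) ?s' (5 * length (s 6) + 1)
        (s(r := rev (s 6) @ bin p q (n - 1), 6 := []))"
      by (rule run_MOVE[where xs = "s 6" and ys = "[]"])
        (use less.prems in \<open>auto simp: fun_eq_iff\<close>)
    show ?thesis unfolding SHRINK_def
      by (rule run_mono[OF run_Seq[OF 1 run_Seq[OF 2 run_Seq[OF 3 4]]]]) simp
  qed
qed

section \<open>Signed increment and decrement\<close>

definition INC :: "nat \<Rightarrow> com" where
  "INC r = Cond r {3, 4} (SHRINK 3 4 r) (GROW 1 2 r)"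

definition DEC :: "nat \<Rightarrow> com" where
  "DEC r = Cond r {1, 2} (SHRINK 1 2 r) (GROW 3 4 r)"

lemma run_INC:
  assumes "s r = enc z" "s 6 = []" "r \<noteq> 6"
  shows "run (INC r) s (10 * length (enc z) + 21) (s(r := enc (z + 1)))"
proof (cases "z < 0")
  case True
  then have "run (SHRINK 3 4 r) s (10 * length (s r) + 5 * length (s 6) + 20)
    (s(r := rev (s 6) @ bin 3 4 (nat (- z) - 1), 6 := []))"
    by (intro run_SHRINK) (use assms in \<open>auto simp: enc_def\<close>)
  moreover have "s(r := rev (s 6) @ bin 3 4 (nat (- z) - 1), 6 := []) = s(r := enc (z + 1))"
    using assms True by (cases "z = - 1") (auto simp: enc_def fun_eq_iff nat_diff_distrib)
  ultimately have "run (INC r) s (10 * length (s r) + 5 * length (s 6) + 20 + 1) (s(r := enc (z + 1)))"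
    unfolding INC_def using assms True by (intro run_CondT) (auto simp: peek_enc)
  then show ?thesis by (rule run_mono) (use assms in simp)
next
  case False
  then have "run (GROW 1 2 r) s (10 * length (s r) + 5 * length (s 6) + 20)
    (s(r := rev (s 6) @ bin 1 2 (nat z + 1), 6 := []))"
    by (intro run_GROW) (use assms in \<open>auto simp: enc_def\<close>)
  moreover have "s(r := rev (s 6) @ bin 1 2 (nat z + 1), 6 := []) = s(r := enc (z + 1))"
    using assms False by (auto simp: enc_def fun_eq_iff nat_add_distrib)
  ultimately have "run (INC r) s (10 * length (s r) + 5 * length (s 6) + 20 + 1) (s(r := enc (z + 1)))"
    unfolding INC_def using assms False by (intro run_CondF) (auto simp: peek_enc)
  then show ?thesis by (rule run_mono) (use assms in simp)
qed

lemma run_DEC: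
  assumes "s r = enc z" "s 6 = []" "r \<noteq> 6"
  shows "run (DEC r) s (10 * length (enc z) + 21) (s(r := enc (z - 1)))"
proof (cases "0 < z")
  case True
  then have "run (SHRINK 1 2 r) s (10 * length (s r) + 5 * length (s 6) + 20)
    (s(r := rev (s 6) @ bin 1 2 (nat z - 1), 6 := []))"
    by (intro run_SHRINK) (use assms in \<open>auto simp: enc_def\<close>)
  moreover have "s(r := rev (s 6) @ bin 1 2 (nat z - 1), 6 := []) = s(r := enc (z - 1))"
    using assms True by (auto simp: enc_def fun_eq_iff nat_diff_distrib)
  ultimately have "run (DEC r) s (10 * length (s r) + 5 * length (s 6) + 20 + 1) (s(r := enc (z - 1)))"
    unfolding DEC_def using assms True by (intro run_CondT) (auto simp: peek_enc)
  then show ?thesis by (rule run_mono) (use assms in simp)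
next
  case False
  then have "run (GROW 3 4 r) s (10 * length (s r) + 5 * length (s 6) + 20)
    (s(r := rev (s 6) @ bin 3 4 (nat (- z) + 1), 6 := []))"
    by (intro run_GROW) (use assms in \<open>auto simp: enc_def\<close>)
  moreover have "nat (1 - z) = nat (- z) + 1" using False by simp
  then have "s(r := rev (s 6) @ bin 3 4 (nat (- z) + 1), 6 := []) = s(r := enc (z - 1))"
    using assms False by (auto simp: enc_def fun_eq_iff)
  ultimately have "run (DEC r) s (10 * length (s r) + 5 * length (s 6) + 20 + 1) (s(r := enc (z - 1)))"
    unfolding DEC_def using assms False by (intro run_CondF) (auto simp: peek_enc)
  then show ?thesis by (rule run_mono) (use assms in simp)
qed

lemma ptime_INC:
  assumes "\<And>Z z. D Z z \<Longrightarrow> f z r = enc (x z) \<and> length (enc (x z)) \<le> poly q Z \<and> f z 6 = []" "r \<noteq> 6"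
    and "\<And>Z z. D Z z \<Longrightarrow> g z = (f z)(r := enc (x z + 1))"
  shows "ptime D (INC r) f g"
proof (rule ptime_run[where a = 10 and b = 21 and q = q and l = "\<lambda>z. length (enc (x z))"])
  fix Z z assume D: "D Z z"
  show "length (enc (x z)) \<le> poly q Z" "run (INC r) (f z) (10 * length (enc (x z)) + 21) (g z)"
    using assms(1)[OF D] assms(2) run_INC[of "f z" r] assms(3)[OF D] by simp_all
qed

lemma ptime_DEC:
  assumes "\<And>Z z. D Z z \<Longrightarrow> f z r = enc (x z) \<and> length (enc (x z)) \<le> poly q Z \<and> f z 6 = []" "r \<noteq> 6"
    and "\<And>Z z. D Z z \<Longrightarrow> g z = (f z)(r := enc (x z - 1))"
  shows "ptime D (DEC r) f g"
proof (rule ptime_run[where a = 10 and b = 21 and q = q and l = "\<lambda>z. length (enc (x z))"])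
  fix Z z assume D: "D Z z"
  show "length (enc (x z)) \<le> poly q Z" "run (DEC r) (f z) (10 * length (enc (x z)) + 21) (g z)"
    using assms(1)[OF D] assms(2) run_DEC[of "f z" r] assms(3)[OF D] by simp_all
qed

subsection \<open>Explicit evaluation\<close>

lemma length_enc_mono: "\<bar>a\<bar> \<le> \<bar>b\<bar> \<Longrightarrow> length (enc a) \<le> length (enc b)"
  using length_enc enc_length le_less_trans by blast

lemma length_enc_diff: "0 \<le> a \<Longrightarrow> a \<le> b \<Longrightarrow> length (enc b) \<le> n \<Longrightarrow> length (enc (b - a)) \<le> n"
  using length_enc_mono[of "b - a" b] by simp

lemma length_enc_le_pow2: "0 \<le> a \<Longrightarrow> a \<le> 2 ^ i \<Longrightarrow> Suc i \<le> n \<Longrightarrow> length (enc a) \<le> n"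
proof -
  assume "0 \<le> a" "a \<le> 2 ^ i" "Suc i \<le> n"
  moreover have "(2::int) ^ i < 2 ^ Suc i" by simp
  ultimately show ?thesis using length_enc[of a "Suc i"] by linarith
qed

lemma peek_replicate [simp]: "peek (replicate n x) = (if n = 0 then 0 else x)"
  by (cases n) simp_all

text \<open>The unary bound on stack 2 serves as fuel: each doubling, a pushed zero digit, moves one
  unit to stack 3. Fuel running out before the exponent does means \<open>2 ^ N > 2 ^ B\<close>,
  reported as 0.\<close>

definition EVAL0 :: com where
  "EVAL0 = XFER 4 10 ;; Psh 4 4 (\<lambda>_. 2) ;;
     Loop 10 nonblank (Cond 2 {0} (CLEAR 10 ;; CLEAR 4)
       (Psh 3 2 id ;; Pop 2 ;; DEC 10 ;; Psh 4 4 (\<lambda>_. 1))) ;; MOVE 3 nonblank 2"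

text \<open>\<open>EVAL j\<close> treats index \<open>j + 2\<close>; a higher index iterates the one
  below it on 1. The argument \<open>N\<close> is exponential in its number of digits, so counting
  it down is affordable only because the loop is cut off at the first overflow, after at most
  \<open>B + 1\<close> rounds.\<close>

primrec EVAL :: "nat \<Rightarrow> com" where
  "EVAL 0 = EVAL0"
| "EVAL (Suc j) = XFER 4 (11 + j) ;; Psh 4 4 (\<lambda>_. 2) ;;
     Loop (11 + j) nonblank (DEC (11 + j) ;; EVAL j ;; Cond 4 {0} (CLEAR (11 + j)) Skip)"

text \<open>The code 0 for overflow is unambiguous, since no \<open>A i\<close> with
  \<open>i \<ge> 2\<close> takes the value 0 on natural numbers.\<close>

definition eval0 :: "nat \<Rightarrow> nat \<Rightarrow> int \<Rightarrow> int" where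
  "eval0 B j N = (if A (j + 2) N \<le> 2 ^ B then A (j + 2) N else 0)"

definition idle :: "nat \<Rightarrow> nat \<Rightarrow> stacks \<Rightarrow> bool" where
  "idle j B s \<longleftrightarrow> s 2 = replicate B 1 \<and> s 3 = [] \<and> s 6 = [] \<and> (\<forall>i\<le>j. s (10 + i) = [])"

definition eval_dom :: "nat \<Rightarrow> nat \<Rightarrow> stacks \<times> nat \<times> int \<Rightarrow> bool" where
  "eval_dom j Z = (\<lambda>(s, B, N). idle j B s \<and> s 4 = enc N \<and> 0 \<le> N \<and> length (enc N) \<le> Z \<and> B \<le> Z)"

lemma peek_enc_0: "peek (enc z) = 0 \<longleftrightarrow> z = 0"
  by (auto simp: peek_enc)

lemma eval0_0: "0 \<le> N \<Longrightarrow> eval0 B 0 N = (if N \<le> int B then 2 ^ nat N else 0)"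
  using A_two[of N] by (auto simp: eval0_def numeral_2_eq_2 power_increasing_iff[of "2::int"])

lemma ptime_EVAL0: "ptime (eval_dom 0) EVAL0 fst (\<lambda>(s, B, N). s(4 := enc (eval0 B 0 N)))"
proof -
  \<comment> \<open>\<open>F z (Suc B)\<close> describes the state after the cut-off, which clears
    the exponent and the result in place of one more doubling.\<close>
  define F where "F = (\<lambda>(s, B, N) i. if i \<le> B
      then s(10 := enc (N - int i), 4 := enc (2 ^ i), 2 := replicate (B - i) 1, 3 := replicate i (1::nat))
      else s(10 := [], 4 := [], 2 := [], 3 := replicate B 1) :: stacks)"
  define m where "m = (\<lambda>(s :: stacks, B, N). if N \<le> int B then nat N else Suc B)"
  have dom: "eval_dom 0 Z (s, B, N) \<longleftrightarrow> s 2 = replicate B 1 \<and> s 3 = [] \<and> s 6 = [] \<and> s 10 = [] \<and>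
      s 4 = enc N \<and> 0 \<le> N \<and> length (enc N) \<le> Z \<and> B \<le> Z" for Z s B N
    by (auto simp: eval_dom_def idle_def)
  have 1: "ptime (eval_dom 0) (XFER 4 10) fst (\<lambda>(s, B, N). s(4 := [], 10 := enc N))"
    by (rule ptime_XFER[where q = "[:0, 1:]"]) (auto simp: dom)
  have 2: "ptime (eval_dom 0) (Psh 4 4 (\<lambda>_. 2)) (\<lambda>(s, B, N). s(4 := [], 10 := enc N)) (\<lambda>z. F z 0)"
    by (rule ptime_Psh_const) (auto simp: dom F_def enc_1 fun_eq_iff)
  define D where "D = (\<lambda>Z ((s, B, N), i). eval_dom 0 Z (s, B, N) \<and> int i < N \<and> i \<le> B)"
  note defs = D_def dom F_def
  have body: "ptime D (Cond 2 {0} (CLEAR 10 ;; CLEAR 4)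
       (Psh 3 2 id ;; Pop 2 ;; DEC 10 ;; Psh 4 4 (\<lambda>_. 1))) (\<lambda>(z, i). F z i) (\<lambda>(z, i). F z (Suc i))"
  proof (rule ptime_cases[where Q = "\<lambda>((s, B, N), i). i = B", OF ptime_CondT ptime_CondF])
    let ?D = "\<lambda>Z x. D Z x \<and> (\<lambda>((s, B, N), i). i = B) x"
    show "ptime ?D (CLEAR 10 ;; CLEAR 4) (\<lambda>(z, i). F z i) (\<lambda>(z, i). F z (Suc i))"
    proof (rule ptime_Seq)
      show "ptime ?D (CLEAR 10) (\<lambda>(z, i). F z i) (\<lambda>(z, i). (F z i)(10 := []))"
        by (rule ptime_CLEAR[where q = "[:0, 1:]"])
          (auto simp: defs split: if_splits intro!: length_enc_diff)
      show "ptime ?D (CLEAR 4) (\<lambda>(z, i). (F z i)(10 := [])) (\<lambda>(z, i). F z (Suc i))"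
        by (rule ptime_CLEAR[where q = "[:1, 1:]"])
          (auto simp: defs split: if_splits intro!: length_enc_le_pow2)
    qed
    show "\<And>Z z. ?D Z z \<Longrightarrow> peek ((\<lambda>(z, i). F z i) z 2) \<in> {0}"
      by (auto simp: defs)
    let ?E = "\<lambda>Z x. D Z x \<and> \<not> (\<lambda>((s, B, N), i). i = B) x"
    have less: "i < B \<and> 0 < N - int i" if "?E Z ((s, B, N), i)" for Z s B N i
      using that by (auto simp: D_def)
    have rep: "replicate (B - i) 1 = 1 # replicate (B - Suc i) 1" if "i < B" for B i
      using that by (metis Suc_diff_Suc replicate_Suc)
    show peek: "\<And>Z z. ?E Z z \<Longrightarrow> peek ((\<lambda>(z, i). F z i) z 2) \<notin> {0}"
      by (auto simp: defs rep split: if_splits)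
    show "ptime ?E (Psh 3 2 id ;; Pop 2 ;; DEC 10 ;; Psh 4 4 (\<lambda>_. 1)) (\<lambda>(z, i). F z i) (\<lambda>(z, i). F z (Suc i))"
    proof (intro ptime_Seq)
      show "ptime ?E (Psh 3 2 id) (\<lambda>(z, i). F z i) (\<lambda>(z, i). (F z i)(3 := 1 # F z i 3))"
        by (rule ptime_Psh) (auto simp: defs rep split: if_splits)
      show "ptime ?E (Pop 2) (\<lambda>(z, i). (F z i)(3 := 1 # F z i 3)) (\<lambda>(z, i). (F z i)(2 := tl (F z i 2), 3 := 1 # F z i 3))"
        by (rule ptime_Pop) auto
      show "ptime ?E (DEC 10) (\<lambda>(z, i). (F z i)(2 := tl (F z i 2), 3 := 1 # F z i 3))
          (\<lambda>((s, B, N), i). (F (s, B, N) i)(2 := tl (F (s, B, N) i 2), 3 := 1 # F (s, B, N) i 3, 10 := enc (N - int i - 1)))"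
        by (rule ptime_DEC[where q = "[:0, 1:]" and x = "\<lambda>((s, B, N), i). N - int i"])
          (auto simp: defs split: if_splits intro!: length_enc_diff)
      show "ptime ?E (Psh 4 4 (\<lambda>_. 1))
          (\<lambda>((s, B, N), i). (F (s, B, N) i)(2 := tl (F (s, B, N) i 2), 3 := 1 # F (s, B, N) i 3, 10 := enc (N - int i - 1)))
          (\<lambda>(z, i). F z (Suc i))"
      proof (rule ptime_Psh_const, goal_cases)
        case (1 Z z)
        obtain s B N i where z: "z = ((s, B, N), i)" by (metis prod.collapse)
        have "i < B" using less 1 z by blast
        then show ?case using 1 by (auto simp: z F_def enc_double fun_eq_iff rep algebra_simps)
      qed simp
    qed
  qed
  have 3: "ptime (eval_dom 0) (Loop 10 nonblank (Cond 2 {0} (CLEAR 10 ;; CLEAR 4)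
       (Psh 3 2 id ;; Pop 2 ;; DEC 10 ;; Psh 4 4 (\<lambda>_. 1)))) (\<lambda>z. F z 0) (\<lambda>z. F z (m z))"
  proof (rule ptime_Loop[where q = "[:1, 1:]"])
    show "ptime (\<lambda>Z (z, i). eval_dom 0 Z z \<and> i < m z) (Cond 2 {0} (CLEAR 10 ;; CLEAR 4)
       (Psh 3 2 id ;; Pop 2 ;; DEC 10 ;; Psh 4 4 (\<lambda>_. 1))) (\<lambda>(z, i). F z i) (\<lambda>(z, i). F z (Suc i))"
      by (rule ptime_cong[OF body]) (auto simp: D_def m_def split: if_splits)
  qed (auto simp: F_def m_def dom peek_enc split: if_splits)
  have m_end: "F (s, B, N) (m (s, B, N)) = s(10 := [], 4 := enc (eval0 B 0 N),
      2 := replicate (B - min (nat N) B) 1, 3 := replicate (min (nat N) B) 1)" if "0 \<le> N" for s B N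
    using that by (auto simp: F_def m_def eval0_0 fun_eq_iff)
  have 4: "ptime (eval_dom 0) (MOVE 3 nonblank 2) (\<lambda>z. F z (m z)) (\<lambda>(s, B, N). s(4 := enc (eval0 B 0 N)))"
    by (rule ptime_MOVE_all[where q = "[:0, 1:]"])
      (auto simp: dom m_end fun_eq_iff simp flip: replicate_add)
  show ?thesis unfolding EVAL0_def by (intro ptime_Seq[OF 1] ptime_Seq[OF 2] ptime_Seq[OF 3] 4)
qed

lemma ptime_EVAL: "ptime (eval_dom j) (EVAL j) fst (\<lambda>(s, B, N). s(4 := enc (eval0 B j N)))"
proof (induction j)
  case 0
  show ?case unfolding EVAL.simps by (rule ptime_EVAL0)
next
  case (Suc j)
  define M where "M = (\<lambda>i. A (j + 3) (int i))"
  have M0: "M 0 = 1" by (simp add: M_def A_at_0)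
  have MSuc: "M (Suc i) = A (j + 2) (M i)" for i
    using A_Suc[of "j + 2" "1 + int i"] by (simp add: M_def numeral_eq_Suc)
  have Mpos: "0 < M i" for i unfolding M_def by (intro A_pos) auto
  have Mne: "M i \<noteq> 0" for i using Mpos[of i] by simp
  have Mge: "2 ^ i \<le> M i" for i unfolding M_def using A_ge_pow2[of "j + 3" "int i"] by simp
  have M_le: "i \<le> B" if "M i \<le> 2 ^ B" for i B
    using order_trans[OF Mge that] by (simp add: power_increasing_iff)
  have Mmono: "M i \<le> M i'" if "i \<le> i'" for i i'
    using that A_strict_mono[of "j + 3" "int i" "int i'"] by (cases "i = i'") (auto simp: M_def)
  have eval0: "eval0 B j (M i) = (if M (Suc i) \<le> 2 ^ B then M (Suc i) else 0)" for B i
    by (simp add: eval0_def MSuc)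
  define F where "F = (\<lambda>(s, B, N) i. if M i \<le> 2 ^ B then s(11 + j := enc (N - int i), 4 := enc (M i))
      else s(11 + j := [], 4 := []) :: stacks)"
  \<comment> \<open>The loop ends after \<open>N\<close> rounds or at the first overflow, whichever
    comes first; overflow occurs by round \<open>B + 1\<close> because \<open>M i\<close> is at
    least \<open>2 ^ i\<close>.\<close>
  define m where "m = (\<lambda>(s :: stacks, B, N). if M (nat N) \<le> 2 ^ B then nat N else (LEAST n. 2 ^ B < M n))"
  have m_less: "int i < N \<and> M i \<le> 2 ^ B" if "i < m (s, B, N)" "0 \<le> N" for i s B N
  proof (cases "M (nat N) \<le> 2 ^ B")
    case True
    then show ?thesis using that Mmono[of i "nat N"] by (auto simp: m_def)
  next
    case False
    then have "(LEAST n. 2 ^ B < M n) \<le> nat N" by (intro Least_le) simp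
    then show ?thesis using that False not_less_Least[of i "\<lambda>n. 2 ^ B < M n"]
      by (auto simp: m_def not_less)
  qed
  have m_end: "F (s, B, N) (m (s, B, N)) = s(11 + j := [], 4 := enc (eval0 B (Suc j) N))" if "0 \<le> N" for s B N
  proof -
    have "\<not> M (LEAST n. 2 ^ B < M n) \<le> 2 ^ B" if "\<not> M (nat N) \<le> 2 ^ B"
      using LeastI[of "\<lambda>n. 2 ^ B < M n" "nat N"] that by simp
    moreover have "eval0 B (Suc j) N = (if M (nat N) \<le> 2 ^ B then M (nat N) else 0)"
      using that by (simp add: eval0_def M_def numeral_eq_Suc)
    ultimately show ?thesis using that by (auto simp: F_def m_def)
  qed
  have m_le: "m (s, B, N) \<le> Suc B" if "0 \<le> N" for s B N
  proof (rule ccontr)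
    assume "\<not> ?thesis"
    then show False using m_less[of "Suc B" s B N] M_le[of "Suc B" B] that by simp
  qed
  have dom: "eval_dom (Suc j) Z (s, B, N) \<longleftrightarrow> idle j B s \<and> s (11 + j) = [] \<and>
      s 4 = enc N \<and> 0 \<le> N \<and> length (enc N) \<le> Z \<and> B \<le> Z" for Z s B N
    by (auto simp: eval_dom_def idle_def le_Suc_eq)
  have domj: "eval_dom j Z (s, B, N) \<longleftrightarrow> idle j B s \<and>
      s 4 = enc N \<and> 0 \<le> N \<and> length (enc N) \<le> Z \<and> B \<le> Z" for Z s B N
    by (simp add: eval_dom_def)
  have idle: "idle j B (s(11 + j := x)) = idle j B s" "idle j B (s(4 := x)) = idle j B s" for s x B
    by (auto simp: idle_def)
  have idle6: "idle j B s \<Longrightarrow> s 6 = []" for s B by (simp add: idle_def)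
  have 1: "ptime (eval_dom (Suc j)) (XFER 4 (11 + j)) fst (\<lambda>(s, B, N). s(4 := [], 11 + j := enc N))"
    by (rule ptime_XFER[where q = "[:0, 1:]"]) (auto simp: dom idle6)
  have 2: "ptime (eval_dom (Suc j)) (Psh 4 4 (\<lambda>_. 2)) (\<lambda>(s, B, N). s(4 := [], 11 + j := enc N)) (\<lambda>z. F z 0)"
    by (rule ptime_Psh_const) (auto simp: dom F_def enc_1 fun_eq_iff M0)
  define D where "D = (\<lambda>Z ((s, B, N), i). eval_dom (Suc j) Z (s, B, N) \<and> int i < N \<and> M i \<le> 2 ^ B)"
  define G where "G = (\<lambda>((s, B :: nat, N), i). s(11 + j := enc (N - int i - 1), 4 := enc (M i)) :: stacks)"
  define H where "H = (\<lambda>((s, B, N), i). s(11 + j := enc (N - int i - 1), 4 := enc (eval0 B j (M i))) :: stacks)"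
  have body: "ptime D (DEC (11 + j) ;; EVAL j ;; Cond 4 {0} (CLEAR (11 + j)) Skip)
      (\<lambda>(z, i). F z i) (\<lambda>(z, i). F z (Suc i))"
  proof (rule ptime_Seq[OF _ ptime_Seq])
    show "ptime D (DEC (11 + j)) (\<lambda>(z, i). F z i) G"
      by (rule ptime_DEC[where q = "[:0, 1:]" and x = "\<lambda>((s, B, N), i). N - int i"])
        (auto simp: D_def dom F_def G_def idle6 fun_eq_iff intro!: length_enc_diff)
    show "ptime D (EVAL j) G H"
    proof (rule ptime_use[OF Suc.IH, where h = "\<lambda>((s, B, N), i). (G ((s, B, N), i), B, M i)" and q = "[:1, 1:]"], goal_cases)
      case (1 Z z)
      obtain s B N i where z: "z = ((s, B, N), i)" by (metis prod.collapse)
      have *: "length (enc (M i)) \<le> Suc Z"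
        by (rule length_enc_le_pow2[of _ B]) (use 1 Mpos[of i] in \<open>auto simp: z D_def dom\<close>)
      have "eval_dom j (Suc Z) (G z, B, M i)"
        using 1 Mpos[of i] * by (simp add: domj z D_def dom G_def idle)
      then show ?case by (auto simp: z G_def H_def fun_eq_iff)
    qed
    show "ptime D (Cond 4 {0} (CLEAR (11 + j)) Skip) H (\<lambda>(z, i). F z (Suc i))"
    proof (rule ptime_cases[where Q = "\<lambda>((s, B, N), i). 2 ^ B < M (Suc i)", OF ptime_CondT ptime_CondF])
      let ?D = "\<lambda>Z x. D Z x \<and> (\<lambda>((s, B, N), i). 2 ^ B < M (Suc i)) x"
      show "ptime ?D (CLEAR (11 + j)) H (\<lambda>(z, i). F z (Suc i))"
        by (rule ptime_CLEAR[where q = "[:0, 1:]"])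
          (auto simp: D_def dom H_def F_def eval0 fun_eq_iff algebra_simps
            intro!: length_enc_diff[of "_ + 1" for a, simplified])
      show "peek (H z 4) \<in> {0}" if "?D Z z" for Z z
        using that by (auto simp: H_def eval0)
      let ?E = "\<lambda>Z x. D Z x \<and> \<not> (\<lambda>((s, B, N), i). 2 ^ B < M (Suc i)) x"
      show "ptime ?E Skip H (\<lambda>(z, i). F z (Suc i))"
        by (rule ptime_cong[OF ptime_Skip[where D = ?E and f = H]])
          (auto simp: H_def F_def eval0 algebra_simps)
      show "peek (H z 4) \<notin> {0}" if "?E Z z" for Z z
        using that by (auto simp: H_def eval0 peek_enc_0 not_less Mne split: if_splits)
    qed
  qed
  have 3: "ptime (eval_dom (Suc j)) (Loop (11 + j) nonblank
        (DEC (11 + j) ;; EVAL j ;; Cond 4 {0} (CLEAR (11 + j)) Skip)) (\<lambda>z. F z 0) (\<lambda>z. F z (m z))"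
  proof (rule ptime_Loop[where q = "[:1, 1:]"])
    show "ptime (\<lambda>Z (z, i). eval_dom (Suc j) Z z \<and> i < m z)
       (DEC (11 + j) ;; EVAL j ;; Cond 4 {0} (CLEAR (11 + j)) Skip) (\<lambda>(z, i). F z i) (\<lambda>(z, i). F z (Suc i))"
      by (rule ptime_cong[OF body]) (use m_less in \<open>auto simp: D_def dom\<close>)
    fix Z and z :: "stacks \<times> nat \<times> int"
    assume d: "eval_dom (Suc j) Z z"
    obtain s B N where z: "z = (s, B, N)" by (metis prod.collapse)
    show "m z \<le> poly [:1, 1:] Z" using d m_le[of N s B] by (simp add: z dom)
    show "peek (F z (m z) (11 + j)) \<notin> nonblank" using d m_end[of N s B] by (simp add: z dom)
    show "peek (F z i (11 + j)) \<in> nonblank" if "i < m z" for i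
      using d m_less[of i s B N] that by (auto simp: z dom F_def peek_enc)
  qed
  have 4: "ptime (eval_dom (Suc j)) (EVAL (Suc j)) fst (\<lambda>z. F z (m z))"
    unfolding EVAL.simps by (intro ptime_Seq[OF 1] ptime_Seq[OF 2] 3)
  show ?case
    by (rule ptime_cong[OF 4]) (auto simp: dom m_end fun_eq_iff)
qed

subsection \<open>Explicit partial inverses\<close>

text \<open>\<open>PREIMG j\<close> inverts index \<open>j + 1\<close>. The values of
  \<open>A (i + 1)\<close> arise by iterating \<open>A i\<close> on 1, so the inverse counts how
  often \<open>A i\<close> can be undone until 1 is left. Top digit 1 means even and positive; a
  failure inside yields 0, which also ends the loop and differs from 1.\<close>

primrec PREIMG :: "nat \<Rightarrow> com" where
  "PREIMG 0 = Pop 4"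
| "PREIMG (Suc j) = Loop 4 {1} (PREIMG j ;; INC (10 + j)) ;;
     Cond 4 {2} (Pop 4 ;; Cond 4 {0} (XFER (10 + j) 4) (CLEAR 4 ;; CLEAR (10 + j))) (CLEAR 4 ;; CLEAR (10 + j))"

text \<open>The value 0 signals that there is no preimage; arguments are even and positive where it matters,
  and then a preimage is positive.\<close>

definition preimage0 :: "nat \<Rightarrow> int \<Rightarrow> int" where
  "preimage0 i x = (case A_inv i x of None \<Rightarrow> 0 | Some q \<Rightarrow> q)"

text \<open>For \<open>i \<ge> 2\<close> and positive \<open>n\<close> one has
  \<open>2 * n \<le> 2 ^ n \<le> A i n\<close>, so each round of the iterated inverse at least
  halves the number; hence there are no more rounds than binary digits.\<close>

lemma preimage0_bounds:
  assumes "1 \<le> i" "even x" "0 < x"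
  shows "0 \<le> preimage0 i x \<and> 2 * preimage0 i x \<le> x"
proof (cases "i = 1")
  case True
  then show ?thesis using assms by (simp add: preimage0_def A_inv_one)
next
  case False
  then have i: "2 \<le> i" using assms by simp
  show ?thesis
  proof (cases "A_inv i x")
    case (Some q)
    have q: "0 \<le> q" "A i q = x" using A_inv_ge2[OF i Some] by auto
    have "2 * int n \<le> 2 ^ n" if "0 < n" for n
      using that by (induction n rule: nat_induct_non_zero) auto
    from this[of "nat q"] show ?thesis using A_ge_pow2[OF i q(1)] q assms Some
      by (cases "q = 0") (auto simp: preimage0_def)
  qed (use assms in \<open>simp add: preimage0_def\<close>)
qed

text \<open>A value of \<open>A i\<close> with \<open>i \<ge> 2\<close> is a power of two, and the
  only odd power of two is 1.\<close>

lemma A_inv_no_halving: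
  assumes "\<not> (even N \<and> 0 < N)"
  shows "A_inv (Suc (Suc j)) N = (if N = 1 then Some 0 else None)"
proof (cases "A_inv (Suc (Suc j)) N")
  case None
  then have "N \<noteq> 1" using A_inv_A[of 0 "Suc (Suc j)"] A_at_0[of "Suc (Suc j)"] by (auto simp: A_dom_ge2)
  then show ?thesis using None by simp
next
  case (Some q)
  then obtain p where p: "N = 2 ^ p" using A_inv_ge2(4)[of "Suc (Suc j)"] by auto
  then have "p = 0" using assms by (cases p) auto
  then have "N = 1" by (simp add: p)
  moreover have "A_inv (Suc (Suc j)) 1 = Some 0"
    using A_inv_A[of 0 "Suc (Suc j)"] A_at_0[of "Suc (Suc j)"] by (simp add: A_dom_ge2)
  ultimately show ?thesis by simp
qed

text \<open>Induction on the number of digits: one round at least halves \<open>N\<close>, and by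
  \<open>A_inv_Suc\<close> it accounts for one unit of the preimage. The witness \<open>m\<close> is
  the round at which the loop of \<open>PREIMG\<close> stops.\<close>

lemma preimage0_iterate:
  fixes j defines "x \<equiv> \<lambda>N i. (preimage0 (Suc j) ^^ i) N"
  assumes "0 \<le> N" "N < 2 ^ L"
  shows "\<exists>m\<le>L. (\<forall>i<m. even (x N i) \<and> 0 < x N i) \<and> \<not> (even (x N m) \<and> 0 < x N m) \<and>
    (\<forall>i\<le>m. 0 \<le> x N i \<and> x N i \<le> N) \<and> A_inv (Suc (Suc j)) N = (if x N m = 1 then Some (int m) else None)"
  using assms(2,3)
proof (induction L arbitrary: N)
  case 0
  then have "N = 0" by simp
  moreover have "A_inv (Suc (Suc j)) 0 = None"
    using A_pos[of "Suc (Suc j)"] by (fastforce simp: A_inv_None A_dom_ge2)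
  ultimately show ?case by (intro exI[of _ 0]) (simp add: x_def)
next
  case (Suc L)
  show ?case
  proof (cases "even N \<and> 0 < N")
    case False
    then have "A_inv (Suc (Suc j)) N = (if N = 1 then Some 0 else None)" by (rule A_inv_no_halving)
    then show ?thesis using False Suc.prems by (intro exI[of _ 0]) (simp add: x_def)
  next
    case True
    define y where "y = preimage0 (Suc j) N"
    have y: "0 \<le> y" "2 * y \<le> N" using preimage0_bounds[of "Suc j" N] True by (auto simp: y_def)
    then obtain m where m: "m \<le> L" "\<And>i. i < m \<Longrightarrow> even (x y i) \<and> 0 < x y i" "\<not> (even (x y m) \<and> 0 < x y m)"
      "\<And>i. i \<le> m \<Longrightarrow> 0 \<le> x y i \<and> x y i \<le> y" "A_inv (Suc (Suc j)) y = (if x y m = 1 then Some (int m) else None)"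
      using Suc.IH[of y] Suc.prems(2) by auto
    have xS: "x N (Suc i) = x y i" for i by (simp add: x_def y_def funpow_swap1)
    have x0: "x N 0 = N" by (simp add: x_def)
    have "N \<noteq> 1" using True by auto
    have "A_inv (Suc (Suc j)) N = map_option (\<lambda>z. z + 1) (A_inv (Suc (Suc j)) y)"
    proof (cases "A_inv (Suc j) N")
      case None
      then have "y = 0" by (simp add: y_def preimage0_def)
      then have "A_inv (Suc (Suc j)) y = None"
        using A_pos[of "Suc (Suc j)"] by (fastforce simp: A_inv_None A_dom_ge2)
      then show ?thesis using None A_inv_Suc[of "Suc j" N] \<open>N \<noteq> 1\<close> by simp
    next
      case (Some q)
      then show ?thesis using A_inv_Suc[of "Suc j" N] \<open>N \<noteq> 1\<close> by (simp add: y_def preimage0_def)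
    qed
    then have "A_inv (Suc (Suc j)) N = (if x N (Suc m) = 1 then Some (int (Suc m)) else None)"
      using m(5) by (simp add: xS)
    moreover have "\<forall>i<Suc m. even (x N i) \<and> 0 < x N i"
      using m(2) True by (auto simp: less_Suc_eq_0_disj xS x0)
    moreover have "\<forall>i\<le>Suc m. 0 \<le> x N i \<and> x N i \<le> N"
    proof (intro allI impI)
      fix i assume "i \<le> Suc m"
      then show "0 \<le> x N i \<and> x N i \<le> N" using m(4)[of "i - 1"] y True
        by (cases i) (auto simp: xS x0)
    qed
    ultimately show ?thesis using m(1,3) by (intro exI[of _ "Suc m"]) (auto simp: xS)
  qed
qed

definition preimg_dom :: "nat \<Rightarrow> nat \<Rightarrow> stacks \<times> int \<Rightarrow> bool" where
  "preimg_dom j Z = (\<lambda>(s, N). s 4 = enc N \<and> 0 \<le> N \<and> (j = 0 \<longrightarrow> even N) \<and> length (enc N) \<le> Z \<and>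
     s 6 = [] \<and> (\<forall>i<j. s (10 + i) = []))"

lemma ptime_PREIMG: "ptime (preimg_dom j) (PREIMG j) fst (\<lambda>(s, N). s(4 := enc (preimage0 (Suc j) N)))"
proof (induction j)
  case 0
  show ?case unfolding PREIMG.simps
    by (rule ptime_Pop) (auto simp: preimg_dom_def preimage0_def A_inv_one tl_enc_even)
next
  case (Suc j)
  define x where "x N i = (preimage0 (Suc j) ^^ i) N" for N i
  define P where "P = (\<lambda>N m. m \<le> length (enc N) \<and> (\<forall>i<m. even (x N i) \<and> 0 < x N i) \<and>
    \<not> (even (x N m) \<and> 0 < x N m) \<and> (\<forall>i\<le>m. 0 \<le> x N i \<and> x N i \<le> N) \<and>
    A_inv (Suc (Suc j)) N = (if x N m = 1 then Some (int m) else None))"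
  define m where "m = (\<lambda>(s :: stacks, N). SOME m. P N m)"
  have m: "P N (m (s, N))" if "0 \<le> N" for s N
  proof -
    have "N < 2 ^ length (enc N)" using enc_length[of N] by linarith
    from preimage0_iterate[OF that this, of j] have "\<exists>m. P N m" unfolding P_def x_def by blast
    then show ?thesis unfolding m_def prod.case by (rule someI_ex)
  qed
  define F where "F = (\<lambda>(s, N) i. s(4 := enc (x N i), 10 + j := enc (int i)) :: stacks)"
  have dom: "preimg_dom (Suc j) Z (s, N) \<longleftrightarrow> s 4 = enc N \<and> 0 \<le> N \<and> length (enc N) \<le> Z \<and> s 6 = [] \<and>
      (\<forall>i<j. s (10 + i) = []) \<and> s (10 + j) = []" for Z s N
    by (auto simp: preimg_dom_def less_Suc_eq)
  have len: "length (enc (int i)) \<le> n" if "i \<le> n" for i n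
  proof -
    have "int i < 2 ^ i" by (rule of_nat_less_two_power)
    then have "length (enc (int i)) \<le> i" by (intro length_enc) simp
    then show ?thesis using that by (rule le_trans)
  qed
  define D where "D = (\<lambda>Z ((s, N), i). preimg_dom (Suc j) Z (s, N) \<and> i < m (s, N))"
  define G where "G = (\<lambda>((s, N), i). s(4 := enc (x N (Suc i)), 10 + j := enc (int i)) :: stacks)"
  have body: "ptime D (PREIMG j ;; INC (10 + j)) (\<lambda>(z, i). F z i) (\<lambda>(z, i). F z (Suc i))"
  proof (rule ptime_Seq)
    show "ptime D (PREIMG j) (\<lambda>(z, i). F z i) G"
    proof (rule ptime_use[OF Suc.IH, where h = "\<lambda>((s, N), i). (F (s, N) i, x N i)" and q = "[:0, 1:]"], goal_cases)
      case (1 Z z)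
      obtain s N i where z: "z = ((s, N), i)" by (metis prod.collapse)
      have N: "0 \<le> N" "i < m (s, N)" using 1 by (auto simp: z D_def dom)
      then have "even (x N i)" "0 \<le> x N i" "x N i \<le> N" using m[of N s] by (auto simp: P_def)
      moreover then have "length (enc (x N i)) \<le> length (enc N)" by (intro length_enc_mono) auto
      ultimately show ?case using 1
        by (auto simp: z D_def dom preimg_dom_def F_def G_def x_def fun_eq_iff)
    qed
    show "ptime D (INC (10 + j)) G (\<lambda>(z, i). F z (Suc i))"
    proof (rule ptime_INC[where q = "[:0, 1:]" and x = "\<lambda>(z, i). int i"], goal_cases)
      case (1 Z z)
      obtain s N i where z: "z = ((s, N), i)" by (metis prod.collapse)
      have "i \<le> Z" using 1 m[of N s] by (auto simp: z D_def dom P_def)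
      then show ?case using 1 len by (auto simp: z G_def D_def dom)
    qed (auto simp: F_def G_def fun_eq_iff algebra_simps)
  qed
  have 1: "ptime (preimg_dom (Suc j)) (Loop 4 {1} (PREIMG j ;; INC (10 + j))) (\<lambda>z. F z 0) (\<lambda>z. F z (m z))"
  proof (rule ptime_Loop[where q = "[:0, 1:]"])
    show "ptime (\<lambda>Z (z, i). preimg_dom (Suc j) Z z \<and> i < m z) (PREIMG j ;; INC (10 + j))
        (\<lambda>(z, i). F z i) (\<lambda>(z, i). F z (Suc i))"
      by (rule ptime_cong[OF body]) (auto simp: D_def)
    fix Z and z :: "stacks \<times> int"
    assume d: "preimg_dom (Suc j) Z z"
    obtain s N where z: "z = (s, N)" by (metis prod.collapse)
    have N: "0 \<le> N" "length (enc N) \<le> Z" using d by (auto simp: z dom)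
    show "m z \<le> poly [:0, 1:] Z" "peek (F z (m z) 4) \<notin> {1}"
      using m[OF N(1), of s] N(2) by (auto simp: z P_def F_def peek_enc)
    show "peek (F z i 4) \<in> {1}" if "i < m z" for i
      using m[OF N(1), of s] that by (auto simp: z P_def F_def peek_enc)
  qed
  let ?tail = "Cond 4 {2} (Pop 4 ;; Cond 4 {0} (XFER (10 + j) 4) (CLEAR 4 ;; CLEAR (10 + j))) (CLEAR 4 ;; CLEAR (10 + j))"
  let ?g = "\<lambda>(s, N). s(4 := enc (preimage0 (Suc (Suc j)) N)) :: stacks"
  define v where "v = (\<lambda>(s, N). x N (m (s, N)))"
  have F: "F (s, N) (m (s, N)) = s(4 := enc (v (s, N)), 10 + j := enc (int (m (s, N))))" for s N
    by (simp add: F_def v_def)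
  have v: "0 \<le> v (s, N)" "v (s, N) \<noteq> 0 \<Longrightarrow> odd (v (s, N))" "length (enc (v (s, N))) \<le> Z" "m (s, N) \<le> Z"
    "preimage0 (Suc (Suc j)) N = (if v (s, N) = 1 then int (m (s, N)) else 0)"
    "s 4 = enc N" "s 6 = []" "s (10 + j) = []"
    if "preimg_dom (Suc j) Z (s, N)" for Z s N
  proof -
    have N: "0 \<le> N" "length (enc N) \<le> Z" using that by (auto simp: dom)
    have P: "P N (m (s, N))" using m N by blast
    then show "0 \<le> v (s, N)" "v (s, N) \<noteq> 0 \<Longrightarrow> odd (v (s, N))" "m (s, N) \<le> Z"
      "preimage0 (Suc (Suc j)) N = (if v (s, N) = 1 then int (m (s, N)) else 0)"
      using N by (auto simp: P_def v_def preimage0_def)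
    have "length (enc (v (s, N))) \<le> length (enc N)" using P by (intro length_enc_mono) (auto simp: P_def v_def)
    then show "length (enc (v (s, N))) \<le> Z" using N by simp
  qed (use that in \<open>auto simp: dom\<close>)
  \<comment> \<open>The last value is 1, another odd number, or 0: an even value that stopped the
    loop is 0 because it is nonnegative.\<close>
  define D1 where "D1 = (\<lambda>Z (s, N). preimg_dom (Suc j) Z (s, N) \<and> v (s, N) = 1)"
  define D2 where "D2 = (\<lambda>Z (s, N). preimg_dom (Suc j) Z (s, N) \<and> odd (v (s, N)) \<and> v (s, N) \<noteq> 1)"
  define D3 where "D3 = (\<lambda>Z (s, N). preimg_dom (Suc j) Z (s, N) \<and> even (v (s, N)))"
  define H where "H = (\<lambda>(s, N). s(4 := enc (v (s, N) div 2), 10 + j := enc (int (m (s, N)))) :: stacks)"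
  have tail1: "ptime D1 ?tail (\<lambda>z. F z (m z)) ?g"
  proof (rule ptime_CondT[OF ptime_Seq[OF _ ptime_CondT]])
    show "ptime D1 (Pop 4) (\<lambda>z. F z (m z)) H"
      by (rule ptime_Pop) (auto simp: D1_def F H_def enc_1 fun_eq_iff)
    show "ptime D1 (XFER (10 + j) 4) H ?g"
      by (rule ptime_XFER[where q = "[:0, 1:]"]) (auto simp: D1_def H_def v len fun_eq_iff)
  qed (auto simp: D1_def H_def F peek_enc)
  have tail2: "ptime D2 ?tail (\<lambda>z. F z (m z)) ?g"
  proof (rule ptime_CondT[OF ptime_Seq[OF _ ptime_CondF[OF ptime_Seq]]])
    show "ptime D2 (Pop 4) (\<lambda>z. F z (m z)) H"
    proof (rule ptime_Pop, goal_cases)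
      case (1 Z z)
      obtain s N where z: "z = (s, N)" by (metis prod.collapse)
      have "odd (v (s, N))" "0 \<le> v (s, N)" using 1 v(1)[of Z s N] by (auto simp: z D2_def)
      moreover then have "0 < v (s, N)" by (cases "v (s, N) = 0") auto
      ultimately show ?case by (auto simp: z F H_def fun_eq_iff tl_enc_odd)
    qed
    show "ptime D2 (CLEAR 4) H (\<lambda>(s, N). s(4 := [], 10 + j := enc (int (m (s, N)))))"
    proof (rule ptime_CLEAR[where q = "[:0, 1:]"], goal_cases)
      case (1 Z z)
      obtain s N where z: "z = (s, N)" by (metis prod.collapse)
      have "length (enc (v (s, N) div 2)) \<le> length (enc (v (s, N)))"
        using v(1)[of Z s N] 1 by (intro length_enc_mono) (auto simp: z D2_def)
      then show ?case using 1 v(3)[of Z s N] by (auto simp: z D2_def H_def)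
    qed (auto simp: H_def fun_eq_iff)
    show "ptime D2 (CLEAR (10 + j)) (\<lambda>(s, N). s(4 := [], 10 + j := enc (int (m (s, N))))) ?g"
      by (rule ptime_CLEAR[where q = "[:0, 1:]"]) (auto simp: D2_def v len fun_eq_iff)
    fix Z z assume d: "D2 Z z"
    obtain s N where z: "z = (s, N)" by (metis prod.collapse)
    have "0 \<le> v (s, N)" "odd (v (s, N))" "v (s, N) \<noteq> 1" using d v(1)[of Z s N] by (auto simp: z D2_def)
    moreover then have "0 < v (s, N)" "v (s, N) div 2 \<noteq> 0" by (auto elim!: oddE)
    ultimately show "peek (H z 4) \<notin> {0}" "peek (F z (m z) 4) \<in> {2}" by (auto simp: z F H_def peek_enc)
  qed
  have tail3: "ptime D3 ?tail (\<lambda>z. F z (m z)) ?g"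
  proof (rule ptime_CondF[OF ptime_Seq])
    have z: "v (s, N) = 0" if "D3 Z (s, N)" for Z s N using that v(2) by (auto simp: D3_def)
    show "ptime D3 (CLEAR 4) (\<lambda>z. F z (m z)) (\<lambda>(s, N). s(4 := [], 10 + j := enc (int (m (s, N)))))"
      by (rule ptime_CLEAR[where q = "[:0, 1:]"]) (auto simp: z F fun_eq_iff)
    show "ptime D3 (CLEAR (10 + j)) (\<lambda>(s, N). s(4 := [], 10 + j := enc (int (m (s, N))))) ?g"
      by (rule ptime_CLEAR[where q = "[:0, 1:]"]) (auto simp: D3_def v len fun_eq_iff)
    show "\<And>Z x. D3 Z x \<Longrightarrow> peek (F x (m x) 4) \<notin> {2}" by (auto simp: z F)
  qed
  have 2: "ptime (preimg_dom (Suc j)) ?tail (\<lambda>z. F z (m z)) ?g"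
    by (rule ptime_cases[where Q = "\<lambda>z. v z = 1", OF ptime_cong[OF tail1]
          ptime_cases[where Q = "\<lambda>z. odd (v z)", OF ptime_cong[OF tail2] ptime_cong[OF tail3]]])
      (auto simp: D1_def D2_def D3_def)
  have 3: "ptime (preimg_dom (Suc j)) (PREIMG (Suc j)) (\<lambda>z. F z 0) ?g"
    unfolding PREIMG.simps by (rule ptime_Seq[OF 1 2])
  show ?case by (rule ptime_cong[OF 3]) (auto simp: F_def x_def dom fun_eq_iff)
qed

subsection \<open>Configurations on the stacks\<close>

text \<open>Stack 4 holds the top offset, stack 5 the remaining layers, where a layer \<open>(r, c)\<close> is stored as
  the marker \<open>5 + r\<close> on top of the digits of \<open>c\<close>; stack 2 holds the bound \<open>B\<close> in unary and
  stack 9 signals failure. Stack 0 is the input, stack 1 the part of the word still to be applied,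
  stack 3 the part of the bound used up by an explicit evaluation, stacks 7 and 8 save the top offset,
  and the stacks from 10 on are the loop counters of explicit evaluations and inverses.\<close>

fun encst :: "(nat \<times> int) list \<Rightarrow> nat list" where
  "encst [] = []"
| "encst ((r, c) # st) = (5 + r) # rev (enc c) @ encst st"

lemma encst_eq_Nil [simp]: "encst st = [] \<longleftrightarrow> st = []"
  by (cases st rule: encst.cases) auto

lemma peek_encst_small: "x < 5 \<Longrightarrow> peek (encst st) = x \<longleftrightarrow> st = [] \<and> x = 0"
  by (cases st rule: encst.cases) auto

lemma peek_zero [simp]: "peek (encst st) = 0 \<longleftrightarrow> st = []" "0 < peek (encst st) \<longleftrightarrow> st \<noteq> []"
  "0 < peek (enc z) \<longleftrightarrow> z \<noteq> 0"
  using peek_encst_small[of 0 st] peek_enc_0[of z] by auto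

definition put :: "stacks \<Rightarrow> int \<Rightarrow> (nat \<times> int) list \<Rightarrow> stacks" where
  "put s b st = s(4 := enc b, 5 := encst st)"

definition put_result :: "stacks \<Rightarrow> cfg option \<Rightarrow> stacks" where
  "put_result s r = (case r of None \<Rightarrow> s(9 := [1]) | Some (b, st) \<Rightarrow> put s b st)"

lemma put_result_simps [simp]: "put_result s None = s(9 := [1])" "put_result s (Some (b, st)) = put s b st"
  by (simp_all add: put_result_def)

lemma put_other [simp]: "i \<noteq> 4 \<Longrightarrow> i \<noteq> 5 \<Longrightarrow> put s b st i = s i" "put s b st 4 = enc b" "put s b st 5 = encst st"
  by (simp_all add: put_def)

lemma put_put [simp]: "put (put s b st) b' st' = put s b' st'"
  by (auto simp: put_def)

lemma put_upd4 [simp]: "(put s b st)(4 := enc b') = put s b' st"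
  by (auto simp: put_def)

definition cfg_dom :: "nat \<Rightarrow> stacks \<times> nat \<times> int \<times> (nat \<times> int) list \<Rightarrow> bool" where
  "cfg_dom Z = (\<lambda>(s, B, b, st). s 2 = replicate B 1 \<and> s 3 = [] \<and> s 6 = [] \<and> s 7 = [] \<and> s 9 = [] \<and>
     (\<forall>i\<ge>10. s i = []) \<and> s 4 = enc b \<and> s 5 = encst st \<and> bits_le Z b st \<and> length (enc b) \<le> Z \<and> B < Z)"

lemma length_enc_bits_le: "bits_le m b st \<Longrightarrow> length (enc b) \<le> m"
  by (auto simp: bits_le_def intro: length_enc)

lemma cfg_dom_put: "cfg_dom Z (s, B, b, st) \<Longrightarrow> Z \<le> Z' \<Longrightarrow> bits_le Z' b' st' \<Longrightarrow> cfg_dom Z' (put s b' st', B, b', st')"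
  by (auto simp: cfg_dom_def length_enc_bits_le)

lemma put_id: "cfg_dom Z (s, B, b, st) \<Longrightarrow> put s b st = s"
  by (auto simp: cfg_dom_def put_def)

lemma run_Seq_assoc: "run ((c ;; d) ;; e) s n s' \<Longrightarrow> run (c ;; d ;; e) s n s'"
proof -
  assume "run ((c ;; d) ;; e) s n s'"
  then obtain t where t: "t \<le> n" "exec ((c ;; d) ;; e) s t s'" by (auto simp: run_def)
  from t(2) obtain u v s1 where 1: "exec (c ;; d) s u s1" "exec e s1 v s'" "t = u + v + 1"
    by (auto elim: exec_SeqE)
  from 1(1) obtain u1 u2 s2 where 2: "exec c s u1 s2" "exec d s2 u2 s1" "u = u1 + u2 + 1"
    by (auto elim: exec_SeqE)
  have "exec (c ;; d ;; e) s (u1 + (u2 + v + 1) + 1) s'"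
    using 1 2 by (intro exec_Seq)
  then show ?thesis using t(1) 1(3) 2(3) by (auto simp: run_def add.assoc)
qed

text \<open>\<open>;;\<close> associates to the right, whereas some facts concern the first two
  commands as a block; both groupings take the same time.\<close>

lemma ptime_Seq_assoc: "ptime D (c ;; d) f g \<Longrightarrow> ptime D e g h \<Longrightarrow> ptime D (c ;; d ;; e) f h"
proof -
  assume "ptime D (c ;; d) f g" "ptime D e g h"
  then have "ptime D ((c ;; d) ;; e) f h" by (rule ptime_Seq)
  then obtain p where p: "\<And>Z z. D Z z \<Longrightarrow> run ((c ;; d) ;; e) (f z) (poly p Z) (h z)"
    unfolding ptime_def by blast
  have "run (c ;; d ;; e) (f z) (poly p Z) (h z)" if "D Z z" for Z z
    using p[OF that] by (rule run_Seq_assoc)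
  then show ?thesis unfolding ptime_def by blast
qed

section \<open>Commands for layers, inverses and applications\<close>

definition FAIL :: com where
  "FAIL = Psh 9 9 (\<lambda>_. 1)"

text \<open>Failure must leave the argument intact, because \<open>APP\<close> takes it as the
  signal to apply \<open>RAW\<close> to that same argument; hence the copy on stack 7 and the digit
  pushed back. An odd positive number has a preimage only if it is 1, and popping its single digit
  yields the preimage 0.\<close>

definition INV_EXPLICIT :: "nat \<Rightarrow> com" where
  "INV_EXPLICIT j = Cond 4 {1} (COPY 4 7 ;; PREIMG (Suc j) ;; Cond 4 {0} (XFER 7 4 ;; FAIL) (CLEAR 7))
     (Cond 4 {2} (Pop 4 ;; Cond 4 {0} Skip (Psh 4 4 (\<lambda>_. 2) ;; FAIL)) FAIL)"

lemma ptime_INV_EXPLICIT: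
  "ptime (\<lambda>Z (s, B, b, st). cfg_dom Z (s, B, b, st) \<and> st = []) (INV_EXPLICIT j) fst
     (\<lambda>(s, B, b, st). put_result s (map_option (\<lambda>q. (q, [])) (A_inv (Suc (Suc j)) b)))"
proof -
  let ?D = "\<lambda>Z (s, B, b, st). cfg_dom Z (s, B, b, st) \<and> st = []"
  let ?g = "\<lambda>(s, B, b, st). put_result s (map_option (\<lambda>q. (q, [])) (A_inv (Suc (Suc j)) b))"
  let ?v = "preimage0 (Suc (Suc j))"
  define D1 where "D1 = (\<lambda>Z (s :: stacks, B :: nat, b :: int, st :: (nat \<times> int) list).
    cfg_dom Z (s, B, b, st) \<and> st = [] \<and> even b \<and> 0 < b \<and> ?v b = 0)"
  define D2 where "D2 = (\<lambda>Z (s :: stacks, B :: nat, b :: int, st :: (nat \<times> int) list).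
    cfg_dom Z (s, B, b, st) \<and> st = [] \<and> even b \<and> 0 < b \<and> ?v b \<noteq> 0)"
  define D3 where "D3 = (\<lambda>Z (s :: stacks, B :: nat, b :: int, st :: (nat \<times> int) list).
    cfg_dom Z (s, B, b, st) \<and> st = [] \<and> b = 1)"
  define D4 where "D4 = (\<lambda>Z (s :: stacks, B :: nat, b :: int, st :: (nat \<times> int) list).
    cfg_dom Z (s, B, b, st) \<and> st = [] \<and> odd b \<and> 1 < b)"
  define D5 where "D5 = (\<lambda>Z (s :: stacks, B :: nat, b :: int, st :: (nat \<times> int) list).
    cfg_dom Z (s, B, b, st) \<and> st = [] \<and> b \<le> 0)"
  note defs = D1_def D2_def D3_def D4_def D5_def
  have inv: "A_inv (Suc (Suc j)) b = (if ?v b = 0 then None else Some (?v b))" if "even b" "0 < b" for b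
  proof (cases "A_inv (Suc (Suc j)) b")
    case (Some q)
    have "q \<noteq> 0" using A_inv_ge2(2)[OF _ Some] A_at_0[of "Suc (Suc j)"] that by auto
    then show ?thesis using Some by (simp add: preimage0_def)
  qed (simp add: preimage0_def)
  define F where "F = (\<lambda>(s, B :: nat, b, st :: (nat \<times> int) list). s(7 := enc b, 4 := enc (?v b)) :: stacks)"
  have even: "ptime D (COPY 4 7 ;; PREIMG (Suc j)) fst F" if D: "\<And>Z s B b st. D Z (s, B, b, st) \<Longrightarrow>
      cfg_dom Z (s, B, b, st) \<and> 0 < b" for D
  proof (rule ptime_Seq)
    show "ptime D (COPY 4 7) fst (\<lambda>(s, B, b, st). s(7 := enc b))"
      by (rule ptime_COPY[where q = "[:0, 1:]"]) (auto simp: cfg_dom_def dest!: D)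
    show "ptime D (PREIMG (Suc j)) (\<lambda>(s, B, b, st). s(7 := enc b)) F"
      by (rule ptime_use[OF ptime_PREIMG, where h = "\<lambda>(s, B, b, st). (s(7 := enc b), b)" and q = "[:0, 1:]"])
        (auto simp: cfg_dom_def preimg_dom_def F_def dest!: D)
  qed
  have 1: "ptime D1 (INV_EXPLICIT j) fst ?g" unfolding INV_EXPLICIT_def
  proof (rule ptime_CondT[OF ptime_Seq_assoc[OF even ptime_CondT[OF ptime_Seq]]])
    show "ptime D1 (XFER 7 4) F (\<lambda>(s, B, b, st). s)"
      by (rule ptime_XFER[where q = "[:0, 1:]"]) (auto simp: D1_def F_def cfg_dom_def fun_eq_iff)
    show "ptime D1 FAIL (\<lambda>(s, B, b, st). s) ?g" unfolding FAIL_def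
      by (rule ptime_Psh_const) (auto simp: D1_def cfg_dom_def inv)
  qed (auto simp: D1_def cfg_dom_def peek_enc F_def split: if_splits)
  have 2: "ptime D2 (INV_EXPLICIT j) fst ?g" unfolding INV_EXPLICIT_def
  proof (rule ptime_CondT[OF ptime_Seq_assoc[OF even ptime_CondF]])
    show "ptime D2 (CLEAR 7) F ?g"
      by (rule ptime_CLEAR[where q = "[:0, 1:]"]) (auto simp: D2_def F_def cfg_dom_def fun_eq_iff inv put_def)
  qed (auto simp: D2_def cfg_dom_def peek_enc peek_enc_0 F_def split: if_splits)
  have 3: "ptime D3 (INV_EXPLICIT j) fst ?g" unfolding INV_EXPLICIT_def
  proof (rule ptime_CondF[OF ptime_CondT[OF ptime_Seq[OF _ ptime_CondT[OF ptime_Skip]]]])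
    show "ptime D3 (Pop 4) fst ?g"
      by (rule ptime_Pop) (auto simp: D3_def cfg_dom_def fun_eq_iff put_def enc_1 A_inv_no_halving)
  qed (auto simp: D3_def cfg_dom_def peek_enc put_def A_inv_no_halving split: if_splits)
  have 4: "ptime D4 (INV_EXPLICIT j) fst ?g" unfolding INV_EXPLICIT_def
  proof (rule ptime_CondF[OF ptime_CondT[OF ptime_Seq[OF _ ptime_CondF[OF ptime_Seq]]]])
    show "ptime D4 (Pop 4) fst (\<lambda>(s, B, b, st). s(4 := enc (b div 2)))"
      by (rule ptime_Pop) (auto simp: D4_def cfg_dom_def fun_eq_iff tl_enc_odd)
    show "ptime D4 (Psh 4 4 (\<lambda>_. 2)) (\<lambda>(s, B, b, st). s(4 := enc (b div 2))) (\<lambda>(s, B, b, st). s)"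
      by (rule ptime_Psh_const) (auto simp: D4_def cfg_dom_def fun_eq_iff tl_enc_odd)
    show "ptime D4 FAIL (\<lambda>(s, B, b, st). s) ?g" unfolding FAIL_def
      by (rule ptime_Psh_const) (auto simp: D4_def cfg_dom_def A_inv_no_halving)
  qed (auto simp: D4_def cfg_dom_def peek_enc split: if_splits)
  have 5: "ptime D5 (INV_EXPLICIT j) fst ?g" unfolding INV_EXPLICIT_def
  proof (rule ptime_CondF[OF ptime_CondF])
    show "ptime D5 FAIL fst ?g" unfolding FAIL_def
      by (rule ptime_Psh_const) (auto simp: D5_def cfg_dom_def A_inv_no_halving)
  qed (auto simp: D5_def cfg_dom_def peek_enc split: if_splits)
  show ?thesis
    by (rule ptime_cases[where Q = "\<lambda>(s, B, b, st). b \<le> 0", OF ptime_cong[OF 5]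
        ptime_cases[where Q = "\<lambda>(s, B, b, st). b = 1", OF ptime_cong[OF 3]
        ptime_cases[where Q = "\<lambda>(s, B, b, st). odd b", OF ptime_cong[OF 4]
        ptime_cases[where Q = "\<lambda>(s, B, b, st). ?v b = 0", OF ptime_cong[OF 1] ptime_cong[OF 2]]]]])
      (auto simp: defs)
qed

text \<open>Moving digits between stacks reverses them, which is why layers store them reversed.
  \<open>POPL\<close> stops at a marker or at the bottom, as markers are at least 5 and digits at
  most 4.\<close>

definition PUSHL :: "nat \<Rightarrow> com" where
  "PUSHL r = MOVE 4 nonblank 5 ;; Psh 5 5 (\<lambda>_. 5 + r)"

definition POPL :: com where
  "POPL = Pop 5 ;; MOVE 5 {1, 2, 3, 4} 4"

lemma ptime_PUSHL:
  assumes "\<And>Z z. D Z z \<Longrightarrow> f z 4 = enc (b z) \<and> f z 5 = encst (st z) \<and> length (enc (b z)) \<le> poly q Z"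
    and "\<And>Z z. D Z z \<Longrightarrow> g z = put (f z) 0 ((r, b z) # st z)"
  shows "ptime D (PUSHL r) f g"
  unfolding PUSHL_def
proof (rule ptime_Seq)
  show "ptime D (MOVE 4 nonblank 5) f (\<lambda>z. (f z)(4 := [], 5 := rev (enc (b z)) @ encst (st z)))"
    by (rule ptime_MOVE_all[where q = q]) (auto dest!: assms(1))
  show "ptime D (Psh 5 5 (\<lambda>_. 5 + r)) (\<lambda>z. (f z)(4 := [], 5 := rev (enc (b z)) @ encst (st z))) g"
    by (rule ptime_Psh_const) (auto simp: assms(2) put_def)
qed

lemma ptime_POPL:
  assumes "\<And>Z z. D Z z \<Longrightarrow> f z 4 = [] \<and> f z 5 = encst ((r z, c z) # st z) \<and> length (enc (c z)) \<le> poly q Z"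
    and "\<And>Z z. D Z z \<Longrightarrow> g z = put (f z) (c z) (st z)"
  shows "ptime D POPL f g"
  unfolding POPL_def
proof (rule ptime_Seq)
  show "ptime D (Pop 5) f (\<lambda>z. (f z)(5 := rev (enc (c z)) @ encst (st z)))"
    by (rule ptime_Pop) (auto dest!: assms(1))
  have "ptime D (MOVE 5 {1, 2, 3, 4} 4) (\<lambda>z. (f z)(5 := rev (enc (c z)) @ encst (st z)))
     (\<lambda>z. ((f z)(5 := rev (enc (c z)) @ encst (st z)))(5 := encst (st z),
        4 := rev (rev (enc (c z))) @ ((f z)(5 := rev (enc (c z)) @ encst (st z))) 4))"
  proof (rule ptime_MOVE[where q = q], goal_cases)
    case (1 Z z)
    then show ?case using assms(1)[OF 1] set_enc[of "c z"] by (auto simp: peek_encst_small)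
  qed auto
  then show "ptime D (MOVE 5 {1, 2, 3, 4} 4) (\<lambda>z. (f z)(5 := rev (enc (c z)) @ encst (st z))) g"
  proof (rule ptime_cong, goal_cases)
    case (1 Z z)
    then show ?case using assms(1)[OF 1] assms(2)[OF 1] by (auto simp: put_def fun_eq_iff)
  qed
qed

definition RAW :: "nat \<Rightarrow> com" where
  "RAW j = Cond 5 {0} (Cond 4 {3, 4} (PUSHL (j + 2))
       (COPY 4 7 ;; EVAL j ;; Cond 4 {0} (XFER 7 4 ;; PUSHL (j + 2)) (CLEAR 7))) (PUSHL (j + 2))"

lemma ptime_RAW: "ptime cfg_dom (RAW j) fst (\<lambda>(s, B, b, st). case raw B (j + 2) b st of (b', st') \<Rightarrow> put s b' st')"
proof -
  let ?g = "\<lambda>(s, B, b, st). case raw B (j + 2) b st of (b', st') \<Rightarrow> put s b' st'"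
  define D1 where "D1 = (\<lambda>Z (s :: stacks, B :: nat, b :: int, st :: (nat \<times> int) list).
    cfg_dom Z (s, B, b, st) \<and> st \<noteq> [])"
  define D2 where "D2 = (\<lambda>Z (s :: stacks, B :: nat, b :: int, st :: (nat \<times> int) list).
    cfg_dom Z (s, B, b, st) \<and> st = [] \<and> b < 0)"
  define D3 where "D3 = (\<lambda>Z (s :: stacks, B :: nat, b :: int, st :: (nat \<times> int) list).
    cfg_dom Z (s, B, b, st) \<and> st = [] \<and> 0 \<le> b \<and> eval0 B j b = 0)"
  define D4 where "D4 = (\<lambda>Z (s :: stacks, B :: nat, b :: int, st :: (nat \<times> int) list).
    cfg_dom Z (s, B, b, st) \<and> st = [] \<and> 0 \<le> b \<and> eval0 B j b \<noteq> 0)"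
  note defs = D1_def D2_def D3_def D4_def
  have eval0: "A (Suc (Suc j)) b \<le> 2 ^ B \<longleftrightarrow> eval0 B j b \<noteq> 0" "eval0 B j b \<noteq> 0 \<Longrightarrow> A (Suc (Suc j)) b = eval0 B j b"
    if "0 \<le> b" for B b
    using A_pos[of "Suc (Suc j)" b] that by (auto simp: eval0_def add_2_eq_Suc' split: if_splits)
  have eval0_le: "eval0 B j b \<le> 2 ^ B" for B b by (simp add: eval0_def)
  define F where "F = (\<lambda>(s, B :: nat, b, st :: (nat \<times> int) list). s(7 := enc b, 4 := enc (eval0 B j b)) :: stacks)"
  have nonneg: "ptime D (COPY 4 7 ;; EVAL j) fst F" if D: "\<And>Z s B b st. D Z (s, B, b, st) \<Longrightarrow>
      cfg_dom Z (s, B, b, st) \<and> 0 \<le> b" for D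
  proof (rule ptime_Seq)
    show "ptime D (COPY 4 7) fst (\<lambda>(s, B, b, st). s(7 := enc b))"
      by (rule ptime_COPY[where q = "[:0, 1:]"]) (auto simp: cfg_dom_def dest!: D)
    show "ptime D (EVAL j) (\<lambda>(s, B, b, st). s(7 := enc b)) F"
      by (rule ptime_use[OF ptime_EVAL, where h = "\<lambda>(s, B, b, st). (s(7 := enc b), B, b)" and q = "[:0, 1:]"])
        (auto simp: cfg_dom_def eval_dom_def idle_def F_def dest!: D)
  qed
  have 1: "ptime D1 (RAW j) fst ?g" unfolding RAW_def
  proof (rule ptime_CondF)
    show "ptime D1 (PUSHL (j + 2)) fst ?g"
      by (rule ptime_PUSHL[where q = "[:0, 1:]" and b = "\<lambda>(s, B, b, st). b" and st = "\<lambda>(s, B, b, st). st"])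
        (auto simp: D1_def cfg_dom_def raw_def)
  qed (auto simp: D1_def cfg_dom_def peek_encst_small)
  have 2: "ptime D2 (RAW j) fst ?g" unfolding RAW_def
  proof (rule ptime_CondT[OF ptime_CondT])
    show "ptime D2 (PUSHL (j + 2)) fst ?g"
      by (rule ptime_PUSHL[where q = "[:0, 1:]" and b = "\<lambda>(s, B, b, st). b" and st = "\<lambda>(s, B, b, st). st"])
        (auto simp: D2_def cfg_dom_def raw_def)
  qed (auto simp: D2_def cfg_dom_def peek_enc split: if_splits)
  have 3: "ptime D3 (RAW j) fst ?g" unfolding RAW_def
  proof (rule ptime_CondT[OF ptime_CondF[OF ptime_Seq_assoc[OF nonneg ptime_CondT[OF ptime_Seq]]]])
    show "ptime D3 (XFER 7 4) F (\<lambda>(s, B, b, st). s)"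
      by (rule ptime_XFER[where q = "[:0, 1:]"]) (auto simp: D3_def F_def cfg_dom_def fun_eq_iff)
    show "ptime D3 (PUSHL (j + 2)) (\<lambda>(s, B, b, st). s) ?g"
      by (rule ptime_PUSHL[where q = "[:0, 1:]" and b = "\<lambda>(s, B, b, st). b" and st = "\<lambda>(s, B, b, st). st"])
        (auto simp: D3_def cfg_dom_def raw_def eval0)
  qed (auto simp: D3_def cfg_dom_def peek_enc F_def split: if_splits)
  have 4: "ptime D4 (RAW j) fst ?g" unfolding RAW_def
  proof (rule ptime_CondT[OF ptime_CondF[OF ptime_Seq_assoc[OF nonneg ptime_CondF]]])
    show "ptime D4 (CLEAR 7) F ?g"
      by (rule ptime_CLEAR[where q = "[:0, 1:]"]) (auto simp: D4_def F_def cfg_dom_def fun_eq_iff eval0 eval0_le put_def raw_def)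
  qed (auto simp: D4_def cfg_dom_def peek_enc peek_enc_0 F_def split: if_splits)
  show ?thesis
    by (rule ptime_cases[where Q = "\<lambda>(s, B, b, st). st \<noteq> []", OF ptime_cong[OF 1]
        ptime_cases[where Q = "\<lambda>(s, B, b, st). b < 0", OF ptime_cong[OF 2]
        ptime_cases[where Q = "\<lambda>(s, B, b, st). eval0 B j b = 0", OF ptime_cong[OF 3] ptime_cong[OF 4]]]])
      (auto simp: defs)
qed

text \<open>Clause by clause the functions \<open>invc\<close> and \<open>appc\<close>: on a
  nonempty stack 5 a top symbol below \<open>5 + (k - d)\<close> is the marker of a smaller index,
  and \<open>Pop 9\<close> withdraws the failure signal before \<open>RAW\<close> runs.
  \<open>RAW\<close> and \<open>INV_EXPLICIT\<close> count indices from 2.\<close>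

fun INV :: "nat \<Rightarrow> nat \<Rightarrow> com" and APP :: "nat \<Rightarrow> nat \<Rightarrow> com" where
  "INV k 0 = FAIL"
| "INV k (Suc d) = Cond 5 {0} (INV_EXPLICIT (k - d - 2))
     (Cond 4 {0} (Cond 5 {..<5 + (k - d)} FAIL (Cond 5 {5 + (k - d)} POPL
        (INV k d ;; Cond 9 {0} (DEC 4 ;; APP k d) Skip))) FAIL)"
| "APP k 0 = Skip"
| "APP k (Suc d) = INV k d ;; Cond 9 {0} (INC 4 ;; APP k d) (Pop 9 ;; RAW (k - d - 2))"

abbreviation resinv :: "nat \<Rightarrow> nat \<Rightarrow> stacks \<times> nat \<times> int \<times> (nat \<times> int) list \<Rightarrow> stacks" where
  "resinv k d \<equiv> (\<lambda>(s, B, b, st). put_result s (invc k B d b st))"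

definition resapp :: "nat \<Rightarrow> nat \<Rightarrow> int \<Rightarrow> stacks \<times> nat \<times> int \<times> (nat \<times> int) list \<Rightarrow> stacks" where
  "resapp k d e = (\<lambda>(s, B, b, st). case appc k B d (b + e) st of (b', st') \<Rightarrow> put s b' st')"

text \<open>Shared by both recursions: the result of a successful inverse is shifted by
  \<open>e\<close> and handed to the application. Inverse and shift together add at most
  \<open>2 ^ d\<close> bits, so the instance for \<open>APP\<close> has size
  \<open>Z + 2 ^ d\<close>.\<close>

lemma ptime_shift_APP:
  assumes app: "ptime cfg_dom (APP k d) fst (resapp k d 0)" and d: "d < k"
    and c: "c = INC 4 \<and> e = 1 \<or> c = DEC 4 \<and> e = - 1"
    and D: "\<And>Z s B b st. D Z (s, B, b, st) \<Longrightarrow> cfg_dom Z (s, B, b, st) \<and> invc k B d b st \<noteq> None"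
  shows "ptime D (c ;; APP k d) (resinv k d) (\<lambda>(s, B, b, st).
      case the (invc k B d b st) of (b', st') \<Rightarrow> resapp k d e (s, B, b', st'))"
proof (rule ptime_Seq)
  let ?h = "\<lambda>(s, B, b, st). case the (invc k B d b st) of (b', st') \<Rightarrow> (put s (b' + e) st', B, b' + e, st')"
  have ex: "\<exists>b' st'. invc k B d b st = Some (b', st') \<and> bits_le (Z + 2 ^ d - 1) b' st' \<and>
      bits_le (Z + 2 ^ d) (b' + e) st' \<and> cfg_dom Z (s, B, b, st)" if z: "D Z (s, B, b, st)" for Z s B b st
  proof -
    obtain b' st' where 1: "invc k B d b st = Some (b', st')" using D[OF z] by auto
    have "cfg_dom Z (s, B, b, st)" using D[OF z] by blast
    then have "bits_le (Z + 2 ^ d - 1) b' st'"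
      by (intro bits_le_invc_appc(1)[OF d _ _ 1]) (auto simp: cfg_dom_def)
    then show ?thesis using 1 D[OF z] c bits_le_step[of Z d b' st' e] by blast
  qed
  show "ptime D c (resinv k d) (\<lambda>z. fst (?h z))"
  proof -
    have g: "f z 4 = enc (x z) \<and> length (enc (x z)) \<le> poly [:2 ^ d, 1:] Z \<and> f z 6 = [] \<and>
        fst (?h z) = (f z)(4 := enc (x z + e))"
      if "D Z z" "f = resinv k d" "x = (\<lambda>(s, B, b, st). fst (the (invc k B d b st)))" for Z z f x
    proof -
      obtain s B b st where z: "z = (s, B, b, st)" by (metis prod.collapse)
      from ex[OF that(1)[unfolded z]] show ?thesis
        by (auto simp: z that(2,3) cfg_dom_def dest!: length_enc_bits_le)
    qed
    from c show ?thesis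
    proof
      assume c: "c = INC 4 \<and> e = 1"
      show ?thesis using g c
        by (auto intro!: ptime_INC[where q = "[:2 ^ d, 1:]" and
            x = "\<lambda>(s, B, b, st). fst (the (invc k B d b st))"])
    next
      assume c: "c = DEC 4 \<and> e = - 1"
      show ?thesis using g c
        by (auto intro!: ptime_DEC[where q = "[:2 ^ d, 1:]" and
            x = "\<lambda>(s, B, b, st). fst (the (invc k B d b st))"])
    qed
  qed
  show "ptime D (APP k d) (\<lambda>z. fst (?h z)) (\<lambda>(s, B, b, st).
      case the (invc k B d b st) of (b', st') \<Rightarrow> resapp k d e (s, B, b', st'))"
  proof (rule ptime_use[OF app, where h = ?h and q = "[:2 ^ d, 1:]"], goal_cases)
    case (1 Z z)
    obtain s B b st where z: "z = (s, B, b, st)" by (metis prod.collapse)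
    obtain b' st' where 2: "invc k B d b st = Some (b', st')" "bits_le (Z + 2 ^ d) (b' + e) st'"
        "cfg_dom Z (s, B, b, st)"
      using ex 1 z by blast
    have "cfg_dom (Z + 2 ^ d) (put s (b' + e) st', B, b' + e, st')"
      using cfg_dom_put[OF 2(3) _ 2(2)] by simp
    then show ?case using 2(1) by (auto simp: z resapp_def add.commute split: prod.splits)
  qed
qed

text \<open>Every level composes polynomials anew and may raise the degree, which is harmless
  because the depth of the recursion is below the fixed \<open>k\<close>.\<close>

lemma ptime_INV_APP:
  shows "d < k \<Longrightarrow> ptime cfg_dom (INV k d) fst (resinv k d)"
    and "d < k \<Longrightarrow> ptime cfg_dom (APP k d) fst (resapp k d 0)"
proof (induction d)
  case 0
  {
    case 1
    show ?case unfolding INV.simps FAIL_def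
      by (rule ptime_Psh_const) (auto simp: cfg_dom_def)
  next
    case 2
    show ?case unfolding APP.simps
      by (rule ptime_cong[OF ptime_Skip[where D = cfg_dom and f = fst]]) (auto simp: resapp_def put_id)
  }
next
  case (Suc d)
  {
    case 1
    then have d: "d < k" and i: "Suc (Suc (k - Suc (Suc d))) = k - d" by simp_all
    let ?i = "k - d"
    let ?g = "resinv k (Suc d)"
    define D1 where "D1 = (\<lambda>Z (s :: stacks, B :: nat, b :: int, st :: (nat \<times> int) list).
      cfg_dom Z (s, B, b, st) \<and> st = [])"
    define D2 where "D2 = (\<lambda>Z (s :: stacks, B :: nat, b :: int, st :: (nat \<times> int) list).
      cfg_dom Z (s, B, b, st) \<and> st \<noteq> [] \<and> b \<noteq> 0)"
    define D3 where "D3 = (\<lambda>Z (s :: stacks, B :: nat, b :: int, st :: (nat \<times> int) list).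
      cfg_dom Z (s, B, b, st) \<and> st \<noteq> [] \<and> b = 0 \<and> fst (hd st) < ?i)"
    define D4 where "D4 = (\<lambda>Z (s :: stacks, B :: nat, b :: int, st :: (nat \<times> int) list).
      cfg_dom Z (s, B, b, st) \<and> st \<noteq> [] \<and> b = 0 \<and> fst (hd st) = ?i)"
    define D5 where "D5 = (\<lambda>Z (s :: stacks, B :: nat, b :: int, st :: (nat \<times> int) list).
      cfg_dom Z (s, B, b, st) \<and> st \<noteq> [] \<and> b = 0 \<and> ?i < fst (hd st))"
    define D6 where "D6 = (\<lambda>Z (s :: stacks, B :: nat, b :: int, st :: (nat \<times> int) list).
      cfg_dom Z (s, B, b, st) \<and> st \<noteq> [] \<and> b = 0 \<and> ?i < fst (hd st) \<and> invc k B d b st = None)"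
    define D7 where "D7 = (\<lambda>Z (s :: stacks, B :: nat, b :: int, st :: (nat \<times> int) list).
      cfg_dom Z (s, B, b, st) \<and> st \<noteq> [] \<and> b = 0 \<and> ?i < fst (hd st) \<and> invc k B d b st \<noteq> None)"
    note defs = D1_def D2_def D3_def D4_def D5_def
    have ne: "\<exists>r c st'. st = (r, c) # st'" if "st \<noteq> []" for st :: "(nat \<times> int) list"
      using that by (cases st) auto
    have 1: "ptime D1 (INV k (Suc d)) fst ?g" unfolding INV.simps
    proof (rule ptime_CondT)
      show "ptime D1 (INV_EXPLICIT (k - d - 2)) fst ?g"
        by (rule ptime_cong[OF ptime_INV_EXPLICIT]) (auto simp: D1_def i)
    qed (auto simp: D1_def cfg_dom_def)
    have 2: "ptime D2 (INV k (Suc d)) fst ?g" unfolding INV.simps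
    proof (rule ptime_CondF[OF ptime_CondF])
      show "ptime D2 FAIL fst ?g" unfolding FAIL_def
        by (rule ptime_Psh_const) (auto simp: D2_def cfg_dom_def dest!: ne)
    qed (auto simp: D2_def cfg_dom_def peek_enc_0 peek_encst_small)
    have 3: "ptime D3 (INV k (Suc d)) fst ?g" unfolding INV.simps
    proof (rule ptime_CondF[OF ptime_CondT[OF ptime_CondT]])
      show "ptime D3 FAIL fst ?g" unfolding FAIL_def
        by (rule ptime_Psh_const) (auto simp: D3_def cfg_dom_def dest!: ne)
    qed (auto simp: D3_def cfg_dom_def peek_enc_0 peek_encst_small dest!: ne)
    have 4: "ptime D4 (INV k (Suc d)) fst ?g" unfolding INV.simps
    proof (rule ptime_CondF[OF ptime_CondT[OF ptime_CondF[OF ptime_CondT]]])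
      show "ptime D4 POPL fst ?g"
        by (rule ptime_POPL[where q = "[:0, 1:]" and r = "\<lambda>(s, B, b, st). fst (hd st)" and
              c = "\<lambda>(s, B, b, st). snd (hd st)" and st = "\<lambda>(s, B, b, st). tl st"])
          (auto simp: D4_def cfg_dom_def bits_le_def length_enc dest!: ne)
    qed (auto simp: D4_def cfg_dom_def peek_enc_0 peek_encst_small dest!: ne)
    have 6: "ptime D6 (Cond 9 {0} (DEC 4 ;; APP k d) Skip) (resinv k d) ?g"
    proof (rule ptime_CondF)
      show "ptime D6 Skip (resinv k d) ?g"
        by (rule ptime_cong[OF ptime_Skip[where D = D6 and f = "resinv k d"]]) (auto simp: D6_def dest!: ne)
    qed (auto simp: D6_def)
    have 7: "ptime D7 (Cond 9 {0} (DEC 4 ;; APP k d) Skip) (resinv k d) ?g"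
    proof (rule ptime_CondT)
      show "ptime D7 (DEC 4 ;; APP k d) (resinv k d) ?g"
        by (rule ptime_cong[OF ptime_shift_APP[OF Suc.IH(2)[OF d] d, where c = "DEC 4" and e = "- 1" and D = D7]])
          (auto simp: D7_def resapp_def put_result_def split: prod.splits dest!: ne)
    qed (auto simp: D7_def cfg_dom_def)
    have 67: "ptime D5 (Cond 9 {0} (DEC 4 ;; APP k d) Skip) (resinv k d) ?g"
      by (rule ptime_cases[where Q = "\<lambda>(s, B, b, st). invc k B d b st = None", OF ptime_cong[OF 6] ptime_cong[OF 7]])
        (auto simp: D5_def D6_def D7_def)
    have 5: "ptime D5 (INV k (Suc d)) fst ?g" unfolding INV.simps
    proof (rule ptime_CondF[OF ptime_CondT[OF ptime_CondF[OF ptime_CondF[OF ptime_Seq[OF _ 67]]]]])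
      show "ptime D5 (INV k d) fst (resinv k d)"
        by (rule ptime_cong[OF Suc.IH(1)[OF d]]) (auto simp: D5_def)
    qed (auto simp: D5_def cfg_dom_def peek_enc_0 peek_encst_small dest!: ne)
    show ?case
      by (rule ptime_cases[where Q = "\<lambda>(s, B, b, st). st = []", OF ptime_cong[OF 1]
        ptime_cases[where Q = "\<lambda>(s, B, b, st). b \<noteq> 0", OF ptime_cong[OF 2]
        ptime_cases[where Q = "\<lambda>(s, B, b, st). fst (hd st) < ?i", OF ptime_cong[OF 3]
        ptime_cases[where Q = "\<lambda>(s, B, b, st). fst (hd st) = ?i", OF ptime_cong[OF 4] ptime_cong[OF 5]]]]])
        (auto simp: defs)
  next
    case 2
    then have d: "d < k" and i: "Suc (Suc (k - Suc (Suc d))) = k - d" by simp_all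
    let ?g = "resapp k (Suc d) 0"
    define D1 where "D1 = (\<lambda>Z (s :: stacks, B :: nat, b :: int, st :: (nat \<times> int) list).
      cfg_dom Z (s, B, b, st) \<and> invc k B d b st = None)"
    define D2 where "D2 = (\<lambda>Z (s :: stacks, B :: nat, b :: int, st :: (nat \<times> int) list).
      cfg_dom Z (s, B, b, st) \<and> invc k B d b st \<noteq> None)"
    let ?tail = "Cond 9 {0} (INC 4 ;; APP k d) (Pop 9 ;; RAW (k - d - 2))"
    have 1: "ptime D1 ?tail (resinv k d) ?g"
    proof (rule ptime_CondF[OF ptime_Seq])
      show "ptime D1 (Pop 9) (resinv k d) fst"
        by (rule ptime_Pop) (auto simp: D1_def cfg_dom_def)
      show "ptime D1 (RAW (k - d - 2)) fst ?g"
        by (rule ptime_cong[OF ptime_RAW]) (auto simp: D1_def resapp_def i)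
    qed (auto simp: D1_def)
    have 2: "ptime D2 ?tail (resinv k d) ?g"
    proof (rule ptime_CondT)
      show "ptime D2 (INC 4 ;; APP k d) (resinv k d) ?g"
        by (rule ptime_cong[OF ptime_shift_APP[OF Suc.IH(2)[OF d] d, where c = "INC 4" and e = 1 and D = D2]])
          (auto simp: D2_def resapp_def split: prod.splits)
    qed (auto simp: D2_def cfg_dom_def)
    have 3: "ptime cfg_dom ?tail (resinv k d) ?g"
      by (rule ptime_cases[where Q = "\<lambda>(s, B, b, st). invc k B d b st = None", OF ptime_cong[OF 1] ptime_cong[OF 2]])
        (auto simp: D1_def D2_def)
    show ?case unfolding APP.simps by (rule ptime_Seq[OF Suc.IH(1)[OF d] 3])
  }
qed

subsection \<open>Processing one letter\<close>

definition DBL :: com where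
  "DBL = Cond 4 {1, 2} (Psh 4 4 (\<lambda>_. 1)) (Cond 4 {3, 4} (Psh 4 4 (\<lambda>_. 3)) Skip)"

definition HLV :: com where
  "HLV = Cond 4 {0} Skip (Pop 4)"

lemma ptime_DBL:
  assumes D: "\<And>Z z. D Z z \<Longrightarrow> f z 4 = enc (x z)" and g: "\<And>Z z. D Z z \<Longrightarrow> g z = (f z)(4 := enc (2 * x z))"
  shows "ptime D DBL f g"
proof -
  have 1: "ptime (\<lambda>Z z. D Z z \<and> 0 < x z) DBL f g" unfolding DBL_def
    by (rule ptime_CondT, rule ptime_Psh_const) (auto simp: D g enc_double peek_enc split: if_splits)
  have 2: "ptime (\<lambda>Z z. D Z z \<and> x z < 0) DBL f g" unfolding DBL_def
    by (rule ptime_CondF, rule ptime_CondT, rule ptime_Psh_const)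
      (auto simp: D g enc_double peek_enc split: if_splits)
  have 3: "ptime (\<lambda>Z z. D Z z \<and> x z = 0) DBL f g" unfolding DBL_def
  proof (rule ptime_CondF, rule ptime_CondF)
    have "(f z)(4 := []) = f z" if "D Z z" "x z = 0" for Z z using D[OF that(1)] that(2) by auto
    then show "ptime (\<lambda>Z z. D Z z \<and> x z = 0) Skip f g"
      by (intro ptime_cong[OF ptime_Skip[where D = "\<lambda>Z z. D Z z \<and> x z = 0" and f = f]]) (auto simp: g)
  qed (auto simp: D)
  show ?thesis
    by (rule ptime_cases[where Q = "\<lambda>z. 0 < x z", OF 1 ptime_cases[where Q = "\<lambda>z. x z < 0", OF ptime_cong[OF 2] ptime_cong[OF 3]]])
      auto
qed

lemma ptime_HLV:
  assumes D: "\<And>Z z. D Z z \<Longrightarrow> f z 4 = enc (x z) \<and> even (x z)"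
    and g: "\<And>Z z. D Z z \<Longrightarrow> g z = (f z)(4 := enc (x z div 2))"
  shows "ptime D HLV f g"
proof -
  have 1: "ptime (\<lambda>Z z. D Z z \<and> x z = 0) HLV f g" unfolding HLV_def
  proof (rule ptime_CondT)
    have "(f z)(4 := []) = f z" if "D Z z" "x z = 0" for Z z using D[OF that(1)] that(2) by auto
    then show "ptime (\<lambda>Z z. D Z z \<and> x z = 0) Skip f g"
      by (intro ptime_cong[OF ptime_Skip[where D = "\<lambda>Z z. D Z z \<and> x z = 0" and f = f]]) (auto simp: g)
  qed (auto simp: D)
  have 2: "ptime (\<lambda>Z z. D Z z \<and> x z \<noteq> 0) HLV f g" unfolding HLV_def
    by (rule ptime_CondF, rule ptime_Pop) (auto simp: D g tl_enc_even)
  show ?thesis by (rule ptime_cases[where Q = "\<lambda>z. x z = 0", OF 1 2])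
qed

text \<open>On a layered number the offset is set aside while doubling or halving the layer below it.\<close>

definition SCALE :: "nat \<Rightarrow> com \<Rightarrow> com \<Rightarrow> com" where
  "SCALE k c fin = XFER 4 8 ;; INV k (k - 1) ;;
     Cond 9 {0} (c ;; APP k (k - 1) ;; CLEAR 4 ;; XFER 8 4 ;; fin) (XFER 8 4)"

text \<open>The condition on \<open>fin\<close> is stated for all families of states, because the
  states in which \<open>fin\<close> runs are known only inside the proof.\<close>

lemma ptime_SCALE:
  fixes D :: "nat \<Rightarrow> stacks \<times> nat \<times> int \<times> (nat \<times> int) list \<Rightarrow> bool"
  assumes k: "1 \<le> k" and c: "c = INC 4 \<and> e = 1 \<or> c = DEC 4 \<and> e = - 1"
    and fin: "\<And>(E :: nat \<Rightarrow> stacks \<times> nat \<times> int \<times> (nat \<times> int) list \<Rightarrow> bool) f g.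
      (\<And>Z s B b st. E Z (s, B, b, st) \<Longrightarrow> D Z (s, B, b, st) \<and> f (s, B, b, st) 4 = enc b \<and>
         g (s, B, b, st) = (f (s, B, b, st))(4 := enc (phi b))) \<Longrightarrow> ptime E fin f g"
    and D: "\<And>Z s B b st. D Z (s, B, b, st) \<Longrightarrow> cfg_dom Z (s, B, b, st) \<and> s 8 = []"
  shows "ptime D (SCALE k c fin) fst (\<lambda>(s, B, b, st). put_result s (map_option
    (\<lambda>(b', st'). (phi b, snd (appc k B (k - 1) (b' + e) st'))) (invc k B (k - 1) 0 st)))"
proof -
  let ?d = "k - 1"
  have d: "?d < k" using k by simp
  define f1 where "f1 = (\<lambda>(s, B :: nat, b, st :: (nat \<times> int) list). s(4 := [], 8 := enc b) :: stacks)"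
  define h where "h = (\<lambda>(s, B, b, st). (f1 (s, B, b, st), B, 0 :: int, st))"
  let ?g = "\<lambda>(s, B, b, st). put_result s (map_option
    (\<lambda>(b', st'). (phi b, snd (appc k B (k - 1) (b' + e) st'))) (invc k B (k - 1) 0 st))"
  have h: "cfg_dom Z (h z)" if "D Z z" for Z z
  proof -
    obtain s B b st where z: "z = (s, B, b, st)" by (metis prod.collapse)
    show ?thesis using D that unfolding z by (fastforce simp: h_def f1_def cfg_dom_def bits_le_def)
  qed
  define N where "N = (\<lambda>(s :: stacks, B, b :: int, st). invc k B ?d 0 st = None)"
  have 1: "ptime D (XFER 4 8) fst f1"
    by (rule ptime_XFER[where q = "[:0, 1:]"]) (auto simp: f1_def cfg_dom_def dest!: D)
  have 2: "ptime D (INV k ?d) f1 (\<lambda>z. resinv k ?d (h z))"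
  proof (rule ptime_use[OF ptime_INV_APP(1)[OF d], where h = h and q = "[:0, 1:]"], goal_cases)
    case (1 Z z)
    then show ?case using h[OF 1] by (cases z) (simp add: h_def)
  qed
  let ?N = "\<lambda>Z z. D Z z \<and> N z" and ?S = "\<lambda>Z z. D Z z \<and> \<not> N z"
  have 3: "ptime ?N (XFER 8 4) (\<lambda>z. resinv k ?d (h z)) ?g"
    by (rule ptime_XFER[where q = "[:0, 1:]"])
      (auto simp: N_def h_def f1_def cfg_dom_def fun_eq_iff dest!: D)
  have S: "\<exists>b' st' b2 st2. invc k B ?d 0 st = Some (b', st') \<and> appc k B ?d (b' + e) st' = (b2, st2) \<and>
      length (enc b2) \<le> Z + 2 ^ ?d + 2 ^ ?d \<and> cfg_dom Z (s, B, b, st) \<and> s 8 = []" if z: "?S Z (s, B, b, st)" for Z s B b st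
  proof -
    obtain b' st' where i: "invc k B ?d 0 st = Some (b', st')" using z by (auto simp: N_def)
    obtain b2 st2 where a: "appc k B ?d (b' + e) st' = (b2, st2)" by force
    have c1: "cfg_dom Z (s, B, b, st)" "s 8 = []" using D z by auto
    have "bits_le Z 0 st" using c1 by (auto simp: cfg_dom_def bits_le_def)
    then have "bits_le (Z + 2 ^ ?d - 1) b' st'"
      by (rule bits_le_invc_appc(1)[OF d _ _ i]) (use c1 in \<open>auto simp: cfg_dom_def\<close>)
    then have "bits_le (Z + 2 ^ ?d) (b' + e) st'" using bits_le_step c by blast
    then have "bits_le (Z + 2 ^ ?d + 2 ^ ?d - 1) b2 st2"
      by (rule bits_le_invc_appc(2)[OF d _ _ a]) (use c1 in \<open>auto simp: cfg_dom_def\<close>)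
    then have "length (enc b2) \<le> Z + 2 ^ ?d + 2 ^ ?d" using length_enc_bits_le by fastforce
    then show ?thesis using i a c1 by blast
  qed
  let ?ap = "\<lambda>(s, B, b, st). case the (invc k B ?d 0 st) of (b', st') \<Rightarrow> appc k B ?d (b' + e) st'"
  have 4: "ptime ?S (c ;; APP k ?d) (\<lambda>z. resinv k ?d (h z)) (\<lambda>z. put (f1 z) (fst (?ap z)) (snd (?ap z)))"
  proof (rule ptime_use[OF ptime_shift_APP[OF ptime_INV_APP(2)[OF d] d c, where
        D = "\<lambda>Z (s, B, b, st). cfg_dom Z (s, B, b, st) \<and> invc k B ?d b st \<noteq> None"], where h = h and q = "[:0, 1:]"], goal_cases)
    case (2 Z z)
    obtain s B b st where z: "z = (s, B, b, st)" by (metis prod.collapse)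
    from S 2 obtain b' st' b2 st2 where "invc k B ?d 0 st = Some (b', st')" "appc k B ?d (b' + e) st' = (b2, st2)"
      unfolding z by blast
    then show ?case using 2 h[of Z z] by (auto simp: z h_def resapp_def)
  qed auto
  \<comment> \<open>Clearing stack 4 realises the \<open>snd\<close> in \<open>stepc\<close>: only
    the layers of the result are kept, and the saved offset returns afterwards.\<close>
  have 5: "ptime ?S (CLEAR 4) (\<lambda>z. put (f1 z) (fst (?ap z)) (snd (?ap z)))
      (\<lambda>z. (f1 z)(4 := [], 5 := encst (snd (?ap z))))"
  proof (rule ptime_CLEAR[where q = "[:2 ^ ?d + 2 ^ ?d, 1:]"], goal_cases)
    case (1 Z z)
    obtain s B b st where z: "z = (s, B, b, st)" by (metis prod.collapse)
    from S[OF 1[unfolded z]] show ?case by (auto simp: z)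
  qed (auto simp: put_def fun_eq_iff)
  have 6: "ptime ?S (XFER 8 4) (\<lambda>z. (f1 z)(4 := [], 5 := encst (snd (?ap z))))
      (\<lambda>(s, B, b, st). s(4 := enc b, 5 := encst (snd (?ap (s, B, b, st)))))"
    by (rule ptime_XFER[where q = "[:0, 1:]"])
      (auto simp: f1_def cfg_dom_def fun_eq_iff dest!: D)
  have 7: "ptime ?S fin (\<lambda>(s, B, b, st). s(4 := enc b, 5 := encst (snd (?ap (s, B, b, st))))) ?g"
  proof (rule fin, goal_cases)
    case (1 Z s B b st)
    from S[OF 1] show ?case using 1 by (auto simp: put_def)
  qed
  have 8: "ptime ?S (c ;; APP k ?d ;; CLEAR 4 ;; XFER 8 4 ;; fin) (\<lambda>z. resinv k ?d (h z)) ?g"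
    by (rule ptime_Seq_assoc[OF 4 ptime_Seq[OF 5 ptime_Seq[OF 6 7]]])
  have 9: "ptime D (Cond 9 {0} (c ;; APP k ?d ;; CLEAR 4 ;; XFER 8 4 ;; fin) (XFER 8 4)) (\<lambda>z. resinv k ?d (h z)) ?g"
  proof (rule ptime_cases[where Q = N, OF ptime_CondF[OF 3] ptime_CondT[OF 8]])
    show "peek (resinv k ?d (h z) 9) \<notin> {0}" if "?N Z z" for Z z
      using that by (auto simp: N_def h_def)
    show "peek (resinv k ?d (h z) 9) \<in> {0}" if "?S Z z" for Z z
    proof -
      obtain s B b st where z: "z = (s, B, b, st)" by (metis prod.collapse)
      from S[OF that[unfolded z]] show ?thesis by (auto simp: z h_def f1_def cfg_dom_def)
    qed
  qed
  show ?thesis unfolding SCALE_def by (rule ptime_Seq[OF 1 ptime_Seq[OF 2 9]])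
qed

fun STEP :: "nat \<Rightarrow> letter \<Rightarrow> com" where
  "STEP k (Ack 0) = INC 4"
| "STEP k (Ack (Suc 0)) = Cond 5 {0} DBL (SCALE k (INC 4) DBL)"
| "STEP k (Ack (Suc (Suc i))) = Cond 5 {0} (Cond 4 {3, 4} FAIL (APP k (k - Suc i))) (APP k (k - Suc i))"
| "STEP k (AckInv 0) = DEC 4"
| "STEP k (AckInv (Suc 0)) = Cond 4 {2, 4} FAIL (Cond 5 {0} HLV (SCALE k (DEC 4) HLV))"
| "STEP k (AckInv (Suc (Suc i))) = INV k (k - Suc i)"

definition step_dom :: "nat \<Rightarrow> stacks \<times> nat \<times> int \<times> (nat \<times> int) list \<Rightarrow> bool" where
  "step_dom Z = (\<lambda>(s, B, b, st). cfg_dom Z (s, B, b, st) \<and> s 8 = [])"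

abbreviation resstep :: "nat \<Rightarrow> letter \<Rightarrow> stacks \<times> nat \<times> int \<times> (nat \<times> int) list \<Rightarrow> stacks" where
  "resstep k x \<equiv> (\<lambda>(s, B, b, st). put_result s (stepc k B x b st))"

lemma ptime_STEP:
  assumes "index x \<le> k"
  shows "ptime step_dom (STEP k x) fst (resstep k x)"
proof -
  let ?E = "\<lambda>(s, B, b, st). st = []"
  have put4: "s(4 := enc b) = put s b st" if "cfg_dom Z (s, B, b', st)" for Z s B b b' and st
    using that by (auto simp: put_def cfg_dom_def)
  have app: "ptime (\<lambda>Z (s, B, b, st). step_dom Z (s, B, b, st) \<and> (st = [] \<longrightarrow> 0 \<le> b)) (APP k (k - Suc i)) fst
      (resstep k (Ack (Suc (Suc i))))" if "Suc (Suc i) \<le> k" for i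
    by (rule ptime_cong[OF ptime_INV_APP(2)]) (use that in \<open>auto simp: step_dom_def resapp_def put_result_def\<close>)
  show ?thesis
  proof (cases "(k, x)" rule: STEP.cases)
    case (1 k)
    have "ptime step_dom (STEP k (Ack 0)) fst (resstep k (Ack 0))" unfolding STEP.simps
      by (rule ptime_INC[where q = "[:0, 1:]" and x = "\<lambda>(s, B, b, st). b"])
        (auto simp: step_dom_def cfg_dom_def put_def)
    then show ?thesis using 1 by (simp only: prod.inject)
  next
    case (2 k')
    let ?x = "Ack (Suc 0)"
    have a: "ptime (\<lambda>Z z. step_dom Z z \<and> ?E z) DBL fst (resstep k ?x)"
      by (rule ptime_DBL[where x = "\<lambda>(s, B, b, st). b"]) (auto simp: step_dom_def cfg_dom_def put_def)
    have b: "ptime (\<lambda>Z z. step_dom Z z \<and> \<not> ?E z) (SCALE k (INC 4) DBL) fst (resstep k ?x)"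
      by (rule ptime_cong[OF ptime_SCALE[where c = "INC 4" and e = 1 and phi = "\<lambda>b. 2 * b" and
            D = "\<lambda>Z z. step_dom Z z \<and> \<not> ?E z"]])
        (use 2 assms in \<open>auto simp: step_dom_def split: prod.splits intro!: ptime_DBL[where x = "\<lambda>(s, B, b, st). b"]\<close>)
    have "ptime step_dom (STEP k ?x) fst (resstep k ?x)" unfolding STEP.simps
      by (rule ptime_cases[where Q = ?E, OF ptime_CondT[OF a] ptime_CondF[OF b]]) (auto simp: step_dom_def cfg_dom_def)
    then show ?thesis using 2 by (simp only: prod.inject)
  next
    case (3 k' i)
    let ?x = "Ack (Suc (Suc i))"
    have i: "Suc (Suc i) \<le> k" using 3 assms by simp
    let ?N = "\<lambda>(s, B, b, st). b < 0"
    have a: "ptime (\<lambda>Z z. (step_dom Z z \<and> ?E z) \<and> ?N z) FAIL fst (resstep k ?x)" unfolding FAIL_def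
      by (rule ptime_Psh_const) (auto simp: step_dom_def cfg_dom_def)
    have b: "ptime (\<lambda>Z z. (step_dom Z z \<and> ?E z) \<and> \<not> ?N z) (APP k (k - Suc i)) fst (resstep k ?x)"
      by (rule ptime_cong[OF app[OF i]]) auto
    have c: "ptime (\<lambda>Z z. step_dom Z z \<and> \<not> ?E z) (APP k (k - Suc i)) fst (resstep k ?x)"
      by (rule ptime_cong[OF app[OF i]]) auto
    have d: "ptime (\<lambda>Z z. step_dom Z z \<and> ?E z) (Cond 4 {3, 4} FAIL (APP k (k - Suc i))) fst (resstep k ?x)"
      by (rule ptime_cases[where Q = ?N, OF ptime_CondT[OF a] ptime_CondF[OF b]])
        (auto simp: step_dom_def cfg_dom_def peek_enc split: if_splits)
    have "ptime step_dom (STEP k ?x) fst (resstep k ?x)" unfolding STEP.simps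
      by (rule ptime_cases[where Q = ?E, OF ptime_CondT[OF d] ptime_CondF[OF c]]) (auto simp: step_dom_def cfg_dom_def)
    then show ?thesis using 3 by (simp only: prod.inject)
  next
    case (4 k')
    have "ptime step_dom (STEP k (AckInv 0)) fst (resstep k (AckInv 0))" unfolding STEP.simps
      by (rule ptime_DEC[where q = "[:0, 1:]" and x = "\<lambda>(s, B, b, st). b"])
        (auto simp: step_dom_def cfg_dom_def put_def)
    then show ?thesis using 4 by (simp only: prod.inject)
  next
    case (5 k')
    let ?x = "AckInv (Suc 0)" and ?O = "\<lambda>(s, B, b, st). odd b"
    have a: "ptime (\<lambda>Z z. step_dom Z z \<and> ?O z) FAIL fst (resstep k ?x)" unfolding FAIL_def
      by (rule ptime_Psh_const) (auto simp: step_dom_def cfg_dom_def)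
    have b: "ptime (\<lambda>Z z. (step_dom Z z \<and> \<not> ?O z) \<and> ?E z) HLV fst (resstep k ?x)"
      by (rule ptime_HLV[where x = "\<lambda>(s, B, b, st). b"]) (auto simp: step_dom_def cfg_dom_def put_def)
    have c: "ptime (\<lambda>Z z. (step_dom Z z \<and> \<not> ?O z) \<and> \<not> ?E z) (SCALE k (DEC 4) HLV) fst (resstep k ?x)"
      by (rule ptime_cong[OF ptime_SCALE[where c = "DEC 4" and e = "- 1" and phi = "\<lambda>b. b div 2" and
            D = "\<lambda>Z z. (step_dom Z z \<and> \<not> ?O z) \<and> \<not> ?E z"]])
        (use 5 assms in \<open>auto simp: step_dom_def split: prod.splits intro!: ptime_HLV[where x = "\<lambda>(s, B, b, st). b"]\<close>)
    have d: "ptime (\<lambda>Z z. step_dom Z z \<and> \<not> ?O z) (Cond 5 {0} HLV (SCALE k (DEC 4) HLV)) fst (resstep k ?x)"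
      by (rule ptime_cases[where Q = ?E, OF ptime_CondT[OF b] ptime_CondF[OF c]]) (auto simp: step_dom_def cfg_dom_def)
    have "ptime step_dom (STEP k ?x) fst (resstep k ?x)" unfolding STEP.simps
      by (rule ptime_cases[where Q = ?O, OF ptime_CondT[OF a] ptime_CondF[OF d]])
        (auto simp: step_dom_def cfg_dom_def peek_enc split: if_splits)
    then show ?thesis using 5 by (simp only: prod.inject)
  next
    case (6 k' i)
    have "ptime step_dom (STEP k (AckInv (Suc (Suc i)))) fst (resstep k (AckInv (Suc (Suc i))))" unfolding STEP.simps
      by (rule ptime_cong[OF ptime_INV_APP(1)]) (use 6 assms in \<open>auto simp: step_dom_def\<close>)
    then show ?thesis using 6 by (simp only: prod.inject)
  qed
qed

subsection \<open>The whole machine\<close>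

lemma ptime_dispatch:
  assumes "\<And>x. x \<in> set xs \<Longrightarrow> ptime (\<lambda>Z z. D Z z \<and> l z = x) (S x) f g"
    and "\<And>Z z. D Z z \<Longrightarrow> l z \<in> set xs \<and> peek (f z 1) = letter_code (l z)"
  shows "ptime D (foldr (\<lambda>x c. Cond 1 {letter_code x} (S x) c) xs Skip) f g"
  using assms
proof (induction xs arbitrary: D)
  case Nil
  then show ?case unfolding ptime_def by auto
next
  case (Cons x xs)
  have ne: "letter_code y \<noteq> letter_code x" if "y \<noteq> x" for y
    using that inj_letter_code by (auto dest: injD)
  have 1: "ptime (\<lambda>Z z. D Z z \<and> l z = x) (S x) f g" using Cons.prems(1) by simp
  have 2: "ptime (\<lambda>Z z. D Z z \<and> l z \<noteq> x) (foldr (\<lambda>x c. Cond 1 {letter_code x} (S x) c) xs Skip) f g"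
  proof (rule Cons.IH)
    fix y assume y: "y \<in> set xs"
    have "ptime (\<lambda>Z z. D Z z \<and> l z = y) (S y) f g" using Cons.prems(1) y by simp
    then show "ptime (\<lambda>Z z. (D Z z \<and> l z \<noteq> x) \<and> l z = y) (S y) f g" by (rule ptime_cong) simp
  next
    fix Z z assume "D Z z \<and> l z \<noteq> x"
    then show "l z \<in> set xs \<and> peek (f z 1) = letter_code (l z)" using Cons.prems(2)[of Z z] by auto
  qed
  show ?case unfolding foldr.simps o_apply
    by (rule ptime_cases[where Q = "\<lambda>z. l z = x", OF ptime_CondT[OF 1] ptime_CondF[OF 2]])
      (use Cons.prems(2) ne in auto)
qed

definition letters :: "nat \<Rightarrow> letter list" where
  "letters k = map Ack [0..<Suc k] @ map AckInv [0..<Suc k]"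

lemma set_letters: "x \<in> set (letters k) \<longleftrightarrow> index x \<le> k"
  by (cases x) (auto simp: letters_def image_iff less_Suc_eq_le)

primrec FUEL :: "nat \<Rightarrow> com" where
  "FUEL 0 = Skip"
| "FUEL (Suc n) = Psh 2 2 (\<lambda>_. 1) ;; FUEL n"

lemma ptime_FUEL: "(\<And>Z z. D Z z \<Longrightarrow> g z = (f z)(2 := replicate n 1 @ f z 2)) \<Longrightarrow> ptime D (FUEL n) f g"
proof (induction n arbitrary: f g)
  case 0
  then show ?case by (auto intro: ptime_cong[OF ptime_Skip[where D = D and f = f]])
next
  case (Suc n)
  show ?case unfolding FUEL.simps
  proof (rule ptime_Seq)
    show "ptime D (Psh 2 2 (\<lambda>_. 1)) f (\<lambda>z. (f z)(2 := 1 # f z 2))" by (rule ptime_Psh_const) auto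
    show "ptime D (FUEL n) (\<lambda>z. (f z)(2 := 1 # f z 2)) g"
      by (rule Suc.IH) (auto simp: Suc.prems replicate_app_Cons_same)
  qed
qed

text \<open>Emptying stack 0 onto stack 1 reverses the word, so its last letter, which is applied
  first, comes out on top; each letter also contributes its share \<open>2 ^ k + 1\<close> of the
  unary bound.\<close>

definition PREPARE :: "nat \<Rightarrow> com" where
  "PREPARE k = Loop 0 nonblank (Psh 1 0 id ;; Pop 0 ;; FUEL (2 ^ k + 1)) ;; FUEL 2"

definition fuel :: "nat \<Rightarrow> nat \<Rightarrow> nat" where
  "fuel k n = (2 ^ k + 1) * n + 2"

abbreviation empty :: stacks where "empty \<equiv> (\<lambda>_. [])"

lemma ptime_PREPARE: "ptime (\<lambda>Z xs. 0 \<notin> set xs \<and> length xs = Z) (PREPARE k) (\<lambda>xs. empty(0 := xs))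
    (\<lambda>xs. empty(1 := rev xs, 2 := replicate (fuel k (length xs)) 1))"
proof -
  let ?D = "\<lambda>Z xs. 0 \<notin> set xs \<and> length xs = Z"
  let ?m = "2 ^ k + 1 :: nat"
  let ?body = "Psh 1 0 id ;; Pop 0 ;; FUEL ?m"
  define F where "F = (\<lambda>xs j. empty(0 := drop j xs, 1 := rev (take j xs), 2 := replicate (?m * j) (1 :: nat)))"
  define E where "E = (\<lambda>Z (xs :: nat list, j). ?D Z xs \<and> j < length xs)"
  have drop: "drop j xs = xs ! j # drop (Suc j) xs" "xs ! j \<noteq> 0"
    if "E Z (xs, j)" for Z xs j
  proof -
    have j: "j < length xs" "0 \<notin> set xs" using that by (auto simp: E_def)
    show "drop j xs = xs ! j # drop (Suc j) xs" using j(1) by (simp add: Cons_nth_drop_Suc)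
    show "xs ! j \<noteq> 0" using nth_mem[OF j(1)] j(2) by metis
  qed
  have body: "ptime E ?body (\<lambda>(xs, j). F xs j) (\<lambda>(xs, j). F xs (Suc j))"
  proof (rule ptime_Seq[OF _ ptime_Seq])
    show "ptime E (Psh 1 0 id) (\<lambda>(xs, j). F xs j) (\<lambda>(xs, j). (F xs j)(1 := rev (take (Suc j) xs)))"
    proof (rule ptime_Psh, goal_cases)
      case (1 Z z)
      then show ?case using drop by (cases z) (auto simp: F_def)
    next
      case (2 Z z)
      obtain xs j where z: "z = (xs, j)" by force
      show ?case using drop[OF 2[unfolded z]] 2 by (simp add: z F_def E_def take_Suc_conv_app_nth fun_eq_iff)
    qed
    show "ptime E (Pop 0) (\<lambda>(xs, j). (F xs j)(1 := rev (take (Suc j) xs)))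
       (\<lambda>(xs, j). (F xs j)(0 := drop (Suc j) xs, 1 := rev (take (Suc j) xs)))"
      by (rule ptime_Pop) (auto simp: F_def fun_eq_iff tl_drop drop_Suc)
    show "ptime E (FUEL ?m) (\<lambda>(xs, j). (F xs j)(0 := drop (Suc j) xs, 1 := rev (take (Suc j) xs)))
       (\<lambda>(xs, j). F xs (Suc j))"
      by (rule ptime_FUEL) (auto simp: F_def fun_eq_iff simp flip: replicate_add)
  qed
  have 1: "ptime ?D (Loop 0 nonblank ?body) (\<lambda>xs. F xs 0) (\<lambda>xs. F xs (length xs))"
  proof (rule ptime_Loop[where q = "[:0, 1:]"])
    show "ptime (\<lambda>Z (xs, j). ?D Z xs \<and> j < length xs) ?body (\<lambda>(xs, j). F xs j) (\<lambda>(xs, j). F xs (Suc j))"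
      by (rule ptime_cong[OF body]) (auto simp: E_def)
    show "peek (F xs j 0) \<in> nonblank" if "?D Z xs" "j < length xs" for Z xs j
      using drop[of Z xs j] that by (auto simp: F_def E_def)
  qed (auto simp: F_def)
  have 2: "ptime ?D (FUEL 2) (\<lambda>xs. F xs (length xs)) (\<lambda>xs. empty(1 := rev xs, 2 := replicate (fuel k (length xs)) 1))"
    by (rule ptime_FUEL) (auto simp: F_def fuel_def fun_eq_iff simp flip: replicate_add)
  show ?thesis unfolding PREPARE_def
    by (rule ptime_cong[OF ptime_Seq[OF 1 2]]) (auto simp: F_def fun_eq_iff)
qed

text \<open>The unit of fuel is spent before the letter is applied, since \<open>trace\<close>
  computes step \<open>Suc j\<close> with the bound \<open>B - Suc j\<close>. After a failure the
  remaining letters are only removed, so the loop always empties stack 1.\<close>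

definition PROCESS :: "nat \<Rightarrow> com" where
  "PROCESS k = Loop 1 nonblank (Pop 2 ;;
     Cond 9 {0} (foldr (\<lambda>x c. Cond 1 {letter_code x} (STEP k x) c) (letters k) Skip) Skip ;; Pop 1)"

text \<open>Here \<open>w\<close> is given in the order of application; \<open>i\<close> letters have been removed from stack 1,
  \<open>l\<close> units of fuel have been consumed, and \<open>j\<close> letters have been applied.\<close>

definition state :: "nat \<Rightarrow> letter list \<Rightarrow> nat \<Rightarrow> nat \<Rightarrow> nat \<Rightarrow> stacks" where
  "state k w i l j = (case trace k (fuel k (length w)) w j of ((b, st), e) \<Rightarrow>
     put (empty(1 := map letter_code (drop i w), 2 := replicate (fuel k (length w) - l) 1,
       9 := (if e then [1] else []))) b st)"

definition word_dom :: "nat \<Rightarrow> nat \<Rightarrow> letter list \<Rightarrow> bool" where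
  "word_dom k Z w \<longleftrightarrow> w \<in> words k \<and> length w = Z"

lemma ptime_PROCESS: "ptime (word_dom k) (PROCESS k) (\<lambda>w. state k w 0 0 0) (\<lambda>w. state k w (length w) (length w) (length w))"
proof -
  let ?D = "\<lambda>Z (w, j). word_dom k Z w \<and> j < length w"
  let ?B = "\<lambda>w. fuel k (length w)"
  let ?dispatch = "foldr (\<lambda>x c. Cond 1 {letter_code x} (STEP k x) c) (letters k) Skip"
  define err where "err = (\<lambda>(w, j). snd (trace k (?B w) w j))"
  define h where "h = (\<lambda>(w, j). (state k w j (Suc j) j, ?B w - Suc j,
     fst (fst (trace k (?B w) w j)), snd (fst (trace k (?B w) w j))))"
  \<comment> \<open>Dominates the bit bound \<open>B + 1 + j * 2 ^ k\<close> of
    \<open>trace_correct\<close> and exceeds the fuel \<open>B\<close>, where \<open>B\<close> is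
    \<open>(2 ^ k + 1) * Z + 2\<close> and \<open>j < Z\<close>.\<close>
  define q :: "nat poly" where "q = [:4, 2 ^ k + 1 + 2 ^ k:]"
  have w_letter: "index (w ! j) \<le> k" "peek (state k w j l j 1) = letter_code (w ! j)"
    "state k w j l j 1 = letter_code (w ! j) # map letter_code (drop (Suc j) w)"
    if "?D Z (w, j)" for Z w j l
  proof -
    have "w ! j \<in> set w" using that by simp
    then show "index (w ! j) \<le> k" using that by (auto simp: word_dom_def words_def)
    show *: "state k w j l j 1 = letter_code (w ! j) # map letter_code (drop (Suc j) w)"
      using that by (auto simp: state_def simp flip: Cons_nth_drop_Suc split: prod.splits)
    show "peek (state k w j l j 1) = letter_code (w ! j)" using * by simp
  qed
  have dom: "step_dom (poly q Z) (h z)" if z: "?D Z z" and e: "\<not> err z" for Z z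
  proof -
    obtain w j where wj: "z = (w, j)" by force
    obtain b st e where t: "trace k (?B w) w j = ((b, st), e)" by (metis prod.collapse)
    have w: "w \<in> words k" "length w = Z" "j < Z" using z by (auto simp: wj word_dom_def)
    have "bits_le (?B w + 1 + j * 2 ^ k) b st"
      using trace_correct[of w k "?B w" j] w t by (auto simp: words_def fuel_def)
    moreover have "?B w + 1 + j * 2 ^ k \<le> poly q Z"
    proof -
      have "j * 2 ^ k \<le> Z * 2 ^ k" using w by (intro mult_le_mono1) simp
      moreover have "?B w + 1 + Z * 2 ^ k \<le> poly q Z" using w by (simp add: q_def fuel_def algebra_simps)
      ultimately show ?thesis by linarith
    qed
    ultimately have b: "bits_le (poly q Z) b st" by (rule bits_le_mono)
    moreover have "?B w < poly q Z" using w by (simp add: q_def fuel_def algebra_simps)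
    ultimately show ?thesis using length_enc_bits_le[OF b] e
      by (auto simp: wj h_def t state_def step_dom_def cfg_dom_def err_def)
  qed
  let ?f = "\<lambda>(w, j). state k w j (Suc j) j" and ?g = "\<lambda>(w, j). state k w j (Suc j) (Suc j)"
  have dispatch: "ptime (\<lambda>Z z. ?D Z z \<and> \<not> err z) ?dispatch ?f ?g"
  proof (rule ptime_dispatch[where l = "\<lambda>(w, j). w ! j"])
    fix x assume x: "x \<in> set (letters k)"
    show "ptime (\<lambda>Z z. (?D Z z \<and> \<not> err z) \<and> (case z of (w, j) \<Rightarrow> w ! j) = x) (STEP k x) ?f ?g"
    proof (rule ptime_use[OF ptime_STEP, where h = h and q = q])
      show "index x \<le> k" using x by (simp add: set_letters)
      fix Z and z :: "letter list \<times> nat"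
      assume z: "(?D Z z \<and> \<not> err z) \<and> (case z of (w, j) \<Rightarrow> w ! j) = x"
      obtain w j where wj: "z = (w, j)" by force
      obtain b st where t: "trace k (?B w) w j = ((b, st), False)"
        using z by (cases "trace k (?B w) w j") (auto simp: wj err_def)
      have "step_dom (poly q Z) (h z)" using dom z by blast
      moreover have "resstep k x (h z) = ?g z"
        using z by (auto simp: wj h_def t state_def put_result_def fun_eq_iff put_def split: option.splits)
      ultimately show "step_dom (poly q Z) (h z) \<and> fst (h z) = ?f z \<and> resstep k x (h z) = ?g z"
        by (simp add: wj h_def)
    qed
  next
    fix Z and z :: "letter list \<times> nat"
    assume "?D Z z \<and> \<not> err z"
    then show "(case z of (w, j) \<Rightarrow> w ! j) \<in> set (letters k) \<and>
        peek (?f z 1) = letter_code (case z of (w, j) \<Rightarrow> w ! j)"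
      using w_letter by (cases z) (auto simp: set_letters)
  qed
  have skip: "ptime (\<lambda>Z z. ?D Z z \<and> \<not> \<not> err z) Skip ?f ?g"
    by (rule ptime_cong[OF ptime_Skip[where D = "\<lambda>Z z. ?D Z z \<and> err z" and f = ?f]])
      (auto simp: err_def state_def Let_def split: prod.splits)
  have cond: "ptime ?D (Cond 9 {0} ?dispatch Skip) ?f ?g"
    by (rule ptime_cases[where Q = "\<lambda>z. \<not> err z", OF ptime_CondT[OF dispatch] ptime_CondF[OF skip]])
      (auto simp: err_def state_def split: prod.splits)
  have pop: "ptime ?D (Pop 2) (\<lambda>(w, j). state k w j j j) ?f"
    by (rule ptime_Pop) (auto simp: state_def put_def fun_eq_iff tl_replicate split: prod.splits)
  have pop1: "ptime ?D (Pop 1) ?g (\<lambda>(w, j). state k w (Suc j) (Suc j) (Suc j))"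
    by (rule ptime_Pop) (auto simp: state_def put_def fun_eq_iff drop_Suc tl_drop simp flip: map_tl split: prod.splits)
  show ?thesis unfolding PROCESS_def
  proof (rule ptime_Loop[where q = "[:0, 1:]" and F = "\<lambda>w j. state k w j j j"])
    show "ptime (\<lambda>Z (w, j). word_dom k Z w \<and> j < length w) (Pop 2 ;; Cond 9 {0} ?dispatch Skip ;; Pop 1)
        (\<lambda>(w, j). state k w j j j) (\<lambda>(w, j). state k w (Suc j) (Suc j) (Suc j))"
      by (rule ptime_Seq[OF pop ptime_Seq[OF cond pop1]])
    show "peek (state k w j j j 1) \<in> nonblank" if "word_dom k Z w" "j < length w" for Z w j
      using w_letter(2)[of Z w j j] that by (cases "w ! j") auto
  qed (auto simp: state_def word_dom_def split: prod.splits)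
qed

section \<open>Number of stacks and of symbols\<close>

lemma wf_basic: "a < m \<Longrightarrow> b < m \<Longrightarrow> wf_com m g (MOVE a X b)" "a < m \<Longrightarrow> wf_com m g (CLEAR a)"
  "a < m \<Longrightarrow> b < m \<Longrightarrow> 6 < m \<Longrightarrow> wf_com m g (XFER a b)" "a < m \<Longrightarrow> b < m \<Longrightarrow> 6 < m \<Longrightarrow> wf_com m g (COPY a b)"
  "a < m \<Longrightarrow> 6 < m \<Longrightarrow> 5 \<le> g \<Longrightarrow> wf_com m g (INC a)" "a < m \<Longrightarrow> 6 < m \<Longrightarrow> 5 \<le> g \<Longrightarrow> wf_com m g (DEC a)"
  by (simp_all add: MOVE_def CLEAR_def XFER_def COPY_def INC_def DEC_def GROW_def SHRINK_def)

lemma wf_EVAL: "11 + j \<le> m \<Longrightarrow> 5 \<le> g \<Longrightarrow> wf_com m g (EVAL j)"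
  by (induction j) (simp_all add: EVAL0_def wf_basic)

lemma wf_PREIMG: "10 + j \<le> m \<Longrightarrow> 5 \<le> g \<Longrightarrow> wf_com m g (PREIMG j)"
  by (induction j) (simp_all add: wf_basic)

text \<open>Truncated subtraction turns every index into at least 2, so markers go up to
  \<open>5 + max 2 k\<close>, which is below \<open>8 + k\<close> even for small
  \<open>k\<close>.\<close>

lemma wf_INV_APP:
  assumes "12 + k \<le> m" "8 + k \<le> g"
  shows "wf_com m g (INV k d) \<and> wf_com m g (APP k d)"
  using assms
  by (induction d)
    (auto simp: FAIL_def INV_EXPLICIT_def RAW_def PUSHL_def POPL_def wf_basic wf_EVAL wf_PREIMG)

lemma wf_STEP: "12 + k \<le> m \<Longrightarrow> 8 + k \<le> g \<Longrightarrow> index x \<le> k \<Longrightarrow> wf_com m g (STEP k x)"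
  using wf_INV_APP[of k m g]
  by (cases "(k, x)" rule: STEP.cases) (simp_all add: SCALE_def DBL_def HLV_def FAIL_def wf_basic)

definition MACHINE :: "nat \<Rightarrow> com" where
  "MACHINE k = PREPARE k ;; PROCESS k"

text \<open>Besides digits and markers the tape alphabet contains the letter codes, which go up to
  \<open>2 * k + 2\<close>.\<close>

lemma wf_MACHINE: "wf_com (12 + k) (2 * k + 8) (MACHINE k)"
proof -
  let ?m = "12 + k" and ?g = "2 * k + 8"
  have fuel: "wf_com ?m ?g (FUEL n)" for n by (induction n) simp_all
  have "\<forall>x\<in>set xs. index x \<le> k \<Longrightarrow>
      wf_com ?m ?g (foldr (\<lambda>x c. Cond 1 {letter_code x} (STEP k x) c) xs Skip)" for xs
    by (induction xs) (simp_all add: wf_STEP)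
  then have "wf_com ?m ?g (foldr (\<lambda>x c. Cond 1 {letter_code x} (STEP k x) c) (letters k) Skip)"
    by (simp add: set_letters)
  then show ?thesis using fuel by (simp add: MACHINE_def PREPARE_def PROCESS_def)
qed

text \<open>A layered number is positive, and every digit shows the sign, so the top symbols of
  three stacks suffice.\<close>

definition reading :: "(nat \<Rightarrow> nat) \<Rightarrow> verdict" where
  "reading rd = (if rd 9 \<noteq> 0 then Invalid else if rd 5 \<noteq> 0 then Positive else if rd 4 = 0 then Zero
     else if rd 4 \<le> 2 then Positive else Negative)"

theorem theorem1:
  fixes k :: nat
  shows "poly_time_computable letter_code (words k) verdict_of"
proof -
  have 1: "ptime (word_dom k) (PREPARE k) (\<lambda>w. empty(0 := map letter_code w)) (\<lambda>w. state k (rev w) 0 0 0)"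
  proof (rule ptime_use[OF ptime_PREPARE[of k], where h = "map letter_code" and q = "[:0, 1:]"], goal_cases)
    case (1 Z w)
    have "0 \<notin> letter_code ` set w"
    proof
      assume "0 \<in> letter_code ` set w"
      then obtain x where "letter_code x = 0" by auto
      then show False by (cases x) auto
    qed
    then show ?case using 1 by (auto simp: word_dom_def state_def put_def fun_eq_iff rev_map)
  qed
  have 2: "ptime (word_dom k) (PROCESS k) (\<lambda>w. state k (rev w) 0 0 0)
      (\<lambda>w. state k (rev w) (length w) (length w) (length w))"
    by (rule ptime_use[OF ptime_PROCESS[of k], where h = rev and q = "[:0, 1:]"]) (auto simp: word_dom_def words_def)
  obtain p where p: "\<And>Z w. word_dom k Z w \<Longrightarrow> run (MACHINE k) (empty(0 := map letter_code w)) (poly p Z)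
      (state k (rev w) (length w) (length w) (length w))"
    using ptime_Seq[OF 1 2] unfolding ptime_def MACHINE_def by blast
  show ?thesis
  proof (rule compile[where out = reading and p = p and m = "12 + k" and g = "2 * k + 8" and c = "MACHINE k"])
    show "wf_com (12 + k) (2 * k + 8) (MACHINE k)" by (rule wf_MACHINE)
    have "range reading \<subseteq> {Invalid, Negative, Zero, Positive}"
      by (auto simp: reading_def)
    then show "finite (range reading)" by (rule finite_subset) simp
    show "reading rd = reading rd'" if "\<And>i. i < 12 + k \<Longrightarrow> rd i = rd' i" for rd rd'
      using that by (simp add: reading_def)
    show "letter_code ` set w \<subseteq> {0<..<2 * k + 8}" if "w \<in> words k" for w
    proof
      fix y assume "y \<in> letter_code ` set w"
      then obtain x where x: "x \<in> set w" "y = letter_code x" by auto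
      then have "index x \<le> k" using that by (simp add: words_def)
      then show "y \<in> {0<..<2 * k + 8}" using x(2) by (cases x) auto
    qed
    fix w assume w: "w \<in> words k"
    let ?s = "state k (rev w) (length w) (length w) (length w)"
    obtain b st e where t: "trace k (fuel k (length w)) (rev w) (length w) = ((b, st), e)"
      by (metis prod.collapse)
    have "verdict_of w = (if e then Invalid else if st \<noteq> [] then Positive
        else if b < 0 then Negative else if b = 0 then Zero else Positive)"
      using verdict_trace[OF w, of "fuel k (length w)"] t by (simp add: fuel_def)
    then have "reading (\<lambda>i. peek (?s i)) = verdict_of w"
      by (auto simp: reading_def state_def t peek_enc split: if_splits)
    then show "\<exists>s. run (MACHINE k) (empty(0 := map letter_code w)) (poly p (length w)) s \<and>
        reading (\<lambda>i. peek (s i)) = verdict_of w"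
      using p[of "length w" w] w by (auto simp: word_dom_def)
  qed auto
qed

end
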